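(* Let $d\ge 2$ be an integer and let $\mu_\beta^{\varnothing}$ be the free state of the classical Ising model on the Cayley tree $\mathbb{T}^d$ at inverse temperature $\beta\ge 0$. Then: (i) if $0\le\beta\le\operatorname{arctanh}(1/\sqrt d)$, then $\mu_\beta^{\varnothing}$ is extremal; (ii) if $\beta>\operatorname{arctanh}(1/\sqrt d)$, then the extremal decomposition measure of $\mu_\beta^{\varnothing}$ has no atoms (i.e. it gives mass $0$ to each single extremal Gibbs measure), and thus it is supported on uncountably many extremal measures.
   Context: $\mathbb{T}^d$ is the Cayley tree with branching factor $d$, i.e. the infinite tree in which every vertex has degree $d+1$; $V(\mathbb{T}^d)$ is its vertex set, $u\sim v$ means that $uv$ is an edge, and $\Lambda\Subset V(\mathbb{T}^d)$ means that $\Lambda$ is a finite subset. Put $\Omega=\{-1,+1\}^{V(\mathbb{T}^d)}$ with the product $\sigma$-algebra. For $\Lambda\Subset V(\mathbb{T}^d)$ and a boundary condition $\eta\in\{-1,+1\}^{\Lambda^c}$ (or $\eta\in\Omega$, using only its restriction to $\Lambda^c$), the classical Ising model on $\Lambda$ is the probability measure on $\{-1,+1\}^\Lambda$ $$\mu^{\eta}_{\Lambda,\beta}(\sigma)\propto\exp\Big[\beta\sum_{u,v\in\Lambda:\,u\sim v}\sigma_u\sigma_v+\beta\sum_{u\in\Lambda,\,v\in\Lambda^c:\,u\sim v}\sigma_u\eta_v\Big],$$ each edge being counted once (equivalently, this is the $2$-state Potts model with weight $\exp[2\beta\sum\delta_{\sigma_u,\sigma_v}]$). The measure $\mu_{\Lambda,\beta}^{\varnothing}$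 with free boundary conditions is obtained by removing the second sum. The free state $\mu_\beta^{\varnothing}$ is the unique probability measure on $\Omega$ such that for each $\Lambda\Subset V(\mathbb{T}^d)$ inducing a connected subgraph and each $s\in\{-1,+1\}^\Lambda$, $\mu_\beta^{\varnothing}(\sigma_u=s_u\ \forall u\in\Lambda)=\mu^{\varnothing}_{\Lambda,\beta}(\sigma_u=s_u\ \forall u\in\Lambda)$. A probability measure $\mu$ on $\Omega$ is a Gibbs measure if $\mu(A)=\int \mu_{\Lambda,\beta}^{\eta}(A)\,\mu(d\eta)$ for every $\Lambda\Subset V(\mathbb{T}^d)$ and every local event $A$ in $\Lambda$ (an event depending only on the spins in $\Lambda$). The free state is a Gibbs measure. A Gibbs measure $\mu$ is extremal if it cannot be written as $\mu=\lambda\mu_1+(1-\lambda)\mu_2$ with $\lambda\in(0,1)$ and $\mu_1\ne\mu_2$ Gibbs measures. For a Gibbs measure $\mu$, its extremal decomposition measure is the unique probability measure $\lambda_\mu$ on the set of extremal Gibbs measures (with the $\sigma$-algebra generated by the maps $\nu\mapsto\nu(B)$, $B$ an event) such that $\mu(\cdot)=\int\nu(\cdot)\,\lambda_\mu(d\nu)$; its existence and uniqueness is a standard fact. *)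

theory Defs
  imports "HOL-Probability.Probability"
begin

text \<open>
  The tree is given by an adjacency relation whose vertex set is the whole type \<open>'v\<close>;
  by \<open>cayley_tree_def\<close> it is the \<open>(d+1)\<close>-regular tree, which is unique up to isomorphism.
\<close>

definition acyclic_graph :: "('v \<Rightarrow> 'v \<Rightarrow> bool) \<Rightarrow> bool" where
  "acyclic_graph adj \<longleftrightarrow>
     \<not> (\<exists>c. 3 \<le> length c \<and> distinct c \<and>
          (\<forall>i<length c. adj (c ! i) (c ! (Suc i mod length c))))"

definition induces_connected :: "('v \<Rightarrow> 'v \<Rightarrow> bool) \<Rightarrow> 'v set \<Rightarrow> bool" where
  "induces_connected adj \<Lambda> \<longleftrightarrow>
     (\<forall>u\<in>\<Lambda>. \<forall>v\<in>\<Lambda>. (\<lambda>x y. x \<in> \<Lambda> \<and> y \<in> \<Lambda> \<and> adj x y)\<^sup>*\<^sup>* u v)"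

definition cayley_tree :: "nat \<Rightarrow> ('v \<Rightarrow> 'v \<Rightarrow> bool) \<Rightarrow> bool" where
  "cayley_tree d adj \<longleftrightarrow>
     symp adj \<and> irreflp adj \<and> induces_connected adj UNIV \<and> acyclic_graph adj \<and>
     (\<forall>u. card {v. adj u v} = d + 1)"

definition spin_space :: "('v \<Rightarrow> real) measure" where
  "spin_space = (\<Pi>\<^sub>M v\<in>UNIV. count_space {-1, 1})"

definition configs :: "'v set \<Rightarrow> ('v \<Rightarrow> real) set" where
  "configs \<Lambda> = (\<Lambda> \<rightarrow>\<^sub>E {-1, 1})"

text \<open>An edge is the set of its two end points, so the sum counts each edge once.\<close>

definition interior_sum :: "('v \<Rightarrow> 'v \<Rightarrow> bool) \<Rightarrow> 'v set \<Rightarrow> ('v \<Rightarrow> real) \<Rightarrow> real" where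
  "interior_sum adj \<Lambda> \<sigma> =
     (\<Sum>e\<in>{{u, v} |u v. u \<in> \<Lambda> \<and> v \<in> \<Lambda> \<and> adj u v}. \<Prod>w\<in>e. \<sigma> w)"

definition boundary_sum ::
    "('v \<Rightarrow> 'v \<Rightarrow> bool) \<Rightarrow> 'v set \<Rightarrow> ('v \<Rightarrow> real) \<Rightarrow> ('v \<Rightarrow> real) \<Rightarrow> real" where
  "boundary_sum adj \<Lambda> \<eta> \<sigma> = (\<Sum>(u, v)\<in>{(u, v). u \<in> \<Lambda> \<and> v \<notin> \<Lambda> \<and> adj u v}. \<sigma> u * \<eta> v)"

definition boltzmann :: "'v set \<Rightarrow> (('v \<Rightarrow> real) \<Rightarrow> real) \<Rightarrow> ('v \<Rightarrow> real) measure" where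
  "boltzmann \<Lambda> h =
     point_measure (configs \<Lambda>) (\<lambda>\<sigma>. ennreal (exp (h \<sigma>) / (\<Sum>\<tau>\<in>configs \<Lambda>. exp (h \<tau>))))"

definition ising ::
    "('v \<Rightarrow> 'v \<Rightarrow> bool) \<Rightarrow> real \<Rightarrow> 'v set \<Rightarrow> ('v \<Rightarrow> real) \<Rightarrow> ('v \<Rightarrow> real) measure" where
  "ising adj \<beta> \<Lambda> \<eta> =
     boltzmann \<Lambda> (\<lambda>\<sigma>. \<beta> * interior_sum adj \<Lambda> \<sigma> + \<beta> * boundary_sum adj \<Lambda> \<eta> \<sigma>)"

definition ising_free ::
    "('v \<Rightarrow> 'v \<Rightarrow> bool) \<Rightarrow> real \<Rightarrow> 'v set \<Rightarrow> ('v \<Rightarrow> real) measure" where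
  "ising_free adj \<beta> \<Lambda> = boltzmann \<Lambda> (\<lambda>\<sigma>. \<beta> * interior_sum adj \<Lambda> \<sigma>)"

text \<open>The free state is the unique measure with this property.\<close>

definition free_state ::
    "('v \<Rightarrow> 'v \<Rightarrow> bool) \<Rightarrow> real \<Rightarrow> ('v \<Rightarrow> real) measure \<Rightarrow> bool" where
  "free_state adj \<beta> \<mu> \<longleftrightarrow>
     prob_space \<mu> \<and> sets \<mu> = sets spin_space \<and>
     (\<forall>\<Lambda> s. finite \<Lambda> \<longrightarrow> induces_connected adj \<Lambda> \<longrightarrow> s \<in> configs \<Lambda> \<longrightarrow>
        measure \<mu> {\<sigma>\<in>space \<mu>. \<forall>u\<in>\<Lambda>. \<sigma> u = s u} =
        measure (ising_free adj \<beta> \<Lambda>) {\<sigma>\<in>configs \<Lambda>. \<forall>u\<in>\<Lambda>. \<sigma> u = s u})"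

text \<open>A local event in \<open>\<Lambda>\<close> is the set of spin configurations whose restriction to \<open>\<Lambda>\<close>
  lies in some \<open>B \<subseteq> configs \<Lambda>\<close>.\<close>

definition gibbs_measure ::
    "('v \<Rightarrow> 'v \<Rightarrow> bool) \<Rightarrow> real \<Rightarrow> ('v \<Rightarrow> real) measure \<Rightarrow> bool" where
  "gibbs_measure adj \<beta> \<mu> \<longleftrightarrow>
     prob_space \<mu> \<and> sets \<mu> = sets spin_space \<and>
     (\<forall>\<Lambda> B. finite \<Lambda> \<longrightarrow> B \<subseteq> configs \<Lambda> \<longrightarrow>
        emeasure \<mu> {\<sigma>\<in>space \<mu>. restrict \<sigma> \<Lambda> \<in> B} =
        (\<integral>\<^sup>+\<eta>. emeasure (ising adj \<beta> \<Lambda> \<eta>) B \<partial>\<mu>))"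

definition extremal_gibbs ::
    "('v \<Rightarrow> 'v \<Rightarrow> bool) \<Rightarrow> real \<Rightarrow> ('v \<Rightarrow> real) measure \<Rightarrow> bool" where
  "extremal_gibbs adj \<beta> \<mu> \<longleftrightarrow>
     gibbs_measure adj \<beta> \<mu> \<and>
     \<not> (\<exists>t \<mu>1 \<mu>2. 0 < t \<and> t < 1 \<and>
          gibbs_measure adj \<beta> \<mu>1 \<and> gibbs_measure adj \<beta> \<mu>2 \<and> \<mu>1 \<noteq> \<mu>2 \<and>
          (\<forall>A\<in>sets spin_space. measure \<mu> A = t * measure \<mu>1 A + (1 - t) * measure \<mu>2 A))"

text \<open>The \<open>\<sigma>\<close>-algebra of \<open>prob_algebra\<close> is generated by the evaluation maps; its trace on the
  set of extremal Gibbs measures is generated by their restrictions to that set.\<close>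

definition extremal_space ::
    "('v \<Rightarrow> 'v \<Rightarrow> bool) \<Rightarrow> real \<Rightarrow> ('v \<Rightarrow> real) measure measure" where
  "extremal_space adj \<beta> = restrict_space (prob_algebra spin_space) {\<nu>. extremal_gibbs adj \<beta> \<nu>}"

definition extremal_decomposition ::
    "('v \<Rightarrow> 'v \<Rightarrow> bool) \<Rightarrow> real \<Rightarrow> ('v \<Rightarrow> real) measure \<Rightarrow>
     ('v \<Rightarrow> real) measure measure \<Rightarrow> bool" where
  "extremal_decomposition adj \<beta> \<mu> L \<longleftrightarrow>
     prob_space L \<and> sets L = sets (extremal_space adj \<beta>) \<and>
     (\<forall>A\<in>sets spin_space. emeasure \<mu> A = (\<integral>\<^sup>+\<nu>. emeasure \<nu> A \<partial>L))"

end

theory Submission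
  imports Defs
begin

text \<open>
  Root the tree at \<open>r\<close> and put \<open>\<theta> = tanh \<beta>\<close>. In the edge variables \<open>\<xi>\<^sub>v = \<sigma>\<^sub>v \<sigma>\<^sub>p\<close>, \<open>p\<close> the parent of
  \<open>v\<close>, the free state is a product measure with means \<open>\<theta>\<close>.

  (i) Let \<open>x\<^sub>k\<close> be the mean magnetization of a plus spin given the spins \<open>k\<close> levels below. Two
  independent observations \<open>A\<close>, \<open>B\<close> of a spin combine to \<open>(A + B) / (1 + A B)\<close>, which is at most
  \<open>A + B - A\<^sup>2 B - A B\<^sup>2 + A\<^sup>2 B\<^sup>2\<close>. Since \<open>E A = E A\<^sup>2\<close> and \<open>E B = E B\<^sup>2\<close>, its mean is at most
  \<open>1 - (1 - E A) (1 - E B)\<close>, so that \<open>x\<^sub>k\<^sub>+\<^sub>1 \<le> 1 - (1 - \<theta>\<^sup>2 x\<^sub>k)\<^sup>d\<close>, which forces \<open>x\<^sub>k \<rightarrow> 0\<close> if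
  \<open>d \<theta>\<^sup>2 \<le> 1\<close>. A Gibbs measure dominated by a multiple of the free state then has its finite
  marginals bounded by those of the free state, and extremality follows.

  (ii) If \<open>d \<theta>\<^sup>2 > 1\<close>, the normalized sums of the spins \<open>n\<close> levels below a vertex converge almost
  surely. Whether the limits at two children of \<open>v\<close> have the same sign is a tail event that depends
  only on the edges below \<open>v\<close>. For the vertices \<open>v\<close> of one level these events are independent with
  probabilities bounded away from \<open>0\<close> and \<open>1\<close>, whereas each of them is trivial under an extremal
  measure. Hence the free state does not dominate a positive multiple of an extremal measure.
\<close>

section \<open>Local functions on spin space\<close>

text \<open>In edge variables the spin at a vertex drops out: by flip symmetry one computes as if it
  were plus, under a product measure. The identity \<open>E A = E (A^2)\<close> is then Bayes' rule
  for the posterior mean of a hidden spin. The quadratic bound on the combination involves first and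
  second moments only, which this identity merges; that is why the recursion closes at the exact
  threshold. At \<open>d * \<theta>^2 = 1\<close> its linear part no longer contracts, and
  strictness of Bernoulli's inequality for \<open>d \<ge> 2\<close> is what pushes the fixed point
  to 0. In (ii) one tail event of intermediate probability would only refute extremality of the free
  state. Excluding atoms takes many independent ones: an extremal measure of weight \<open>a\<close>
  would force \<open>a \<le> (1 - \<delta>)^N\<close> for every \<open>N\<close>. The sign of a
  single limit is unusable, since it carries the spin of its vertex and hence all edges down to the
  root; comparing two siblings cancels the spin of their parent. The root has \<open>d + 1\<close>
  children, so moment bounds are proved at the other vertices.\<close>

definition cyl :: "'v set \<Rightarrow> ('v \<Rightarrow> real) \<Rightarrow> ('v \<Rightarrow> real) set" where
  "cyl K s = {\<sigma>\<in>space spin_space. restrict \<sigma> K = s}"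

lemma space_spin_space: "space spin_space = (UNIV \<rightarrow>\<^sub>E {-1, 1})"
  by (simp add: spin_space_def space_PiM)

lemma spin_values: "\<sigma> \<in> space spin_space \<Longrightarrow> \<sigma> v = -1 \<or> \<sigma> v = 1"
  by (auto simp: space_spin_space PiE_iff)

lemma spin_square: "\<sigma> \<in> space spin_space \<Longrightarrow> \<sigma> v * \<sigma> v = 1"
  using spin_values[of \<sigma> v] by auto

lemma configs_values: "s \<in> configs K \<Longrightarrow> v \<in> K \<Longrightarrow> s v = -1 \<or> s v = 1"
  by (auto simp: configs_def PiE_iff)

lemma finite_configs [simp]: "finite K \<Longrightarrow> finite (configs K)"
  by (simp add: configs_def finite_PiE)

lemma configs_nonempty [simp]: "configs K \<noteq> {}"
  by (auto simp: configs_def PiE_eq_empty_iff)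

lemma restrict_configs [simp]: "\<sigma> \<in> space spin_space \<Longrightarrow> restrict \<sigma> K \<in> configs K"
  by (auto simp: space_spin_space configs_def PiE_iff)

lemma restrict_configs_eq: "s \<in> configs K \<Longrightarrow> restrict s K = s"
  by (auto simp: configs_def)

lemma measurable_spin [measurable]: "(\<lambda>\<sigma>. \<sigma> v) \<in> measurable spin_space (count_space {-1, 1})"
  unfolding spin_space_def by (rule measurable_component_singleton) simp

lemma borel_measurable_spin [measurable]: "(\<lambda>\<sigma>. \<sigma> v) \<in> borel_measurable spin_space"
  using measurable_compose[OF measurable_spin, of "\<lambda>x. x" borel v] by simp

lemma measurable_into_spin_space:
  assumes "\<And>v. (\<lambda>x. f x v) \<in> borel_measurable M"
    and "\<And>x v. x \<in> space M \<Longrightarrow> f x v = -1 \<or> f x v = 1"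
  shows "f \<in> measurable M spin_space"
  unfolding spin_space_def
proof (rule measurable_PiM_single')
  show "(\<lambda>x. f x v) \<in> measurable M (count_space {-1, 1})" for v
  proof (rule measurable_count_space_eq2[THEN iffD2], goal_cases)
    case 2
    have "(\<lambda>x. f x v) -` {c} \<inter> space M \<in> sets M" for c
      using measurable_sets[OF assms(1), of "{c}" v] by simp
    moreover have "(\<lambda>x. f x v) \<in> space M \<rightarrow> {-1, 1}"
      using assms(2) by auto
    ultimately show ?case by blast
  qed simp
  show "f \<in> space M \<rightarrow> UNIV \<rightarrow>\<^sub>E space (count_space {-1, 1})"
    using assms(2) by auto
qed

lemma cyl_eq: "s \<in> configs K \<Longrightarrow> cyl K s = {\<sigma>\<in>space spin_space. \<forall>u\<in>K. \<sigma> u = s u}"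
  by (auto simp: cyl_def configs_def PiE_iff extensional_def fun_eq_iff restrict_def)

lemma cyl_sets [measurable]:
  assumes "finite K" "s \<in> configs K"
  shows "cyl K s \<in> sets spin_space"
  unfolding cyl_eq[OF assms(2)] using assms(1) by measurable

lemma indicator_cyl: "\<sigma> \<in> space spin_space \<Longrightarrow> indicator (cyl K s) \<sigma> = (if restrict \<sigma> K = s then 1 else 0)"
  by (auto simp: cyl_def indicator_def)

lemma local_function_sum:
  fixes f :: "('v \<Rightarrow> real) \<Rightarrow> 'a::semiring_1"
  assumes "finite K" "f (restrict \<sigma> K) = f \<sigma>" "\<sigma> \<in> space spin_space"
  shows "f \<sigma> = (\<Sum>s\<in>configs K. f s * indicator (cyl K s) \<sigma>)"
proof -
  have "(\<Sum>s\<in>configs K. f s * indicator (cyl K s) \<sigma>) = (\<Sum>s\<in>configs K. if restrict \<sigma> K = s then f s else 0)"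
    by (intro sum.cong) (auto simp: indicator_cyl assms)
  also have "\<dots> = f \<sigma>"
    using assms by simp
  finally show ?thesis by simp
qed

lemma local_measurable:
  fixes f :: "('v \<Rightarrow> real) \<Rightarrow> ennreal"
  assumes K: "finite K" and loc: "\<And>\<sigma>. \<sigma> \<in> space spin_space \<Longrightarrow> f (restrict \<sigma> K) = f \<sigma>"
  shows "f \<in> borel_measurable spin_space"
proof (subst measurable_cong)
  show "f \<sigma> = (\<Sum>s\<in>configs K. f s * indicator (cyl K s) \<sigma>)" if "\<sigma> \<in> space spin_space" for \<sigma>
    by (rule local_function_sum[where f = f, OF K loc[OF that] that])
  show "(\<lambda>\<sigma>. \<Sum>s\<in>configs K. f s * indicator (cyl K s) \<sigma>) \<in> borel_measurable spin_space"
    by (intro borel_measurable_sum borel_measurable_times_ennreal borel_measurable_const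
        borel_measurable_indicator cyl_sets K)
qed

lemma nn_integral_local:
  fixes f :: "('v \<Rightarrow> real) \<Rightarrow> ennreal"
  assumes M: "sets M = sets spin_space" and K: "finite K"
    and loc: "\<And>\<sigma>. \<sigma> \<in> space spin_space \<Longrightarrow> f (restrict \<sigma> K) = f \<sigma>"
  shows "(\<integral>\<^sup>+\<sigma>. f \<sigma> \<partial>M) = (\<Sum>s\<in>configs K. f s * emeasure M (cyl K s))"
proof -
  have sp: "space M = space spin_space" by (rule sets_eq_imp_space_eq[OF M])
  have "(\<integral>\<^sup>+\<sigma>. f \<sigma> \<partial>M) = (\<integral>\<^sup>+\<sigma>. (\<Sum>s\<in>configs K. f s * indicator (cyl K s) \<sigma>) \<partial>M)"
    by (intro nn_integral_cong local_function_sum[where f = f, OF K loc]) (auto simp: sp)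
  also have "\<dots> = (\<Sum>s\<in>configs K. \<integral>\<^sup>+\<sigma>. f s * indicator (cyl K s) \<sigma> \<partial>M)"
    by (intro nn_integral_sum borel_measurable_times_ennreal borel_measurable_const
        borel_measurable_indicator) (simp add: M K)
  also have "\<dots> = (\<Sum>s\<in>configs K. f s * emeasure M (cyl K s))"
    by (intro sum.cong refl nn_integral_cmult_indicator) (simp add: M K)
  finally show ?thesis .
qed

lemma emeasure_local:
  assumes M: "sets M = sets spin_space" and K: "finite K"
    and loc: "\<And>\<sigma>. \<sigma> \<in> space spin_space \<Longrightarrow> P (restrict \<sigma> K) = P \<sigma>"
  shows "emeasure M {\<sigma>\<in>space spin_space. P \<sigma>} = (\<Sum>s\<in>{s\<in>configs K. P s}. emeasure M (cyl K s))"
    and "{\<sigma>\<in>space spin_space. P \<sigma>} \<in> sets spin_space"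
proof -
  have sp: "space M = space spin_space" by (rule sets_eq_imp_space_eq[OF M])
  let ?f = "\<lambda>\<sigma>. if P \<sigma> then 1 else 0 :: ennreal"
  have f: "?f \<in> borel_measurable spin_space"
    by (rule local_measurable[OF K]) (simp add: loc)
  have eq: "{\<sigma>\<in>space spin_space. P \<sigma>} = ?f -` {1} \<inter> space spin_space"
    by (auto split: if_splits)
  show s: "{\<sigma>\<in>space spin_space. P \<sigma>} \<in> sets spin_space"
    unfolding eq using f by (rule measurable_sets) simp
  have "emeasure M {\<sigma>\<in>space spin_space. P \<sigma>} = (\<integral>\<^sup>+\<sigma>. indicator {\<sigma>\<in>space spin_space. P \<sigma>} \<sigma> \<partial>M)"
    using s by (simp add: M)
  also have "\<dots> = (\<integral>\<^sup>+\<sigma>. ?f \<sigma> \<partial>M)"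
    by (intro nn_integral_cong) (auto simp: sp)
  also have "\<dots> = (\<Sum>s\<in>configs K. ?f s * emeasure M (cyl K s))"
    by (rule nn_integral_local[OF M K]) (simp add: loc)
  also have "\<dots> = (\<Sum>s\<in>{s\<in>configs K. P s}. emeasure M (cyl K s))"
    using K by (intro sum.mono_neutral_cong_right) auto
  finally show "emeasure M {\<sigma>\<in>space spin_space. P \<sigma>} = (\<Sum>s\<in>{s\<in>configs K. P s}. emeasure M (cyl K s))" .
qed

text \<open>An event depending on \<open>J\<close> is a finite disjoint union of cylinders over any
  finite \<open>K\<close> containing \<open>J\<close>. Hence a cofinal family of sets
  \<open>K\<close> suffices, and later only balls are ever compared.\<close>

lemma measure_eqI_cyl:
  assumes M: "sets M = sets spin_space" and N: "sets N = sets spin_space" and fin: "finite_measure M"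
    and eq: "\<And>J. finite J \<Longrightarrow> \<exists>K. finite K \<and> J \<subseteq> K \<and>
      (\<forall>s\<in>configs K. emeasure M (cyl K s) = emeasure N (cyl K s))"
  shows "M = N"
proof (rule measure_eqI_PiM_infinite)
  show "sets M = sets (PiM UNIV (\<lambda>_. count_space {-1, 1}))" "sets N = sets (PiM UNIV (\<lambda>_. count_space {-1, 1}))"
    using M N by (simp_all add: spin_space_def)
  show "finite_measure M" by fact
  fix A :: "'a \<Rightarrow> real set" and J :: "'a set"
  assume J: "finite J" and A: "\<And>i. i \<in> J \<Longrightarrow> A i \<in> sets (count_space {-1, 1})"
  obtain K where K: "finite K" "J \<subseteq> K" "\<And>s. s \<in> configs K \<Longrightarrow> emeasure M (cyl K s) = emeasure N (cyl K s)"
    using eq[OF J] by blast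
  have *: "prod_emb UNIV (\<lambda>_. count_space {-1, 1}) J (Pi\<^sub>E J A) = {\<sigma>\<in>space spin_space. \<forall>j\<in>J. \<sigma> j \<in> A j}"
    using A by (auto simp: prod_emb_def space_spin_space PiE_iff)
  show "emeasure M (prod_emb UNIV (\<lambda>_. count_space {-1, 1}) J (Pi\<^sub>E J A)) =
      emeasure N (prod_emb UNIV (\<lambda>_. count_space {-1, 1}) J (Pi\<^sub>E J A))"
    unfolding * using K(2)
    by (subst (1 2) emeasure_local[OF _ K(1)]) (auto simp: M N K(3) intro!: sum.cong ball_cong)
qed

section \<open>The finite-volume kernels\<close>

definition energy ::
    "('v \<Rightarrow> 'v \<Rightarrow> bool) \<Rightarrow> real \<Rightarrow> 'v set \<Rightarrow> ('v \<Rightarrow> real) \<Rightarrow> ('v \<Rightarrow> real) \<Rightarrow> real" where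
  "energy adj \<beta> \<Lambda> \<eta> \<tau> = \<beta> * interior_sum adj \<Lambda> \<tau> + \<beta> * boundary_sum adj \<Lambda> \<eta> \<tau>"

definition kernel ::
    "('v \<Rightarrow> 'v \<Rightarrow> bool) \<Rightarrow> real \<Rightarrow> 'v set \<Rightarrow> ('v \<Rightarrow> real) \<Rightarrow> ('v \<Rightarrow> real) \<Rightarrow> real" where
  "kernel adj \<beta> \<Lambda> \<eta> \<tau> = exp (energy adj \<beta> \<Lambda> \<eta> \<tau>) / (\<Sum>\<tau>'\<in>configs \<Lambda>. exp (energy adj \<beta> \<Lambda> \<eta> \<tau>'))"

lemma emeasure_boltzmann:
  assumes "finite \<Lambda>" "B \<subseteq> configs \<Lambda>"
  shows "emeasure (boltzmann \<Lambda> h) B = (\<Sum>\<sigma>\<in>B. ennreal (exp (h \<sigma>) / (\<Sum>\<tau>\<in>configs \<Lambda>. exp (h \<tau>))))"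
  unfolding boltzmann_def using assms by (subst emeasure_point_measure_finite) auto

lemma emeasure_ising:
  assumes "finite \<Lambda>" "B \<subseteq> configs \<Lambda>"
  shows "emeasure (ising adj \<beta> \<Lambda> \<eta>) B = (\<Sum>\<sigma>\<in>B. ennreal (kernel adj \<beta> \<Lambda> \<eta> \<sigma>))"
  unfolding ising_def kernel_def energy_def by (rule emeasure_boltzmann[OF assms])

lemma kernel_nonneg: "kernel adj \<beta> \<Lambda> \<eta> \<tau> \<ge> 0"
  by (simp add: kernel_def sum_nonneg)

lemma sum_exp_pos: "finite \<Lambda> \<Longrightarrow> (\<Sum>\<tau>\<in>configs \<Lambda>. exp (h \<tau> :: real)) > 0"
  by (intro sum_pos) auto

lemma kernel_sum: "finite \<Lambda> \<Longrightarrow> (\<Sum>\<tau>\<in>configs \<Lambda>. kernel adj \<beta> \<Lambda> \<eta> \<tau>) = 1"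
  using sum_exp_pos[of \<Lambda> "energy adj \<beta> \<Lambda> \<eta>"]
  by (simp add: kernel_def sum_divide_distrib[symmetric])

lemma boundary_sum_cong:
  assumes "\<And>u v. u \<in> \<Lambda> \<Longrightarrow> v \<notin> \<Lambda> \<Longrightarrow> adj u v \<Longrightarrow> \<eta> v = \<eta>' v"
    and "\<And>u. u \<in> \<Lambda> \<Longrightarrow> \<tau> u = \<tau>' u"
  shows "boundary_sum adj \<Lambda> \<eta> \<tau> = boundary_sum adj \<Lambda> \<eta>' \<tau>'"
  unfolding boundary_sum_def using assms by (intro sum.cong) auto

lemma interior_sum_cong:
  assumes "\<And>u. u \<in> \<Lambda> \<Longrightarrow> \<tau> u = \<tau>' u"
  shows "interior_sum adj \<Lambda> \<tau> = interior_sum adj \<Lambda> \<tau>'"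
  unfolding interior_sum_def using assms by (intro sum.cong prod.cong) auto

lemma kernel_cong:
  assumes "\<And>u v. u \<in> \<Lambda> \<Longrightarrow> v \<notin> \<Lambda> \<Longrightarrow> adj u v \<Longrightarrow> \<eta> v = \<eta>' v"
  shows "kernel adj \<beta> \<Lambda> \<eta> \<tau> = kernel adj \<beta> \<Lambda> \<eta>' \<tau>"
proof -
  have "energy adj \<beta> \<Lambda> \<eta> = energy adj \<beta> \<Lambda> \<eta>'"
    unfolding energy_def using boundary_sum_cong[of \<Lambda> adj \<eta> \<eta>'] assms by (intro ext) metis
  then show ?thesis by (simp add: kernel_def)
qed

definition merge_at :: "'v set \<Rightarrow> ('v \<Rightarrow> real) \<Rightarrow> ('v \<Rightarrow> real) \<Rightarrow> 'v \<Rightarrow> real" where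
  "merge_at \<Lambda> t \<omega> = (\<lambda>v. if v \<in> \<Lambda> then t v else \<omega> v)"

lemma sum_configs_split:
  assumes "\<Lambda> \<subseteq> K"
  shows "(\<Sum>\<tau>\<in>configs K. F \<tau>) = (\<Sum>\<omega>\<in>configs (K - \<Lambda>). \<Sum>t\<in>configs \<Lambda>. F (merge_at \<Lambda> t \<omega>))"
proof -
  have "(\<Sum>\<omega>\<in>configs (K - \<Lambda>). \<Sum>t\<in>configs \<Lambda>. F (merge_at \<Lambda> t \<omega>)) =
      (\<Sum>(\<omega>, t)\<in>configs (K - \<Lambda>) \<times> configs \<Lambda>. F (merge_at \<Lambda> t \<omega>))"
    by (rule sum.cartesian_product)
  also have "\<dots> = (\<Sum>\<tau>\<in>configs K. F \<tau>)"
    by (rule sum.reindex_bij_witness[where i = "\<lambda>\<tau>. (restrict \<tau> (K - \<Lambda>), restrict \<tau> \<Lambda>)"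
          and j = "\<lambda>(\<omega>, t). merge_at \<Lambda> t \<omega>"])
      (use assms in \<open>auto simp: configs_def merge_at_def PiE_iff extensional_def fun_eq_iff restrict_def
        split: if_splits\<close>)
  finally show ?thesis by simp
qed

text \<open>The weight splits into a factor for the inside of \<open>\<Lambda>\<close> and factors
  \<open>exp (r \<omega>)\<close> and \<open>F0 \<omega>\<close> seen only outside, so summing over
  the inside turns the indicator of \<open>t\<close> into its conditional probability.
  \<open>E\<close> is left abstract to cover both the free energy of a ball and the energy with a
  boundary condition.\<close>

lemma finite_volume_dlr:
  fixes E F :: "('v \<Rightarrow> real) \<Rightarrow> real"
  assumes K: "finite K" "\<Lambda> \<subseteq> K" and t: "t \<in> configs \<Lambda>"
    and E: "\<And>t \<omega>. t \<in> configs \<Lambda> \<Longrightarrow> \<omega> \<in> configs (K - \<Lambda>) \<Longrightarrow>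
      E (merge_at \<Lambda> t \<omega>) = energy adj \<beta> \<Lambda> \<omega> t + r \<omega>"
    and F: "\<And>t \<omega>. t \<in> configs \<Lambda> \<Longrightarrow> \<omega> \<in> configs (K - \<Lambda>) \<Longrightarrow> F (merge_at \<Lambda> t \<omega>) = F0 \<omega>"
  shows "(\<Sum>\<tau>\<in>configs K. exp (E \<tau>) * F \<tau> * (if restrict \<tau> \<Lambda> = t then 1 else 0)) =
    (\<Sum>\<tau>\<in>configs K. exp (E \<tau>) * F \<tau> * kernel adj \<beta> \<Lambda> \<tau> t)"
  unfolding sum_configs_split[OF K(2)]
proof (rule sum.cong[OF refl])
  fix \<omega> assume w: "\<omega> \<in> configs (K - \<Lambda>)"
  have fL: "finite \<Lambda>" using K finite_subset by blast
  have r: "restrict (merge_at \<Lambda> t' \<omega>) \<Lambda> = t'" if "t' \<in> configs \<Lambda>" for t'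
    using that by (auto simp: merge_at_def configs_def PiE_iff extensional_def fun_eq_iff restrict_def)
  have k: "kernel adj \<beta> \<Lambda> (merge_at \<Lambda> t' \<omega>) t = kernel adj \<beta> \<Lambda> \<omega> t" for t'
    by (rule kernel_cong) (auto simp: merge_at_def)
  let ?Z = "\<Sum>t'\<in>configs \<Lambda>. exp (energy adj \<beta> \<Lambda> \<omega> t')"
  have Z: "?Z > 0" by (rule sum_exp_pos[OF fL])
  have "(\<Sum>t'\<in>configs \<Lambda>. exp (E (merge_at \<Lambda> t' \<omega>)) * F (merge_at \<Lambda> t' \<omega>) *
        (if restrict (merge_at \<Lambda> t' \<omega>) \<Lambda> = t then 1 else 0)) =
      (\<Sum>t'\<in>configs \<Lambda>. if t' = t then exp (energy adj \<beta> \<Lambda> \<omega> t) * exp (r \<omega>) * F0 \<omega> else 0)"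
    using w by (intro sum.cong) (auto simp: r E F exp_add)
  also have "\<dots> = exp (energy adj \<beta> \<Lambda> \<omega> t) * exp (r \<omega>) * F0 \<omega>"
    using t fL by simp
  \<comment> \<open>The single surviving Boltzmann factor is \<open>?Z\<close> times the kernel;
    expanding \<open>?Z\<close> again gives the sum over all inner configurations on the
    right.\<close>
  also have "\<dots> = ?Z * (exp (r \<omega>) * F0 \<omega> * kernel adj \<beta> \<Lambda> \<omega> t)"
    using Z by (simp add: kernel_def)
  also have "\<dots> = (\<Sum>t'\<in>configs \<Lambda>. exp (E (merge_at \<Lambda> t' \<omega>)) * F (merge_at \<Lambda> t' \<omega>) *
        kernel adj \<beta> \<Lambda> (merge_at \<Lambda> t' \<omega>) t)"
    unfolding sum_distrib_right using w by (intro sum.cong) (auto simp: k E F exp_add)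
  finally show "(\<Sum>t'\<in>configs \<Lambda>. exp (E (merge_at \<Lambda> t' \<omega>)) * F (merge_at \<Lambda> t' \<omega>) *
        (if restrict (merge_at \<Lambda> t' \<omega>) \<Lambda> = t then 1 else 0)) =
    (\<Sum>t'\<in>configs \<Lambda>. exp (E (merge_at \<Lambda> t' \<omega>)) * F (merge_at \<Lambda> t' \<omega>) *
        kernel adj \<beta> \<Lambda> (merge_at \<Lambda> t' \<omega>) t)" .
qed

section \<open>Gibbs measures and tail events\<close>

text \<open>The kernel on \<Lambda> reads its boundary condition only in this finite set, which is
  what makes it a local function.\<close>

definition closed_nbhd :: "('v \<Rightarrow> 'v \<Rightarrow> bool) \<Rightarrow> 'v set \<Rightarrow> 'v set" where
  "closed_nbhd adj \<Lambda> = \<Lambda> \<union> (\<Union>u\<in>\<Lambda>. {v. adj u v})"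

text \<open>Tail measurability is encoded as invariance under changing finitely many spins. One
  implication is enough because the two configurations may be exchanged.\<close>

definition tail_event :: "('v \<Rightarrow> real) set \<Rightarrow> bool" where
  "tail_event T \<longleftrightarrow> T \<in> sets spin_space \<and>
    (\<forall>\<Lambda> \<sigma> \<sigma>'. finite \<Lambda> \<longrightarrow> \<sigma> \<in> space spin_space \<longrightarrow> \<sigma>' \<in> space spin_space \<longrightarrow>
      (\<forall>v. v \<notin> \<Lambda> \<longrightarrow> \<sigma> v = \<sigma>' v) \<longrightarrow> \<sigma> \<in> T \<longrightarrow> \<sigma>' \<in> T)"

locale locally_finite_graph =
  fixes adj :: "'v \<Rightarrow> 'v \<Rightarrow> bool"
  assumes sym: "adj u v \<Longrightarrow> adj v u" and irrefl: "\<not> adj u u"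
    and finite_nbhd: "finite {v. adj u v}"
begin

lemma finite_closed_nbhd: "finite \<Lambda> \<Longrightarrow> finite (closed_nbhd adj \<Lambda>)"
  by (auto simp: closed_nbhd_def finite_nbhd)

text \<open>Edges of \<open>K\<close> are sorted by having two, one or no end points in \<Lambda>.
  As the neighbours of \<Lambda> lie in \<open>K\<close>, the middle class consists of all boundary
  edges of \<Lambda>.\<close>

lemma interior_sum_split:
  assumes K: "finite K" and L: "closed_nbhd adj \<Lambda> \<subseteq> K"
  shows "interior_sum adj K \<tau> = interior_sum adj \<Lambda> \<tau> + boundary_sum adj \<Lambda> \<tau> \<tau> + interior_sum adj (K - \<Lambda>) \<tau>"
proof -
  define E where "E S = {{u, v} |u v. u \<in> S \<and> v \<in> S \<and> adj u v}" for S
  define X where "X = {(u, v). u \<in> \<Lambda> \<and> v \<notin> \<Lambda> \<and> adj u v}"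
  have LK: "\<Lambda> \<subseteq> K" and NK: "\<And>u v. u \<in> \<Lambda> \<Longrightarrow> adj u v \<Longrightarrow> v \<in> K"
    using L by (auto simp: closed_nbhd_def)
  have finE: "finite (E S)" if "S \<subseteq> K" for S
  proof (rule finite_subset)
    show "E S \<subseteq> (\<lambda>(u, v). {u, v}) ` (K \<times> K)" using that by (auto simp: E_def)
  qed (use K in auto)
  have finX: "finite X"
    by (rule finite_subset[of _ "K \<times> K"]) (use K LK NK in \<open>auto simp: X_def\<close>)
  have EK: "E K = E \<Lambda> \<union> (\<lambda>(u, v). {u, v}) ` X \<union> E (K - \<Lambda>)"
  proof (intro equalityI subsetI)
    fix e assume "e \<in> E K"
    then obtain u v where uv: "e = {u, v}" "u \<in> K" "v \<in> K" "adj u v" "adj v u"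
      using sym by (auto simp: E_def)
    consider "u \<in> \<Lambda>" "v \<in> \<Lambda>" | "u \<in> \<Lambda>" "v \<notin> \<Lambda>" | "u \<notin> \<Lambda>" "v \<in> \<Lambda>" | "u \<notin> \<Lambda>" "v \<notin> \<Lambda>" by blast
    then show "e \<in> E \<Lambda> \<union> (\<lambda>(u, v). {u, v}) ` X \<union> E (K - \<Lambda>)"
    proof cases
      case 1 then show ?thesis using uv by (auto simp: E_def)
    next
      case 2
      then have "(u, v) \<in> X" using uv by (auto simp: X_def)
      then show ?thesis using uv by force
    next
      case 3
      then have "(v, u) \<in> X" using uv by (auto simp: X_def)
      then show ?thesis using uv by (auto simp: insert_commute intro!: image_eqI[of _ _ "(v, u)"])
    next
      case 4 then show ?thesis using uv by (auto simp: E_def)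
    qed
  next
    fix e assume "e \<in> E \<Lambda> \<union> (\<lambda>(u, v). {u, v}) ` X \<union> E (K - \<Lambda>)"
    moreover have "E \<Lambda> \<subseteq> E K" "E (K - \<Lambda>) \<subseteq> E K"
      using LK by (auto simp: E_def)
    moreover have "{u, v} \<in> E K" if "(u, v) \<in> X" for u v
    proof -
      have "u \<in> K" "v \<in> K" "adj u v" using that LK NK[of u v] by (auto simp: X_def)
      then show ?thesis unfolding E_def by blast
    qed
    ultimately show "e \<in> E K" by auto
  qed
  have d1: "(E \<Lambda> \<union> (\<lambda>(u, v). {u, v}) ` X) \<inter> E (K - \<Lambda>) = {}"
    by (auto simp: E_def X_def doubleton_eq_iff)
  have d2: "E \<Lambda> \<inter> (\<lambda>(u, v). {u, v}) ` X = {}"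
    by (auto simp: E_def X_def doubleton_eq_iff)
  have inj: "inj_on (\<lambda>(u, v). {u, v}) X"
    by (auto simp: inj_on_def X_def doubleton_eq_iff)
  have "(\<Sum>e\<in>(\<lambda>(u, v). {u, v}) ` X. \<Prod>w\<in>e. \<tau> w) = (\<Sum>(u, v)\<in>X. \<tau> u * \<tau> v)"
  proof (subst sum.reindex[OF inj], rule sum.cong[OF refl])
    fix x assume "x \<in> X"
    then obtain u v where "x = (u, v)" "u \<noteq> v" by (auto simp: X_def)
    then show "((\<lambda>e. \<Prod>w\<in>e. \<tau> w) \<circ> (\<lambda>(u, v). {u, v})) x = (case x of (u, v) \<Rightarrow> \<tau> u * \<tau> v)"
      by simp
  qed
  moreover have "interior_sum adj S \<tau> = (\<Sum>e\<in>E S. \<Prod>w\<in>e. \<tau> w)" for S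
    by (simp add: interior_sum_def E_def)
  moreover have "boundary_sum adj \<Lambda> \<tau> \<tau> = (\<Sum>(u, v)\<in>X. \<tau> u * \<tau> v)"
    by (simp add: boundary_sum_def X_def)
  moreover have "(\<Sum>e\<in>E K. \<Prod>w\<in>e. \<tau> w) = (\<Sum>e\<in>E \<Lambda>. \<Prod>w\<in>e. \<tau> w) +
      (\<Sum>e\<in>(\<lambda>(u, v). {u, v}) ` X. \<Prod>w\<in>e. \<tau> w) + (\<Sum>e\<in>E (K - \<Lambda>). \<Prod>w\<in>e. \<tau> w)"
    unfolding EK
    by (subst sum.union_disjoint, use finE LK finX d1 in simp_all)
      (subst sum.union_disjoint, use finE LK finX d2 in simp_all)
  ultimately show ?thesis by simp
qed

lemma interior_sum_merge:
  assumes K: "finite K" and L: "closed_nbhd adj \<Lambda> \<subseteq> K"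
  shows "\<beta> * interior_sum adj K (merge_at \<Lambda> t \<omega>) = energy adj \<beta> \<Lambda> \<omega> t + \<beta> * interior_sum adj (K - \<Lambda>) \<omega>"
proof -
  have "interior_sum adj \<Lambda> (merge_at \<Lambda> t \<omega>) = interior_sum adj \<Lambda> t"
    "interior_sum adj (K - \<Lambda>) (merge_at \<Lambda> t \<omega>) = interior_sum adj (K - \<Lambda>) \<omega>"
    "boundary_sum adj \<Lambda> (merge_at \<Lambda> t \<omega>) (merge_at \<Lambda> t \<omega>) = boundary_sum adj \<Lambda> \<omega> t"
    by (auto intro!: interior_sum_cong boundary_sum_cong simp: merge_at_def)
  then show ?thesis
    using interior_sum_split[OF K L] by (simp add: energy_def algebra_simps)
qed

text \<open>No edge leaving \<open>K\<close> starts in \<Lambda>, so the boundary term of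
  \<open>K\<close> does not see the inner configuration \<open>t\<close>.\<close>

lemma energy_merge:
  assumes K: "finite K" and L: "closed_nbhd adj \<Lambda> \<subseteq> K"
  shows "energy adj \<beta> K \<eta> (merge_at \<Lambda> t \<omega>) = energy adj \<beta> \<Lambda> \<omega> t +
    (\<beta> * interior_sum adj (K - \<Lambda>) \<omega> + \<beta> * boundary_sum adj K \<eta> \<omega>)"
proof -
  have NK: "\<And>u v. u \<in> \<Lambda> \<Longrightarrow> adj u v \<Longrightarrow> v \<in> K"
    using L by (auto simp: closed_nbhd_def)
  have "(\<Sum>(u, v)\<in>{(u, v). u \<in> K \<and> v \<notin> K \<and> adj u v}. merge_at \<Lambda> t \<omega> u * \<eta> v) =
      (\<Sum>(u, v)\<in>{(u, v). u \<in> K \<and> v \<notin> K \<and> adj u v}. \<omega> u * \<eta> v)"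
  proof (rule sum.cong[OF refl], clarify)
    fix u v assume "v \<notin> K" "adj u v"
    then have "u \<notin> \<Lambda>" using NK by blast
    then show "merge_at \<Lambda> t \<omega> u * \<eta> v = \<omega> u * \<eta> v" by (simp add: merge_at_def)
  qed
  then have "boundary_sum adj K \<eta> (merge_at \<Lambda> t \<omega>) = boundary_sum adj K \<eta> \<omega>"
    by (simp add: boundary_sum_def)
  then show ?thesis
    using interior_sum_merge[OF K L, of \<beta> t \<omega>] by (simp add: energy_def[of _ _ K])
qed

lemma kernel_restrict:
  assumes "closed_nbhd adj \<Lambda> \<subseteq> K"
  shows "kernel adj \<beta> \<Lambda> (restrict \<eta> K) t = kernel adj \<beta> \<Lambda> \<eta> t"
  by (rule kernel_cong) (use assms in \<open>auto simp: closed_nbhd_def\<close>)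

lemma kernel_measurable:
  assumes "finite \<Lambda>"
  shows "(\<lambda>\<eta>. ennreal (kernel adj \<beta> \<Lambda> \<eta> t)) \<in> borel_measurable spin_space"
  by (rule local_measurable[OF finite_closed_nbhd[OF assms]]) (simp add: kernel_restrict)

lemma gibbs_measureD:
  assumes "gibbs_measure adj \<beta> \<mu>"
  shows "prob_space \<mu>" "sets \<mu> = sets spin_space" "space \<mu> = space spin_space"
proof -
  show "prob_space \<mu>"
    by (rule assms[unfolded gibbs_measure_def, THEN conjunct1])
  show s: "sets \<mu> = sets spin_space"
    by (rule assms[unfolded gibbs_measure_def, THEN conjunct2, THEN conjunct1])
  show "space \<mu> = space spin_space"
    by (rule sets_eq_imp_space_eq[OF s])
qed

text \<open>Both sides of the defining identity are additive in \<open>B\<close>, so it may be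
  tested on single configurations.\<close>

lemma gibbs_measure_iff:
  "gibbs_measure adj \<beta> \<mu> \<longleftrightarrow> prob_space \<mu> \<and> sets \<mu> = sets spin_space \<and>
     (\<forall>\<Lambda> t. finite \<Lambda> \<longrightarrow> t \<in> configs \<Lambda> \<longrightarrow>
        emeasure \<mu> (cyl \<Lambda> t) = (\<integral>\<^sup>+\<eta>. ennreal (kernel adj \<beta> \<Lambda> \<eta> t) \<partial>\<mu>))" (is "?L \<longleftrightarrow> ?R")
proof
  assume L: ?L
  then have s: "sets \<mu> = sets spin_space" and sp: "space \<mu> = space spin_space"
    by (rule gibbs_measureD)+
  show ?R
  proof (intro conjI allI impI)
    show "prob_space \<mu>" "sets \<mu> = sets spin_space"
      using L by (rule gibbs_measureD)+
    fix \<Lambda> :: "'v set" and t :: "'v \<Rightarrow> real" assume *: "finite \<Lambda>" "t \<in> configs \<Lambda>"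
    then have "emeasure \<mu> {\<sigma>\<in>space \<mu>. restrict \<sigma> \<Lambda> \<in> {t}} =
        (\<integral>\<^sup>+\<eta>. emeasure (ising adj \<beta> \<Lambda> \<eta>) {t} \<partial>\<mu>)"
      using L unfolding gibbs_measure_def by blast
    also have "\<dots> = (\<integral>\<^sup>+\<eta>. ennreal (kernel adj \<beta> \<Lambda> \<eta> t) \<partial>\<mu>)"
      using * by (subst emeasure_ising) auto
    finally show "emeasure \<mu> (cyl \<Lambda> t) = (\<integral>\<^sup>+\<eta>. ennreal (kernel adj \<beta> \<Lambda> \<eta> t) \<partial>\<mu>)"
      by (simp add: cyl_def sp)
  qed
next
  assume R: ?R
  then have s: "sets \<mu> = sets spin_space" and sp: "space \<mu> = space spin_space"
    and k: "\<And>\<Lambda> t. finite \<Lambda> \<Longrightarrow> t \<in> configs \<Lambda> \<Longrightarrow>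
        emeasure \<mu> (cyl \<Lambda> t) = (\<integral>\<^sup>+\<eta>. ennreal (kernel adj \<beta> \<Lambda> \<eta> t) \<partial>\<mu>)"
    using sets_eq_imp_space_eq[of \<mu> spin_space] by blast+
  show ?L
    unfolding gibbs_measure_def
  proof (intro conjI allI impI)
    show "prob_space \<mu>" "sets \<mu> = sets spin_space"
      using R by blast+
    fix \<Lambda> :: "'v set" and B assume *: "finite \<Lambda>" "B \<subseteq> configs \<Lambda>"
    have "emeasure \<mu> {\<sigma>\<in>space \<mu>. restrict \<sigma> \<Lambda> \<in> B} = (\<Sum>t\<in>{t\<in>configs \<Lambda>. restrict t \<Lambda> \<in> B}. emeasure \<mu> (cyl \<Lambda> t))"
      unfolding sp using * by (intro emeasure_local[OF s]) auto
    also have "{t\<in>configs \<Lambda>. restrict t \<Lambda> \<in> B} = B"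
      using * by (auto simp: restrict_configs_eq)
    also have "(\<Sum>t\<in>B. emeasure \<mu> (cyl \<Lambda> t)) = (\<Sum>t\<in>B. \<integral>\<^sup>+\<eta>. ennreal (kernel adj \<beta> \<Lambda> \<eta> t) \<partial>\<mu>)"
      using * by (intro sum.cong refl k) auto
    also have "\<dots> = (\<integral>\<^sup>+\<eta>. (\<Sum>t\<in>B. ennreal (kernel adj \<beta> \<Lambda> \<eta> t)) \<partial>\<mu>)"
      by (intro nn_integral_sum[symmetric]) (simp add: measurable_cong_sets[OF s refl] kernel_measurable *)
    also have "\<dots> = (\<integral>\<^sup>+\<eta>. emeasure (ising adj \<beta> \<Lambda> \<eta>) B \<partial>\<mu>)"
      by (simp add: emeasure_ising[OF *])
    finally show "emeasure \<mu> {\<sigma>\<in>space \<mu>. restrict \<sigma> \<Lambda> \<in> B} = (\<integral>\<^sup>+\<eta>. emeasure (ising adj \<beta> \<Lambda> \<eta>) B \<partial>\<mu>)" .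
  qed
qed

text \<open>The definition tests only events inside \<Lambda>, whereas \<open>F\<close> looks at
  spins outside. Passing to the larger volume \<open>K\<close>, both integrals become averages over
  the kernel of \<open>K\<close>, and inside \<open>K\<close> the identity is a finite sum.\<close>

lemma gibbs_local_dlr:
  assumes g: "gibbs_measure adj \<beta> \<nu>" and L: "finite \<Lambda>" "t \<in> configs \<Lambda>"
    and K: "finite K" "closed_nbhd adj \<Lambda> \<subseteq> K"
    and locF: "\<And>\<sigma>. F (restrict \<sigma> K) = F \<sigma>"
    and F: "\<And>t \<omega>. F (merge_at \<Lambda> t \<omega>) = F \<omega>" and F0: "\<And>\<sigma>. F \<sigma> \<ge> (0::real)"
  shows "(\<integral>\<^sup>+\<sigma>. ennreal (F \<sigma>) * indicator (cyl \<Lambda> t) \<sigma> \<partial>\<nu>) = (\<integral>\<^sup>+\<sigma>. ennreal (F \<sigma> * kernel adj \<beta> \<Lambda> \<sigma> t) \<partial>\<nu>)"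
proof -
  have s: "sets \<nu> = sets spin_space" and sp: "space \<nu> = space spin_space"
    and gk: "\<And>s. s \<in> configs K \<Longrightarrow> emeasure \<nu> (cyl K s) = (\<integral>\<^sup>+\<eta>. ennreal (kernel adj \<beta> K \<eta> s) \<partial>\<nu>)"
    using gibbs_measureD[OF g] g K(1) unfolding gibbs_measure_iff by blast+
  have LK: "\<Lambda> \<subseteq> K" using K(2) by (auto simp: closed_nbhd_def)
  have loc: "(\<integral>\<^sup>+\<sigma>. ennreal (f \<sigma>) \<partial>\<nu>) = (\<integral>\<^sup>+\<eta>. ennreal (\<Sum>\<tau>\<in>configs K. f \<tau> * kernel adj \<beta> K \<eta> \<tau>) \<partial>\<nu>)"
    if f: "\<And>\<sigma>. f (restrict \<sigma> K) = f \<sigma>" and f0: "\<And>\<sigma>. f \<sigma> \<ge> 0" for f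
  proof -
    have "(\<integral>\<^sup>+\<sigma>. ennreal (f \<sigma>) \<partial>\<nu>) = (\<Sum>\<tau>\<in>configs K. ennreal (f \<tau>) * emeasure \<nu> (cyl K \<tau>))"
      by (rule nn_integral_local[OF s K(1)]) (simp add: f)
    also have "\<dots> = (\<Sum>\<tau>\<in>configs K. \<integral>\<^sup>+\<eta>. ennreal (f \<tau>) * ennreal (kernel adj \<beta> K \<eta> \<tau>) \<partial>\<nu>)"
      by (intro sum.cong refl)
        (simp add: gk nn_integral_cmult measurable_cong_sets[OF s refl] kernel_measurable K(1))
    also have "\<dots> = (\<integral>\<^sup>+\<eta>. (\<Sum>\<tau>\<in>configs K. ennreal (f \<tau>) * ennreal (kernel adj \<beta> K \<eta> \<tau>)) \<partial>\<nu>)"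
      by (intro nn_integral_sum[symmetric] borel_measurable_times_ennreal borel_measurable_const)
        (simp add: measurable_cong_sets[OF s refl] kernel_measurable K(1))
    also have "\<dots> = (\<integral>\<^sup>+\<eta>. ennreal (\<Sum>\<tau>\<in>configs K. f \<tau> * kernel adj \<beta> K \<eta> \<tau>) \<partial>\<nu>)"
      by (simp add: f0 kernel_nonneg ennreal_mult[symmetric])
    finally show ?thesis .
  qed
  let ?i = "\<lambda>\<sigma>. if restrict \<sigma> \<Lambda> = t then 1 else 0 :: real"
  have Int: "K \<inter> \<Lambda> = \<Lambda>" using LK by blast
  have "(\<integral>\<^sup>+\<sigma>. ennreal (F \<sigma>) * indicator (cyl \<Lambda> t) \<sigma> \<partial>\<nu>) = (\<integral>\<^sup>+\<sigma>. ennreal (F \<sigma> * ?i \<sigma>) \<partial>\<nu>)"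
    by (intro nn_integral_cong) (auto simp: indicator_cyl sp)
  also have "\<dots> = (\<integral>\<^sup>+\<eta>. ennreal (\<Sum>\<tau>\<in>configs K. F \<tau> * ?i \<tau> * kernel adj \<beta> K \<eta> \<tau>) \<partial>\<nu>)"
    by (rule loc) (auto simp: locF F0 Int)
  also have "\<dots> = (\<integral>\<^sup>+\<eta>. ennreal (\<Sum>\<tau>\<in>configs K. F \<tau> * kernel adj \<beta> \<Lambda> \<tau> t * kernel adj \<beta> K \<eta> \<tau>) \<partial>\<nu>)"
  proof (intro nn_integral_cong arg_cong[of _ _ ennreal])
    fix \<eta>
    have "(\<Sum>\<tau>\<in>configs K. exp (energy adj \<beta> K \<eta> \<tau>) * F \<tau> * ?i \<tau>) =
      (\<Sum>\<tau>\<in>configs K. exp (energy adj \<beta> K \<eta> \<tau>) * F \<tau> * kernel adj \<beta> \<Lambda> \<tau> t)"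
      by (rule finite_volume_dlr[where F = F and F0 = F, OF K(1) LK L(2) energy_merge[OF K]]) (rule F)
    then show "(\<Sum>\<tau>\<in>configs K. F \<tau> * ?i \<tau> * kernel adj \<beta> K \<eta> \<tau>) =
        (\<Sum>\<tau>\<in>configs K. F \<tau> * kernel adj \<beta> \<Lambda> \<tau> t * kernel adj \<beta> K \<eta> \<tau>)"
      by (simp add: kernel_def[of _ _ K] sum_divide_distrib[symmetric] mult_ac)
  qed
  also have "\<dots> = (\<integral>\<^sup>+\<sigma>. ennreal (F \<sigma> * kernel adj \<beta> \<Lambda> \<sigma> t) \<partial>\<nu>)"
    by (rule loc[symmetric]) (auto simp: locF F0 kernel_restrict K kernel_nonneg)
  finally show ?thesis .
qed

text \<open>A tail event is not local, so the identity is lifted through measures. The map \<phi>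
  overwrites \<Lambda> by plus spins; the images of \<nu>, weighted by the indicator of the cylinder
  and by the kernel, agree on cylinders by the local identity and hence on every event. A tail event
  does not notice the overwriting.\<close>

lemma gibbs_tail_dlr:
  assumes g: "gibbs_measure adj \<beta> \<nu>" and L: "finite \<Lambda>" "t \<in> configs \<Lambda>" and T: "tail_event T"
  shows "emeasure \<nu> (T \<inter> cyl \<Lambda> t) = (\<integral>\<^sup>+\<sigma>. ennreal (kernel adj \<beta> \<Lambda> \<sigma> t) * indicator T \<sigma> \<partial>\<nu>)"
proof -
  have s [measurable_cong]: "sets \<nu> = sets spin_space" and sp: "space \<nu> = space spin_space"
    and P: "prob_space \<nu>"
    by (rule gibbs_measureD[OF g])+
  interpret prob_space \<nu> by fact
  define \<phi> where "\<phi> = (merge_at \<Lambda> (\<lambda>_. 1) :: ('v \<Rightarrow> real) \<Rightarrow> 'v \<Rightarrow> real)"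
  have \<phi> [measurable]: "\<phi> \<in> measurable spin_space spin_space"
    unfolding \<phi>_def
    by (rule measurable_into_spin_space) (auto simp: merge_at_def dest: spin_values)
  have TS [measurable]: "T \<in> sets spin_space"
    using T by (simp add: tail_event_def)
  have \<phi>s: "\<phi> \<sigma> \<in> space spin_space" if "\<sigma> \<in> space spin_space" for \<sigma>
    using measurable_space[OF \<phi> that] .
  have T\<phi>: "\<phi> \<sigma> \<in> T \<longleftrightarrow> \<sigma> \<in> T" if "\<sigma> \<in> space spin_space" for \<sigma>
  proof -
    have "\<forall>v. v \<notin> \<Lambda> \<longrightarrow> \<sigma> v = \<phi> \<sigma> v" by (simp add: \<phi>_def merge_at_def)
    then show ?thesis
      using T that \<phi>s[OF that] L(1) unfolding tail_event_def by metis
  qed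
  note [measurable] = kernel_measurable[OF L(1)] cyl_sets[OF L]
  have dd: "emeasure (distr (density \<nu> f) spin_space \<phi>) A = (\<integral>\<^sup>+\<sigma>. indicator A (\<phi> \<sigma>) * f \<sigma> \<partial>\<nu>)"
    if A: "A \<in> sets spin_space" and f: "f \<in> borel_measurable \<nu>" for A f
  proof -
    have pre: "\<phi> -` A \<inter> space spin_space \<in> sets \<nu>"
      using measurable_sets[OF \<phi> A] by (simp add: s)
    have "emeasure (distr (density \<nu> f) spin_space \<phi>) A = emeasure (density \<nu> f) (\<phi> -` A \<inter> space spin_space)"
      using A by (subst emeasure_distr) (auto simp: sp)
    also have "\<dots> = (\<integral>\<^sup>+\<sigma>. f \<sigma> * indicator (\<phi> -` A \<inter> space spin_space) \<sigma> \<partial>\<nu>)"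
      by (rule emeasure_density[OF f pre])
    also have "\<dots> = (\<integral>\<^sup>+\<sigma>. indicator A (\<phi> \<sigma>) * f \<sigma> \<partial>\<nu>)"
      by (intro nn_integral_cong) (auto simp: sp indicator_def)
    finally show ?thesis .
  qed
  define M where "M = distr (density \<nu> (indicator (cyl \<Lambda> t))) spin_space \<phi>"
  define N where "N = distr (density \<nu> (\<lambda>\<sigma>. ennreal (kernel adj \<beta> \<Lambda> \<sigma> t))) spin_space \<phi>"
  have M: "emeasure M A = (\<integral>\<^sup>+\<sigma>. indicator A (\<phi> \<sigma>) * indicator (cyl \<Lambda> t) \<sigma> \<partial>\<nu>)" if "A \<in> sets spin_space" for A
    unfolding M_def by (rule dd[OF that]) (simp add: s cyl_sets[OF L])
  have N: "emeasure N A = (\<integral>\<^sup>+\<sigma>. indicator A (\<phi> \<sigma>) * ennreal (kernel adj \<beta> \<Lambda> \<sigma> t) \<partial>\<nu>)" if "A \<in> sets spin_space" for A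
    unfolding N_def by (rule dd[OF that]) (simp only: measurable_cong_sets[OF s refl] kernel_measurable[OF L(1)])
  have "M = N"
  proof (rule measure_eqI_cyl)
    show "finite_measure M"
    proof
      have "emeasure M (space spin_space) \<le> (\<integral>\<^sup>+\<sigma>. 1 \<partial>\<nu>)"
        unfolding M[OF sets.top] by (intro nn_integral_mono) (auto simp: indicator_def)
      then have "emeasure M (space spin_space) \<le> 1" by (simp add: emeasure_space_1)
      then show "emeasure M (space M) \<noteq> \<infinity>" by (auto simp: M_def top_unique)
    qed
    fix J :: "'v set" assume J: "finite J"
    define K where "K = J \<union> closed_nbhd adj \<Lambda>"
    have K: "finite K" "closed_nbhd adj \<Lambda> \<subseteq> K" "J \<subseteq> K" and LK: "\<Lambda> \<subseteq> K"
      using J finite_closed_nbhd[OF L(1)] by (auto simp: K_def closed_nbhd_def)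
    have "emeasure M (cyl K s) = emeasure N (cyl K s)" if s: "s \<in> configs K" for s
    proof -
      define F where "F \<sigma> = (if restrict (\<phi> \<sigma>) K = s then 1 else 0 :: real)" for \<sigma>
      have ind: "indicator (cyl K s) (\<phi> \<sigma>) = ennreal (F \<sigma>)" if "\<sigma> \<in> space \<nu>" for \<sigma>
        using \<phi>s that by (simp add: F_def indicator_cyl sp)
      have loc: "F (restrict \<sigma> K) = F \<sigma>" for \<sigma>
      proof -
        have "restrict (\<phi> (restrict \<sigma> K)) K = restrict (\<phi> \<sigma>) K"
          by (auto simp: \<phi>_def merge_at_def fun_eq_iff restrict_def)
        then show ?thesis by (simp add: F_def)
      qed
      have mg: "F (merge_at \<Lambda> t' \<omega>) = F \<omega>" for t' \<omega>
      proof -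
        have "\<phi> (merge_at \<Lambda> t' \<omega>) = \<phi> \<omega>" by (auto simp: \<phi>_def merge_at_def)
        then show ?thesis by (simp add: F_def)
      qed
      have "emeasure M (cyl K s) = (\<integral>\<^sup>+\<sigma>. ennreal (F \<sigma>) * indicator (cyl \<Lambda> t) \<sigma> \<partial>\<nu>)"
        unfolding M[OF cyl_sets[OF K(1) s]] by (intro nn_integral_cong) (simp add: ind)
      also have "\<dots> = (\<integral>\<^sup>+\<sigma>. ennreal (F \<sigma> * kernel adj \<beta> \<Lambda> \<sigma> t) \<partial>\<nu>)"
        by (rule gibbs_local_dlr[OF g L K(1,2) loc mg]) (simp add: F_def)
      also have "\<dots> = emeasure N (cyl K s)"
        unfolding N[OF cyl_sets[OF K(1) s]]
        by (intro nn_integral_cong) (simp add: ind ennreal_mult'' kernel_nonneg)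
      finally show ?thesis .
    qed
    then show "\<exists>K. finite K \<and> J \<subseteq> K \<and> (\<forall>s\<in>configs K. emeasure M (cyl K s) = emeasure N (cyl K s))"
      using K by (intro exI[of _ K]) simp
  qed (simp_all add: M_def N_def)
  then have MN: "emeasure M T = emeasure N T" by simp
  have ind: "indicator T (\<phi> \<sigma>) = (indicator T \<sigma> :: ennreal)" if "\<sigma> \<in> space \<nu>" for \<sigma>
    using T\<phi>[of \<sigma>] that by (simp add: indicator_def sp)
  have MT: "emeasure M T = emeasure \<nu> (T \<inter> cyl \<Lambda> t)"
  proof -
    have "emeasure M T = (\<integral>\<^sup>+\<sigma>. indicator (T \<inter> cyl \<Lambda> t) \<sigma> \<partial>\<nu>)"
      unfolding M[OF TS] by (intro nn_integral_cong) (simp add: ind indicator_inter_arith)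
    also have "\<dots> = emeasure \<nu> (T \<inter> cyl \<Lambda> t)"
      by (intro nn_integral_indicator sets.Int) (simp_all only: s TS cyl_sets[OF L])
    finally show ?thesis .
  qed
  have NT: "emeasure N T = (\<integral>\<^sup>+\<sigma>. ennreal (kernel adj \<beta> \<Lambda> \<sigma> t) * indicator T \<sigma> \<partial>\<nu>)"
    unfolding N[OF TS] by (intro nn_integral_cong) (simp add: ind mult.commute)
  show ?thesis using MN unfolding MT NT .
qed

text \<open>Changing spins in \<Lambda> does not affect membership in \<open>T\<close>, so
  conditioning on \<open>T\<close> commutes with resampling \<Lambda>.\<close>

lemma gibbs_conditioned_on_tail_event:
  assumes g: "gibbs_measure adj \<beta> \<nu>" and T: "tail_event T" and pos: "emeasure \<nu> T \<noteq> 0"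
  shows "gibbs_measure adj \<beta> (uniform_measure \<nu> T)"
  unfolding gibbs_measure_iff
proof (intro conjI allI impI)
  have s: "sets \<nu> = sets spin_space" and P: "prob_space \<nu>"
    by (rule gibbs_measureD[OF g])+
  interpret prob_space \<nu> by fact
  have TS: "T \<in> sets spin_space"
    using T by (simp add: tail_event_def)
  show "prob_space (uniform_measure \<nu> T)"
    by (rule prob_space_uniform_measure) (use pos in \<open>simp_all add: emeasure_eq_measure\<close>)
  show "sets (uniform_measure \<nu> T) = sets spin_space"
    by (simp add: s)
  fix \<Lambda> :: "'v set" and t :: "'v \<Rightarrow> real" assume L: "finite \<Lambda>" "t \<in> configs \<Lambda>"
  have "emeasure (uniform_measure \<nu> T) (cyl \<Lambda> t) = emeasure \<nu> (T \<inter> cyl \<Lambda> t) / emeasure \<nu> T"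
    by (rule emeasure_uniform_measure) (simp_all only: s TS cyl_sets[OF L])
  also have "\<dots> = (\<integral>\<^sup>+\<eta>. ennreal (kernel adj \<beta> \<Lambda> \<eta> t) \<partial>(uniform_measure \<nu> T))"
    unfolding gibbs_tail_dlr[OF g L T]
  proof (rule nn_integral_uniform_measure[symmetric])
    show "(\<lambda>\<eta>. ennreal (kernel adj \<beta> \<Lambda> \<eta> t)) \<in> borel_measurable \<nu>"
      unfolding measurable_cong_sets[OF s refl] by (rule kernel_measurable[OF L(1)])
    show "T \<in> sets \<nu>" using TS by (simp only: s)
  qed
  finally show "emeasure (uniform_measure \<nu> T) (cyl \<Lambda> t) = (\<integral>\<^sup>+\<eta>. ennreal (kernel adj \<beta> \<Lambda> \<eta> t) \<partial>(uniform_measure \<nu> T))" .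
qed

lemma tail_eventD:
  assumes "tail_event T" "finite \<Lambda>" "\<sigma> \<in> space spin_space" "\<sigma>' \<in> space spin_space"
    "\<And>v. v \<notin> \<Lambda> \<Longrightarrow> \<sigma> v = \<sigma>' v" "\<sigma> \<in> T"
  shows "\<sigma>' \<in> T"
proof -
  have a: "finite \<Lambda> \<longrightarrow> \<sigma> \<in> space spin_space \<longrightarrow> \<sigma>' \<in> space spin_space \<longrightarrow>
      (\<forall>v. v \<notin> \<Lambda> \<longrightarrow> \<sigma> v = \<sigma>' v) \<longrightarrow> \<sigma> \<in> T \<longrightarrow> \<sigma>' \<in> T"
    using assms(1) unfolding tail_event_def by (elim conjE allE)
  have b: "\<forall>v. v \<notin> \<Lambda> \<longrightarrow> \<sigma> v = \<sigma>' v" using assms(5) by (intro allI impI)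
  show ?thesis by (rule a[THEN mp, THEN mp, THEN mp, THEN mp, THEN mp, OF assms(2,3,4) b assms(6)])
qed

lemma tail_event_compl:
  fixes T :: "('v \<Rightarrow> real) set"
  assumes T: "tail_event T"
  shows "tail_event (space spin_space - T)"
proof -
  have "\<sigma>' \<notin> T" if *: "finite \<Lambda>" "\<sigma> \<in> space spin_space" "\<sigma>' \<in> space spin_space"
    "\<forall>v. v \<notin> \<Lambda> \<longrightarrow> \<sigma> v = \<sigma>' v" "\<sigma> \<notin> T" for \<Lambda> \<sigma> \<sigma>'
  proof
    have b: "\<And>v. v \<notin> \<Lambda> \<Longrightarrow> \<sigma>' v = \<sigma> v" using *(4) by (metis (full_types))
    assume "\<sigma>' \<in> T"
    then have "\<sigma> \<in> T"
      using tail_eventD[where \<sigma> = \<sigma>' and \<sigma>' = \<sigma>, OF T *(1,3,2)] b by blast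
    with *(5) show False by (rule notE)
  qed
  moreover have "T \<in> sets spin_space" using T unfolding tail_event_def by (rule conjunct1)
  ultimately show ?thesis unfolding tail_event_def by (intro conjI allI impI DiffI sets.compl_sets) (assumption | elim DiffE)+
qed
text \<open>Otherwise \<nu> is a mixture of its conditionings on \<open>T\<close> and on the
  complement. Both are Gibbs, and they differ because they give \<open>T\<close> mass 1 and
  0.\<close>

lemma extremal_tail_trivial:
  assumes e: "extremal_gibbs adj \<beta> \<nu>" and T: "tail_event T"
  shows "measure \<nu> T = 0 \<or> measure \<nu> T = 1"
proof (rule ccontr)
  assume n: "\<not> ?thesis"
  have g: "gibbs_measure adj \<beta> \<nu>" using e by (simp add: extremal_gibbs_def)
  then have s: "sets \<nu> = sets spin_space" and sp: "space \<nu> = space spin_space" and P: "prob_space \<nu>"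
    by (rule gibbs_measureD)+
  interpret prob_space \<nu> by fact
  define T' where "T' = space spin_space - T"
  have TS: "T \<in> sets \<nu>" "T' \<in> sets \<nu>"
    using T by (auto simp: tail_event_def s T'_def)
  have t: "0 < measure \<nu> T" "measure \<nu> T < 1"
    using n prob_le_1[of T] measure_nonneg[of \<nu> T] by linarith+
  have T'm: "measure \<nu> T' = 1 - measure \<nu> T"
    using TS prob_compl[of T] by (simp add: T'_def sp)
  have m: "measure (uniform_measure \<nu> S) A = measure \<nu> (S \<inter> A) / measure \<nu> S"
    if "S \<in> sets \<nu>" "A \<in> sets \<nu>" "measure \<nu> S > 0" for S A
    using that by (intro measure_uniform_measure) (auto simp: emeasure_eq_measure)
  have "gibbs_measure adj \<beta> (uniform_measure \<nu> T)"
    by (rule gibbs_conditioned_on_tail_event[OF g T]) (use t in \<open>simp add: emeasure_eq_measure\<close>)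
  moreover have "gibbs_measure adj \<beta> (uniform_measure \<nu> T')"
    unfolding T'_def
    by (rule gibbs_conditioned_on_tail_event[OF g tail_event_compl[OF T]])
      (use t T'm in \<open>simp add: emeasure_eq_measure T'_def\<close>)
  moreover have "uniform_measure \<nu> T \<noteq> uniform_measure \<nu> T'"
  proof
    assume "uniform_measure \<nu> T = uniform_measure \<nu> T'"
    then have "measure (uniform_measure \<nu> T) T = measure (uniform_measure \<nu> T') T" by simp
    moreover have "T' \<inter> T = {}" by (auto simp: T'_def)
    ultimately show False using t T'm TS by (simp add: m)
  qed
  moreover have "measure \<nu> A = measure \<nu> T * measure (uniform_measure \<nu> T) A +
      (1 - measure \<nu> T) * measure (uniform_measure \<nu> T') A" if "A \<in> sets spin_space" for A
  proof -
    have A: "A \<in> sets \<nu>" using that s by simp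
    have "measure \<nu> A = measure \<nu> (T \<inter> A) + measure \<nu> (T' \<inter> A)"
      using TS A sets.sets_into_space[OF A]
      by (subst finite_measure_Union[symmetric]) (auto simp: T'_def sp intro!: arg_cong[of _ _ "measure \<nu>"])
    then show ?thesis using t T'm TS A by (simp add: m)
  qed
  ultimately have "\<exists>t \<mu>1 \<mu>2. 0 < t \<and> t < 1 \<and>
          gibbs_measure adj \<beta> \<mu>1 \<and> gibbs_measure adj \<beta> \<mu>2 \<and> \<mu>1 \<noteq> \<mu>2 \<and>
          (\<forall>A\<in>sets spin_space. measure \<nu> A = t * measure \<mu>1 A + (1 - t) * measure \<mu>2 A)"
    using t by (intro exI conjI ballI)
  then show False using e unfolding extremal_gibbs_def by (elim conjE) (erule notE)
qed

end

section \<open>The rooted Cayley tree\<close>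

lemma rtranclp_imp_distinct_path:
  assumes "R\<^sup>*\<^sup>* x y"
  shows "\<exists>xs. xs \<noteq> [] \<and> hd xs = x \<and> last xs = y \<and> distinct xs \<and> successively R xs"
  using assms
proof (induction rule: converse_rtranclp_induct)
  case base
  show ?case by (rule exI[of _ "[y]"]) simp
next
  case (step x z)
  then obtain xs where xs: "xs \<noteq> []" "hd xs = z" "last xs = y" "distinct xs" "successively R xs"
    by blast
  show ?case
  proof (cases "x \<in> set xs")
    case True
    then obtain ps qs where "xs = ps @ x # qs"
      by (meson split_list)
    with xs show ?thesis
      by (intro exI[of _ "x # qs"]) (auto simp: successively_append_iff)
  next
    case False
    with xs step(1) show ?thesis
      by (intro exI[of _ "x # xs"]) (auto simp: successively_Cons)
  qed
qed

text \<open>A path between two neighbours of \<open>v\<close> that avoids \<open>v\<close> closes up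
  through \<open>v\<close> to a cycle; since \<open>u\<close> and \<open>u'\<close> differ, the
  cycle has at least three vertices.\<close>

lemma acyclic_graph_neighbours_separated:
  assumes acyc: "acyclic_graph adj" and sym: "\<And>x y. adj x y \<Longrightarrow> adj y x"
    and vu: "adj v u" "adj v u'" "u \<noteq> u'"
    and path: "(\<lambda>x y. adj x y \<and> x \<noteq> v \<and> y \<noteq> v)\<^sup>*\<^sup>* u u'"
  shows False
proof -
  let ?R = "\<lambda>x y. adj x y \<and> x \<noteq> v \<and> y \<noteq> v"
  obtain xs where xs: "xs \<noteq> []" "hd xs = u" "last xs = u'" "distinct xs" "successively ?R xs"
    using rtranclp_imp_distinct_path[OF path] by blast
  have len: "2 \<le> length xs"
    using xs vu(3) by (cases xs; cases "tl xs") auto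
  have R: "?R (xs ! i) (xs ! Suc i)" if "Suc i < length xs" for i
    using successively_nth[OF xs(5) that] .
  have "x \<noteq> v" if x: "x \<in> set xs" for x
  proof -
    obtain i where i: "i < length xs" "xs ! i = x"
      using x by (auto simp: in_set_conv_nth)
    show ?thesis
    proof (cases "Suc i < length xs")
      case True then show ?thesis using R i by blast
    next
      case False
      then obtain j where "i = Suc j" using i len by (cases i) auto
      then show ?thesis using R[of j] i by blast
    qed
  qed
  then have "distinct (v # xs)" using xs by auto
  moreover have "3 \<le> length (v # xs)" using len by simp
  moreover have "adj ((v # xs) ! i) ((v # xs) ! (Suc i mod length (v # xs)))" if "i < length (v # xs)" for i
  proof (cases i)
    case 0
    then show ?thesis using len vu xs by (cases xs) auto
  next
    case (Suc j)
    show ?thesis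
    proof (cases "Suc j < length xs")
      case True
      then show ?thesis using R[OF True] Suc by simp
    next
      case False
      then have "Suc i = length (v # xs)" "j = length xs - 1" using that Suc by auto
      then show ?thesis using Suc xs(1,3) sym[OF vu(2)] by (simp add: last_conv_nth)
    qed
  qed
  ultimately show False
    using acyc unfolding acyclic_graph_def by blast
qed

locale rooted_cayley_tree =
  fixes d :: nat and adj :: "'v \<Rightarrow> 'v \<Rightarrow> bool" and r :: 'v
  assumes d2: "2 \<le> d" and tree: "cayley_tree d adj"
begin

lemma finite_nbhd: "finite {v. adj u v}"
  using tree unfolding cayley_tree_def by (intro card_ge_0_finite) simp

sublocale locally_finite_graph adj
proof
  show "adj u v \<Longrightarrow> adj v u" for u v
    using tree unfolding cayley_tree_def by (blast dest: sympD)
  show "\<not> adj u u" for u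
    using tree unfolding cayley_tree_def by (blast dest: irreflpD)
  show "finite {v. adj u v}" for u
    by (rule finite_nbhd)
qed

lemma acyclic: "acyclic_graph adj" and degree: "card {v. adj u v} = d + 1"
  and connected: "adj\<^sup>*\<^sup>* u v"
  using tree unfolding cayley_tree_def induces_connected_def by simp_all

definition lev :: "'v \<Rightarrow> nat" where
  "lev v = (LEAST n. (adj ^^ n) r v)"

abbreviation level :: "nat \<Rightarrow> 'v set" where
  "level n \<equiv> {v. lev v = n}"

text \<open>\<open>par r\<close> is an arbitrary vertex.\<close>

definition par :: "'v \<Rightarrow> 'v" where
  "par v = (SOME u. adj v u \<and> lev u < lev v)"

definition ch :: "'v \<Rightarrow> 'v set" where
  "ch v = {u. u \<noteq> r \<and> par u = v}"

definition ball :: "nat \<Rightarrow> 'v set" where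
  "ball n = {v. lev v \<le> n}"

text \<open>Membership is expressed through an iterate of \<open>par\<close> that depends only on
  the levels, so that subtrees of distinct vertices of one level are disjoint at once: the same
  iterate cannot have two values.\<close>

definition desc :: "'v \<Rightarrow> 'v set" where
  "desc v = {u. lev v \<le> lev u \<and> (par ^^ (lev u - lev v)) u = v}"

lemma lev_path: "(adj ^^ lev v) r v"
proof -
  obtain n where "(adj ^^ n) r v"
    using connected[of r v] by (auto simp: rtranclp_power)
  then show ?thesis unfolding lev_def by (rule LeastI)
qed

lemma lev_le: "(adj ^^ n) r v \<Longrightarrow> lev v \<le> n"
  unfolding lev_def by (rule Least_le)

lemma lev_step: "adj u v \<Longrightarrow> lev v \<le> Suc (lev u)"
  using lev_path[of u] by (intro lev_le) auto

lemma lev_root [simp]: "lev r = 0"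
  using lev_le[of 0 r] by simp

lemma lev_0: "lev v = 0 \<longleftrightarrow> v = r"
  using lev_path[of v] by auto

lemma lev_pred:
  assumes "v \<noteq> r"
  shows "\<exists>u. adj v u \<and> lev u < lev v"
proof -
  obtain n where n: "lev v = Suc n"
    using assms lev_0 by (cases "lev v") auto
  then have "(adj ^^ Suc n) r v" using lev_path[of v] by simp
  then obtain u where "(adj ^^ n) r u" "adj u v" by (rule relpowp_Suc_E)
  then show ?thesis using lev_le[of n u] n sym[of u v] by (intro exI[of _ u]) auto
qed

text \<open>After its first vertex, a path that strictly decreases in level stays below the level of
  \<open>v\<close> and thus cannot meet it.\<close>

lemma path_to_root_avoiding:
  "u \<noteq> v \<Longrightarrow> lev u \<le> lev v \<Longrightarrow> (\<lambda>x y. adj x y \<and> x \<noteq> v \<and> y \<noteq> v)\<^sup>*\<^sup>* u r"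
proof (induction "lev u" arbitrary: u rule: less_induct)
  case less
  show ?case
  proof (cases "u = r")
    case False
    then obtain w where w: "adj u w" "lev w < lev u" using lev_pred by blast
    then have "w \<noteq> v" "lev w \<le> lev v" using less.prems by auto
    then show ?thesis
      using w less.hyps[of w] less.prems by (intro converse_rtranclp_into_rtranclp[of _ u w]) auto
  qed simp
qed

text \<open>Two such neighbours would be joined through the root without passing \<open>v\<close>.
  Allowing equality of levels also rules out edges inside a level, which makes every edge a
  parent-child edge.\<close>

lemma lower_neighbour_unique:
  assumes "adj v u" "adj v u'" "lev u \<le> lev v" "lev u' \<le> lev v"
  shows "u = u'"
proof (rule ccontr)
  assume ne: "u \<noteq> u'"
  let ?R = "\<lambda>x y. adj x y \<and> x \<noteq> v \<and> y \<noteq> v"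
  have nv: "u \<noteq> v" "u' \<noteq> v" using assms(1,2) irrefl[of v] by metis+
  have s: "symp ?R" by (rule sympI) (simp add: sym)
  have a: "?R\<^sup>*\<^sup>* u' r" by (rule path_to_root_avoiding[OF nv(2) assms(4)])
  have b: "?R\<^sup>*\<^sup>* u r" by (rule path_to_root_avoiding[OF nv(1) assms(3)])
  have c: "?R\<^sup>*\<^sup>* r u'" by (rule sympD[OF symp_rtranclp[OF s] a])
  have e: "?R\<^sup>*\<^sup>* u u'" by (rule rtranclp_trans[OF b c]) 
  show False by (rule acyclic_graph_neighbours_separated[OF acyclic _ assms(1,2) ne e]) (rule sym)
qed

lemma par: assumes "v \<noteq> r" shows "adj v (par v)" "lev v = Suc (lev (par v))"
proof -
  have *: "adj v (par v) \<and> lev (par v) < lev v"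
    unfolding par_def by (rule someI_ex[OF lev_pred[OF assms]])
  then show a: "adj v (par v)" by simp
  show "lev v = Suc (lev (par v))" using * lev_step[OF sym[OF a]] by simp
qed

lemma par_unique: "adj v u \<Longrightarrow> lev u \<le> lev v \<Longrightarrow> v \<noteq> r \<and> u = par v"
proof -
  assume *: "adj v u" "lev u \<le> lev v"
  have "v \<noteq> r"
  proof
    assume "v = r"
    then have "u = r" using * lev_0[of u] by simp
    with \<open>v = r\<close> * irrefl show False by blast
  qed
  moreover from this have "u = par v"
    using * par[of v] by (intro lower_neighbour_unique[of v]) simp_all
  ultimately show ?thesis by blast
qed

lemma adj_cases:
  assumes "adj u v"
  obtains "u \<noteq> r" "v = par u" | "v \<noteq> r" "u = par v"
proof (cases "lev v \<le> lev u")
  case True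
  then show ?thesis using par_unique[OF assms] that(1) by blast
next
  case False
  then show ?thesis using par_unique[OF sym[OF assms]] that(2) by simp
qed

lemma ch_iff: "c \<in> ch v \<longleftrightarrow> c \<noteq> r \<and> par c = v" 
  unfolding ch_def by (rule mem_Collect_eq)

lemma chD: "c \<in> ch v \<Longrightarrow> c \<noteq> r \<and> par c = v \<and> lev c = Suc (lev v) \<and> adj v c"
proof -
  assume c: "c \<in> ch v"
  have 1: "c \<noteq> r" by (rule c[unfolded ch_iff, THEN conjunct1])
  have 2: "par c = v" by (rule c[unfolded ch_iff, THEN conjunct2])
  have 3: "lev c = Suc (lev v)" by (rule par(2)[OF 1, unfolded 2])
  have 4: "adj v c" by (rule sym[OF par(1)[OF 1, unfolded 2]])
  show ?thesis by (intro conjI 1 2 3 4)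
qed

lemma ch_eq: "ch v = {u. adj v u} - (if v = r then {} else {par v})"
proof (intro equalityI subsetI)
  fix u assume u: "u \<in> ch v"
  have 1: "adj v u" and 2: "lev u = Suc (lev v)"
    using chD[OF u] by blast+
  have "u \<noteq> par v" if "v \<noteq> r"
  proof
    assume "u = par v"
    then have "lev v = Suc (lev u)" using par(2)[OF that] by simp
    with 2 show False by linarith
  qed
  with 1 show "u \<in> {u. adj v u} - (if v = r then {} else {par v})"
    by simp
next
  fix u assume u: "u \<in> {u. adj v u} - (if v = r then {} else {par v})"
  then have "adj v u" by simp
  then consider "v \<noteq> r" "u = par v" | "u \<noteq> r" "par u = v"
    using adj_cases[of v u] by metis
  then show "u \<in> ch v"
  proof cases
    case 1
    then show ?thesis using u by simp
  next
    case 2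
    then show ?thesis by (simp add: ch_iff)
  qed
qed

lemma finite_ch [simp]: "finite (ch v)"
  unfolding ch_eq using finite_nbhd by simp

lemma card_ch: "v \<noteq> r \<Longrightarrow> card (ch v) = d"
  using par[of v] degree[of v] finite_nbhd[of v] by (simp add: ch_eq card_Diff_singleton)

lemma card_ch_root: "card (ch r) = d + 1"
  using degree[of r] by (simp add: ch_eq)

lemma card_ch_ge: "2 \<le> card (ch v)"
  using d2 card_ch[of v] card_ch_root by (cases "v = r") auto

lemma level_Suc: "level (Suc n) = (\<Union>u\<in>level n. ch u)"
proof (intro equalityI subsetI)
  fix v assume "v \<in> level (Suc n)"
  then have v: "lev v = Suc n" by simp
  then have "v \<noteq> r" using lev_root by force
  with v have "v \<noteq> r" "lev (par v) = n" using par(2)[of v] by simp_all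
  then show "v \<in> (\<Union>u\<in>level n. ch u)" by (simp add: ch_iff)
next
  fix v assume "v \<in> (\<Union>u\<in>level n. ch u)"
  then obtain u where "lev u = n" "v \<in> ch u" by blast
  then show "v \<in> level (Suc n)" using chD[of v u] by simp
qed

lemma finite_level [simp]: "finite (level n)"
proof (induction n)
  case 0
  show ?case using lev_0 by simp
next
  case (Suc n)
  then show ?case unfolding level_Suc by simp
qed

lemma ball_Suc: "ball (Suc n) = ball n \<union> level (Suc n)"
  by (auto simp: ball_def)

lemma ball_0: "ball 0 = {r}"
  using lev_0 by (auto simp: ball_def)

lemma finite_ball [simp]: "finite (ball n)"
  by (induction n) (auto simp: ball_0 ball_Suc)

lemma ball_exhausts:
  assumes "finite J"
  shows "\<exists>n\<ge>m. J \<subseteq> ball n"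
proof -
  have "J \<subseteq> ball (max m (Max (insert 0 (lev ` J))))"
    using assms by (auto simp: ball_def intro: le_max_iff_disj[THEN iffD2])
  then show ?thesis by (meson max.cobounded1)
qed

text \<open>The true growth is exponential, but the levels only have to supply arbitrarily many
  independent events.\<close>

lemma card_level_ge: "n < card (level n)"
proof (induction n)
  case 0
  have "level 0 = {r}" using lev_0 by auto
  then show ?case by simp
next
  case (Suc n)
  have "card (level (Suc n)) = (\<Sum>u\<in>level n. card (ch u))"
    unfolding level_Suc by (rule card_UN_disjoint) (auto simp: ch_iff)
  also have "\<dots> \<ge> (\<Sum>u\<in>level n. 2)"
    by (rule sum_mono) (rule card_ch_ge)
  finally show ?case using Suc by simp
qed

text \<open>The free state is prescribed on connected finite sets; balls are the connected
  exhaustion on which it will be evaluated.\<close>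

lemma ball_connected: "induces_connected adj (ball n)"
proof -
  let ?R = "\<lambda>x y. x \<in> ball n \<and> y \<in> ball n \<and> adj x y"
  have s: "symp ?R" by (rule sympI) (simp add: sym)
  have root: "?R\<^sup>*\<^sup>* u r" if "u \<in> ball n" for u
    using that
  proof (induction "lev u" arbitrary: u rule: less_induct)
    case less
    show ?case
    proof (cases "u = r")
      case False
      then have "par u \<in> ball n" "lev (par u) < lev u"
        using par(2)[OF False] less.prems by (simp_all add: ball_def)
      then show ?thesis
        using less.hyps[of "par u"] less.prems par(1)[OF False]
        by (intro converse_rtranclp_into_rtranclp[of ?R u "par u"]) auto
    qed simp
  qed
  have "?R\<^sup>*\<^sup>* u v" if "u \<in> ball n" "v \<in> ball n" for u v
    by (rule rtranclp_trans[OF root[OF that(1)] sympD[OF symp_rtranclp[OF s] root[OF that(2)]]])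
  then show ?thesis unfolding induces_connected_def by simp
qed

lemma desc_self: "v \<in> desc v"
  by (simp add: desc_def)

lemma desc_child:
  assumes c: "c \<in> ch v"
  shows "desc c \<subseteq> desc v - {v}"
proof
  fix u assume u: "u \<in> desc c"
  have l: "lev c = Suc (lev v)" and p: "par c = v" using chD[OF c] by auto
  have "lev c \<le> lev u" using u by (simp add: desc_def)
  with l have "lev u - lev v = Suc (lev u - lev c)" by linarith
  then have "(par ^^ (lev u - lev v)) u = v" using u p by (simp add: desc_def)
  then show "u \<in> desc v - {v}" using u l by (auto simp: desc_def)
qed

lemma desc_disjoint: "lev c = lev c' \<Longrightarrow> c \<noteq> c' \<Longrightarrow> desc c \<inter> desc c' = {}"
  by (auto simp: desc_def)

end

section \<open>Independence in product measures\<close>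

text \<open>Dependence on \<open>K j\<close> is assumed in the semantic sense that coordinates
  outside do not change the value. Filling those coordinates from a fixed point \<open>z\<close>
  turns \<open>X j\<close> into a measurable function of the restriction to \<open>K j\<close>, and
  restrictions to disjoint sets are independent.\<close>

lemma indep_vars_PiM_disjoint_support:
  fixes X :: "'j \<Rightarrow> ('i \<Rightarrow> 'a) \<Rightarrow> 'b"
  assumes M: "\<And>i. prob_space (M i)"
    and X: "\<And>j. j \<in> L \<Longrightarrow> X j \<in> measurable (PiM UNIV M) (N j)"
    and dep: "\<And>j x y. j \<in> L \<Longrightarrow> x \<in> space (PiM UNIV M) \<Longrightarrow> y \<in> space (PiM UNIV M) \<Longrightarrow>
      (\<And>i. i \<in> K j \<Longrightarrow> x i = y i) \<Longrightarrow> X j x = X j y"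
    and disj: "disjoint_family_on K L"
  shows "prob_space.indep_vars (PiM UNIV M) N X L"
proof -
  interpret P: prob_space "PiM UNIV M"
    by (rule prob_space_PiM[OF M])
  have coord: "P.indep_vars M (\<lambda>i \<omega>. \<omega> i) UNIV"
  proof (subst P.indep_vars_iff_distr_eq_PiM)
    have "distr (PiM UNIV M) (PiM UNIV M) (\<lambda>x. \<lambda>i\<in>UNIV. x i) = distr (PiM UNIV M) (PiM UNIV M) (\<lambda>x. x)"
      by (intro distr_cong) auto
    also have "\<dots> = PiM UNIV M" by (rule distr_id)
    also have "\<dots> = (\<Pi>\<^sub>M i\<in>UNIV. distr (PiM UNIV M) (M i) (\<lambda>x. x i))"
      by (intro PiM_cong refl distr_PiM_component[symmetric] M) auto
    finally show "distr (PiM UNIV M) (PiM UNIV M) (\<lambda>x. \<lambda>i\<in>UNIV. x i) =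
        (\<Pi>\<^sub>M i\<in>UNIV. distr (PiM UNIV M) (M i) (\<lambda>x. x i))" .
  qed auto
  obtain z where z: "z \<in> space (PiM UNIV M)"
    using P.not_empty by blast
  define fill where "fill j y = (\<lambda>i. if i \<in> K j then y i else z i)" for j and y :: "'i \<Rightarrow> 'a"
  have fill: "fill j \<in> measurable (PiM (K j) M) (PiM UNIV M)" for j
  proof (rule measurable_PiM_single')
    show "(\<lambda>y. fill j y i) \<in> measurable (PiM (K j) M) (M i)" for i
    proof (cases "i \<in> K j")
      case True then show ?thesis by (simp add: fill_def)
    next
      case False
      then show ?thesis using z by (simp add: fill_def space_PiM PiE_iff)
    qed
    show "fill j \<in> space (PiM (K j) M) \<rightarrow> (\<Pi>\<^sub>E i\<in>UNIV. space (M i))"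
      using z by (auto simp: fill_def space_PiM PiE_iff)
  qed
  have fills: "fill j (restrict x (K j)) \<in> space (PiM UNIV M)" if "x \<in> space (PiM UNIV M)" for j x
    using that z by (auto simp: fill_def space_PiM PiE_iff)
  have "P.indep_vars (\<lambda>j. PiM (K j) M) (\<lambda>j \<omega>. restrict (\<lambda>i. \<omega> i) (K j)) L"
    by (rule P.indep_vars_restrict[OF coord _ disj]) simp
  then have "P.indep_vars N (\<lambda>j \<omega>. X j (fill j (restrict (\<lambda>i. \<omega> i) (K j)))) L"
    by (rule P.indep_vars_compose2) (rule measurable_compose[OF fill X])
  moreover have eq: "X j (fill j (restrict x (K j))) = X j x" if "j \<in> L" "x \<in> space (PiM UNIV M)" for j x
    by (rule dep[OF that(1) fills[OF that(2)] that(2)]) (simp add: fill_def)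
  moreover have "P.indep_vars N (\<lambda>j \<omega>. X j (fill j (restrict (\<lambda>i. \<omega> i) (K j)))) L \<longleftrightarrow> P.indep_vars N X L"
    unfolding P.indep_vars_def2
  proof (intro conj_cong ball_cong refl P.indep_sets_cong)
    fix j assume j: "j \<in> L"
    show "P.random_variable (N j) (\<lambda>\<omega>. X j (fill j (restrict (\<lambda>i. \<omega> i) (K j)))) \<longleftrightarrow> P.random_variable (N j) (X j)"
      by (rule measurable_cong) (rule eq[OF j])
    have "(\<lambda>\<omega>. X j (fill j (restrict (\<lambda>i. \<omega> i) (K j)))) -` A \<inter> space (PiM UNIV M) = X j -` A \<inter> space (PiM UNIV M)" for A
      using eq[OF j] by auto
    then show "{(\<lambda>\<omega>. X j (fill j (restrict (\<lambda>i. \<omega> i) (K j)))) -` A \<inter> space (PiM UNIV M) |A. A \<in> sets (N j)} =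
        {X j -` A \<inter> space (PiM UNIV M) |A. A \<in> sets (N j)}"
      by simp
  qed
  ultimately show ?thesis by simp
qed

section \<open>The free state in edge variables\<close>

context rooted_cayley_tree
begin

lemma par_ball: "v \<in> ball n \<Longrightarrow> v \<noteq> r \<Longrightarrow> par v \<in> ball n"
  using par(2)[of v] by (simp add: ball_def)

text \<open>Edges of a ball correspond to its non-root vertices, each vertex standing for the edge
  to its parent.\<close>

lemma interior_sum_ball:
  "interior_sum adj (ball n) \<sigma> = (\<Sum>v\<in>ball n - {r}. \<sigma> v * \<sigma> (par v))"
proof -
  have E: "{{u, v} |u v. u \<in> ball n \<and> v \<in> ball n \<and> adj u v} = (\<lambda>v. {v, par v}) ` (ball n - {r})"
  proof (intro equalityI subsetI)
    fix e assume "e \<in> {{u, v} |u v. u \<in> ball n \<and> v \<in> ball n \<and> adj u v}"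
    then obtain u v where uv: "e = {u, v}" "u \<in> ball n" "v \<in> ball n" "adj u v" by blast
    from uv(4) show "e \<in> (\<lambda>v. {v, par v}) ` (ball n - {r})"
    proof (cases rule: adj_cases)
      case 1
      then have "e = {u, par u}" "u \<in> ball n - {r}" using uv by simp_all
      then show ?thesis by (rule image_eqI)
    next
      case 2
      then have "e = {v, par v}" "v \<in> ball n - {r}" using uv by (simp_all add: insert_commute)
      then show ?thesis by (rule image_eqI)
    qed
  next
    fix e assume "e \<in> (\<lambda>v. {v, par v}) ` (ball n - {r})"
    then obtain v where v: "v \<in> ball n" "v \<noteq> r" "e = {v, par v}" by blast
    have "par v \<in> ball n" "adj v (par v)" using par_ball[OF v(1,2)] par(1)[OF v(2)] by simp_all
    with v show "e \<in> {{u, v} |u v. u \<in> ball n \<and> v \<in> ball n \<and> adj u v}" by blast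
  qed
  have inj: "inj_on (\<lambda>v. {v, par v}) (ball n - {r})"
  proof (rule inj_onI)
    fix v w assume *: "v \<in> ball n - {r}" "w \<in> ball n - {r}" "{v, par v} = {w, par w}"
    then have l: "lev v = Suc (lev (par v))" "lev w = Suc (lev (par w))" using par(2) by blast+
    from *(3) have "v = w \<or> (v = par w \<and> par v = w)" by (metis doubleton_eq_iff)
    moreover have "\<not> (v = par w \<and> par v = w)"
    proof
      assume "v = par w \<and> par v = w"
      then have "lev v = Suc (lev w)" "lev w = Suc (lev v)" using l by metis+
      then show False by linarith
    qed
    ultimately show "v = w" by blast
  qed
  show ?thesis
    unfolding interior_sum_def E
  proof (subst sum.reindex[OF inj], rule sum.cong[OF refl])
    fix v assume "v \<in> ball n - {r}"
    then have "v \<noteq> par v" using par(1)[of v] irrefl[of v] by auto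
    then show "((\<lambda>e. \<Prod>w\<in>e. \<sigma> w) \<circ> (\<lambda>v. {v, par v})) v = \<sigma> v * \<sigma> (par v)" by simp
  qed
qed

text \<open>The root keeps its own spin, so nothing is lost: spins are recovered level by level,
  multiplying by the spin of the parent.\<close>

definition inc :: "('v \<Rightarrow> real) \<Rightarrow> 'v \<Rightarrow> real" where
  "inc \<sigma> v = (if v = r then \<sigma> v else \<sigma> v * \<sigma> (par v))"

lemma inc_measurable [measurable]: "inc \<in> measurable spin_space spin_space"
proof (rule measurable_into_spin_space)
  show "(\<lambda>\<sigma>. inc \<sigma> v) \<in> borel_measurable spin_space" for v
    by (cases "v = r") (simp_all add: inc_def)
  show "inc \<sigma> v = -1 \<or> inc \<sigma> v = 1" if "\<sigma> \<in> space spin_space" for \<sigma> v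
    using spin_values[OF that, of v] spin_values[OF that, of "par v"] by (auto simp: inc_def)
qed

lemma inc_space: "\<sigma> \<in> space spin_space \<Longrightarrow> inc \<sigma> \<in> space spin_space"
  by (rule measurable_space[OF inc_measurable])

lemma inc_restrict: "restrict (inc (restrict \<sigma> (ball n))) (ball n) = restrict (inc \<sigma>) (ball n)"
  using par_ball[of _ n] by (auto simp: inc_def fun_eq_iff)

lemma inc_configs:
  assumes s: "s \<in> configs (ball n)"
  shows "restrict (inc s) (ball n) \<in> configs (ball n)"
proof -
  have "inc s v \<in> {-1, 1}" if "v \<in> ball n" for v
  proof (cases "v = r")
    case True
    then show ?thesis using configs_values[OF s that] by (auto simp: inc_def)
  next
    case False
    then show ?thesis
      using configs_values[OF s that] configs_values[OF s par_ball[OF that False]] by (auto simp: inc_def)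
  qed
  then show ?thesis by (simp add: configs_def PiE_iff)
qed

lemma inc_inj:
  assumes s: "s \<in> configs (ball n)" "s' \<in> configs (ball n)"
    and eq: "restrict (inc s) (ball n) = restrict (inc s') (ball n)"
  shows "s = s'"
proof -
  have "s v = s' v" if "v \<in> ball n" for v
    using that
  proof (induction "lev v" arbitrary: v rule: less_induct)
    case less
    have e: "inc s v = inc s' v" using fun_cong[OF eq, of v] less.prems by simp
    show ?case
    proof (cases "v = r")
      case True
      then show ?thesis using e by (simp add: inc_def)
    next
      case False
      have pv: "par v \<in> ball n" by (rule par_ball[OF less.prems False])
      have "s (par v) = s' (par v)" using less.hyps[OF _ pv] par(2)[OF False] by simp
      moreover have "s' (par v) \<noteq> 0" using configs_values[OF s(2) pv] by auto
      ultimately show ?thesis using e False by (simp add: inc_def)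
    qed
  qed
  then show ?thesis
    using s by (intro PiE_ext[where k = "ball n" and s = "\<lambda>_. {-1, 1}"]) (simp_all add: configs_def)
qed

lemma inc_bij: "bij_betw (\<lambda>s. restrict (inc s) (ball n)) (configs (ball n)) (configs (ball n))"
  unfolding bij_betw_def
proof
  show inj: "inj_on (\<lambda>s. restrict (inc s) (ball n)) (configs (ball n))"
    by (rule inj_onI) (rule inc_inj)
  show "(\<lambda>s. restrict (inc s) (ball n)) ` configs (ball n) = configs (ball n)"
    by (rule endo_inj_surj[OF _ _ inj]) (auto intro: inc_configs)
qed

end

section \<open>The product law of the edge variables and the Gibbs weights on balls\<close>

locale ising_tree = rooted_cayley_tree d adj r
  for d :: nat and adj :: "'v \<Rightarrow> 'v \<Rightarrow> bool" and r :: 'v +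
  fixes \<beta> :: real
  assumes \<beta>_nonneg: "0 \<le> \<beta>"
begin

definition \<theta> :: real where "\<theta> = tanh \<beta>"

lemma \<theta>: "0 \<le> \<theta>" "\<theta> < 1"
  using \<beta>_nonneg tanh_real_lt_1[of \<beta>] by (simp_all add: \<theta>_def)

text \<open>For a sign \<open>x\<close>, \<open>(1 + \<theta> * x) / 2\<close> is
  \<open>exp (\<beta> * x)\<close> divided by \<open>2 * cosh \<beta>\<close>: the law of the
  product of the two spins on an isolated edge. The root spin is unbiased.\<close>

definition weight :: "'v \<Rightarrow> real \<Rightarrow> real" where
  "weight v x = (if v = r then 1 / 2 else (1 + \<theta> * x) / 2)"

definition edge_law :: "'v \<Rightarrow> real measure" where
  "edge_law v = point_measure {-1, 1} (\<lambda>x. ennreal (weight v x))"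

definition edge_measure :: "('v \<Rightarrow> real) measure" where
  "edge_measure = PiM UNIV edge_law"

lemma weight_pos: "x = -1 \<or> x = 1 \<Longrightarrow> weight v x > 0"
  using \<theta> by (auto simp: weight_def)

lemma weight_sum: "(\<Sum>x\<in>{-1, 1}. weight v x) = 1"
  by (simp add: weight_def field_simps)

lemma sets_edge_law: "sets (edge_law v) = sets (count_space {-1, 1})"
  by (simp add: edge_law_def sets_point_measure)

lemma space_edge_law: "space (edge_law v) = {-1, 1}"
  by (simp add: edge_law_def space_point_measure)

lemma emeasure_edge_law: "A \<subseteq> {-1, 1} \<Longrightarrow> emeasure (edge_law v) A = ennreal (\<Sum>x\<in>A. weight v x)"
  unfolding edge_law_def using weight_pos
  by (subst emeasure_point_measure_finite) (auto intro!: sum_ennreal less_imp_le)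

lemma prob_edge_law: "prob_space (edge_law v)"
proof
  show "emeasure (edge_law v) (space (edge_law v)) = 1"
    by (subst emeasure_edge_law) (simp_all only: space_edge_law weight_sum subset_refl ennreal_1)
qed

lemma sets_edge_measure [measurable_cong]: "sets edge_measure = sets spin_space"
  unfolding edge_measure_def spin_space_def by (rule sets_PiM_cong) (simp_all only: sets_edge_law)

lemma space_edge_measure: "space edge_measure = space spin_space"
  by (rule sets_eq_imp_space_eq[OF sets_edge_measure])

lemma prob_edge_measure: "prob_space edge_measure"
  unfolding edge_measure_def by (rule prob_space_PiM[OF prob_edge_law])

sublocale E: prob_space edge_measure by (rule prob_edge_measure)

lemma emeasure_edge_measure_cyl:
  assumes K: "finite K" and s: "s \<in> configs K"
  shows "emeasure edge_measure (cyl K s) = ennreal (\<Prod>v\<in>K. weight v (s v))"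
proof -
  interpret product_prob_space edge_law UNIV
    by (rule product_prob_spaceI) (rule prob_edge_law)
  have *: "cyl K s = prod_emb UNIV edge_law K (Pi\<^sub>E K (\<lambda>v. {s v}))"
    by (auto simp: cyl_eq[OF s] prod_emb_def space_spin_space PiE_iff space_edge_law)
  have sv: "s v = -1 \<or> s v = 1" if "v \<in> K" for v
    by (rule configs_values[OF s that])
  have "emeasure edge_measure (cyl K s) = (\<Prod>v\<in>K. emeasure (edge_law v) {s v})"
    unfolding edge_measure_def * by (rule emeasure_PiM_emb) (use K sv in \<open>auto simp: sets_edge_law\<close>)
  also have "\<dots> = (\<Prod>v\<in>K. ennreal (weight v (s v)))"
    using sv by (intro prod.cong refl) (subst emeasure_edge_law, auto)
  also have "\<dots> = ennreal (\<Prod>v\<in>K. weight v (s v))"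
    using sv weight_pos by (intro prod_ennreal) (auto intro: less_imp_le)
  finally show ?thesis .
qed

lemma edge_indep:
  assumes X: "\<And>j. j \<in> L \<Longrightarrow> X j \<in> measurable spin_space (N j)"
    and dep: "\<And>j x y. j \<in> L \<Longrightarrow> x \<in> space spin_space \<Longrightarrow> y \<in> space spin_space \<Longrightarrow>
      (\<And>i. i \<in> K j \<Longrightarrow> x i = y i) \<Longrightarrow> X j x = X j y"
    and disj: "disjoint_family_on K L"
  shows "E.indep_vars N X L"
  unfolding edge_measure_def
proof (rule indep_vars_PiM_disjoint_support[OF prob_edge_law _ _ disj])
  note sets = sets_edge_measure[unfolded edge_measure_def]
  note space = space_edge_measure[unfolded edge_measure_def]
  show "X j \<in> measurable (PiM UNIV edge_law) (N j)" if "j \<in> L" for j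
    using X[OF that] unfolding measurable_cong_sets[OF sets refl] .
  show "X j x = X j y" if "j \<in> L" "x \<in> space (PiM UNIV edge_law)" "y \<in> space (PiM UNIV edge_law)"
    "\<And>i. i \<in> K j \<Longrightarrow> x i = y i" for j x y
    by (rule dep[OF that(1) that(2,3)[unfolded space] that(4)])
qed

lemma exp_spin: "x = -1 \<or> x = 1 \<Longrightarrow> exp (\<beta> * x) = cosh \<beta> * (1 + \<theta> * x)"
proof -
  have "cosh \<beta> * \<theta> = sinh \<beta>" by (simp add: \<theta>_def tanh_def)
  then show "x = -1 \<or> x = 1 \<Longrightarrow> exp (\<beta> * x) = cosh \<beta> * (1 + \<theta> * x)"
    using cosh_plus_sinh[of \<beta>] cosh_minus_sinh[of \<beta>] by (auto simp: algebra_simps)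
qed

text \<open>Every edge contributes \<open>2 * cosh \<beta>\<close> times its weight; the leading 2
  undoes the weight \<open>1 / 2\<close> of the root. The prefactor does not depend on
  \<open>s\<close>, so it is the partition function.\<close>

lemma exp_interior_sum_ball:
  assumes s: "s \<in> configs (ball n)"
  shows "exp (\<beta> * interior_sum adj (ball n) s) =
    2 * (2 * cosh \<beta>) ^ card (ball n - {r}) * (\<Prod>v\<in>ball n. weight v (inc s v))"
proof -
  have i: "inc s v = s v * s (par v)" "inc s v = -1 \<or> inc s v = 1" if "v \<in> ball n - {r}" for v
  proof -
    show "inc s v = s v * s (par v)" using that by (simp add: inc_def)
    have "restrict (inc s) (ball n) v = -1 \<or> restrict (inc s) (ball n) v = 1"
      using that by (intro configs_values[OF inc_configs[OF s]]) simp
    then show "inc s v = -1 \<or> inc s v = 1" using that by simp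
  qed
  have r: "r \<in> ball n" by (simp add: ball_def)
  have "exp (\<beta> * interior_sum adj (ball n) s) = (\<Prod>v\<in>ball n - {r}. exp (\<beta> * inc s v))"
    unfolding interior_sum_ball sum_distrib_left by (simp add: exp_sum i)
  also have "\<dots> = (\<Prod>v\<in>ball n - {r}. (2 * cosh \<beta>) * weight v (inc s v))"
    using i(2) by (intro prod.cong refl) (simp add: exp_spin weight_def)
  also have "\<dots> = (2 * cosh \<beta>) ^ card (ball n - {r}) * (\<Prod>v\<in>ball n - {r}. weight v (inc s v))"
    by (simp add: prod.distrib prod_constant)
  also have "(\<Prod>v\<in>ball n. weight v (inc s v)) = weight r (inc s r) * (\<Prod>v\<in>ball n - {r}. weight v (inc s v))"
    using r by (intro prod.remove) simp_all
  then have "(\<Prod>v\<in>ball n - {r}. weight v (inc s v)) = 2 * (\<Prod>v\<in>ball n. weight v (inc s v))"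
    by (simp add: weight_def)
  finally show ?thesis by simp
qed

lemma sum_weight_inc: "(\<Sum>s\<in>configs (ball n). \<Prod>v\<in>ball n. weight v (inc s v)) = 1"
proof -
  have "(\<Sum>s\<in>configs (ball n). \<Prod>v\<in>ball n. weight v (inc s v)) =
      (\<Sum>s\<in>configs (ball n). (\<lambda>\<xi>. \<Prod>v\<in>ball n. weight v (\<xi> v)) (restrict (inc s) (ball n)))"
    by (intro sum.cong prod.cong refl) simp
  also have "\<dots> = (\<Sum>\<xi>\<in>configs (ball n). \<Prod>v\<in>ball n. weight v (\<xi> v))"
    by (rule sum.reindex_bij_betw[OF inc_bij])
  also have "\<dots> = (\<Prod>v\<in>ball n. \<Sum>x\<in>{-1, 1}. weight v x)"
    unfolding configs_def by (rule prod_sum_PiE[symmetric]) simp_all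
  also have "\<dots> = 1" unfolding weight_sum by simp
  finally show ?thesis .
qed

lemma free_kernel_ball:
  assumes s: "s \<in> configs (ball n)"
  shows "exp (\<beta> * interior_sum adj (ball n) s) / (\<Sum>\<tau>\<in>configs (ball n). exp (\<beta> * interior_sum adj (ball n) \<tau>)) =
    (\<Prod>v\<in>ball n. weight v (inc s v))"
proof -
  define C where "C = 2 * (2 * cosh \<beta>) ^ card (ball n - {r})"
  have C: "C > 0" by (simp add: C_def)
  have "(\<Sum>\<tau>\<in>configs (ball n). exp (\<beta> * interior_sum adj (ball n) \<tau>)) =
      (\<Sum>\<tau>\<in>configs (ball n). C * (\<Prod>v\<in>ball n. weight v (inc \<tau> v)))"
    unfolding C_def by (intro sum.cong refl exp_interior_sum_ball)
  also have "\<dots> = C" by (simp add: sum_distrib_left[symmetric] sum_weight_inc)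
  finally have Z: "(\<Sum>\<tau>\<in>configs (ball n). exp (\<beta> * interior_sum adj (ball n) \<tau>)) = C" .
  have "exp (\<beta> * interior_sum adj (ball n) s) = C * (\<Prod>v\<in>ball n. weight v (inc s v))"
    unfolding C_def by (rule exp_interior_sum_ball[OF s])
  with Z C show ?thesis by simp
qed

end

section \<open>The law of the free state in edge variables and its Gibbs property\<close>

locale free_ising_tree = ising_tree d adj r \<beta>
  for d :: nat and adj :: "'v \<Rightarrow> 'v \<Rightarrow> bool" and r :: 'v and \<beta> :: real +
  fixes \<mu> :: "('v \<Rightarrow> real) measure"
  assumes free: "free_state adj \<beta> \<mu>"
begin

lemma prob_\<mu>: "prob_space \<mu>" and sets_\<mu> [measurable_cong]: "sets \<mu> = sets spin_space"
  using free unfolding free_state_def by blast+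

lemma space_\<mu>: "space \<mu> = space spin_space"
  by (rule sets_eq_imp_space_eq[OF sets_\<mu>])

sublocale \<mu>: prob_space \<mu> by (rule prob_\<mu>)

lemma emeasure_\<mu>_cyl_ball:
  assumes s: "s \<in> configs (ball n)"
  shows "emeasure \<mu> (cyl (ball n) s) = ennreal (\<Prod>v\<in>ball n. weight v (inc s v))"
proof -
  have "measure \<mu> (cyl (ball n) s) = measure (ising_free adj \<beta> (ball n)) {\<sigma>\<in>configs (ball n). \<forall>u\<in>ball n. \<sigma> u = s u}"
    using free[unfolded free_state_def, THEN conjunct2, THEN conjunct2, rule_format,
        OF finite_ball ball_connected s]
    unfolding cyl_eq[OF s] space_\<mu> .
  also have "{\<sigma>\<in>configs (ball n). \<forall>u\<in>ball n. \<sigma> u = s u} = {s}"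
    using s by (auto simp: configs_def intro: PiE_ext)
  also have "measure (ising_free adj \<beta> (ball n)) {s} = (\<Prod>v\<in>ball n. weight v (inc s v))"
  proof -
    have "emeasure (ising_free adj \<beta> (ball n)) {s} =
        ennreal (exp (\<beta> * interior_sum adj (ball n) s) / (\<Sum>\<tau>\<in>configs (ball n). exp (\<beta> * interior_sum adj (ball n) \<tau>)))"
      unfolding ising_free_def using s by (subst emeasure_boltzmann) simp_all
    also have "\<dots> = ennreal (\<Prod>v\<in>ball n. weight v (inc s v))"
      by (simp only: free_kernel_ball[OF s])
    finally have "emeasure (ising_free adj \<beta> (ball n)) {s} = ennreal (\<Prod>v\<in>ball n. weight v (inc s v))" .
    moreover have "0 \<le> (\<Prod>v\<in>ball n. weight v (inc s v))"
      unfolding free_kernel_ball[OF s, symmetric] by (simp add: sum_nonneg)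
    ultimately show ?thesis by (simp only: measure_def enn2real_ennreal)
  qed
  finally show ?thesis by (simp add: \<mu>.emeasure_eq_measure)
qed

text \<open>On a ball, \<open>inc\<close> permutes the configurations, so the preimage of an edge
  cylinder is one spin cylinder, whose mass is already the product of the edge weights.\<close>

theorem distr_inc: "distr \<mu> spin_space inc = edge_measure"
proof (rule measure_eqI_cyl)
  show "sets (distr \<mu> spin_space inc) = sets spin_space" "sets edge_measure = sets spin_space"
    by (simp_all add: sets_edge_measure)
  have inc: "inc \<in> measurable \<mu> spin_space"
    using inc_measurable by (simp add: measurable_cong_sets[OF sets_\<mu> refl])
  show "finite_measure (distr \<mu> spin_space inc)"
    by (intro prob_space.finite_measure \<mu>.prob_space_distr inc)
  fix J :: "'v set" assume "finite J"
  then obtain n where n: "J \<subseteq> ball n" using ball_exhausts[of J 0] by blast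
  have "emeasure (distr \<mu> spin_space inc) (cyl (ball n) \<xi>) = emeasure edge_measure (cyl (ball n) \<xi>)"
    if xi: "\<xi> \<in> configs (ball n)" for \<xi>
  proof -
    have "\<xi> \<in> (\<lambda>s. restrict (inc s) (ball n)) ` configs (ball n)"
      using xi inc_bij[of n] by (simp add: bij_betw_def)
    then obtain s where s: "s \<in> configs (ball n)" "restrict (inc s) (ball n) = \<xi>"
      by blast
    have "inc -` cyl (ball n) \<xi> \<inter> space \<mu> = cyl (ball n) s"
    proof (intro equalityI subsetI)
      fix \<sigma> assume "\<sigma> \<in> inc -` cyl (ball n) \<xi> \<inter> space \<mu>"
      then have sg: "\<sigma> \<in> space spin_space" "restrict (inc \<sigma>) (ball n) = restrict (inc s) (ball n)"
        by (auto simp: cyl_def space_\<mu> s)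
      then have "restrict \<sigma> (ball n) = s"
        by (intro inc_inj[OF restrict_configs[OF sg(1)] s(1)]) (simp only: inc_restrict)
      then show "\<sigma> \<in> cyl (ball n) s" using sg by (simp add: cyl_def)
    next
      fix \<sigma> assume "\<sigma> \<in> cyl (ball n) s"
      then have sg: "\<sigma> \<in> space spin_space" "restrict \<sigma> (ball n) = s" by (simp_all add: cyl_def)
      then have "restrict (inc \<sigma>) (ball n) = \<xi>"
        using inc_restrict[of \<sigma> n] s by simp
      then show "\<sigma> \<in> inc -` cyl (ball n) \<xi> \<inter> space \<mu>"
        using sg inc_space by (simp add: cyl_def space_\<mu>)
    qed
    then have "emeasure (distr \<mu> spin_space inc) (cyl (ball n) \<xi>) = emeasure \<mu> (cyl (ball n) s)"
      using xi by (simp add: emeasure_distr[OF inc])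
    also have "\<dots> = ennreal (\<Prod>v\<in>ball n. weight v (restrict (inc s) (ball n) v))"
      by (subst emeasure_\<mu>_cyl_ball[OF s(1)]) (intro arg_cong[of _ _ ennreal] prod.cong refl, simp)
    also have "\<dots> = emeasure edge_measure (cyl (ball n) \<xi>)"
      unfolding s(2) by (rule emeasure_edge_measure_cyl[symmetric, OF finite_ball xi])
    finally show ?thesis .
  qed
  then show "\<exists>K. finite K \<and> J \<subseteq> K \<and>
      (\<forall>s\<in>configs K. emeasure (distr \<mu> spin_space inc) (cyl K s) = emeasure edge_measure (cyl K s))"
    using n by (intro exI[of _ "ball n"]) simp
qed

lemma measure_inc:
  assumes "A \<in> sets spin_space"
  shows "measure \<mu> {\<sigma>\<in>space spin_space. inc \<sigma> \<in> A} = measure edge_measure A"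
proof -
  have inc: "inc \<in> measurable \<mu> spin_space"
    using inc_measurable by (simp add: measurable_cong_sets[OF sets_\<mu> refl])
  have "inc -` A \<inter> space \<mu> = {\<sigma>\<in>space spin_space. inc \<sigma> \<in> A}"
    by (auto simp: space_\<mu>)
  then show ?thesis
    using measure_distr[OF inc, of A] assms by (simp add: distr_inc)
qed

text \<open>On a ball containing \<Lambda> and its neighbours the free state has explicit Boltzmann
  weights, for which resampling \<Lambda> is the finite-volume identity.\<close>

theorem free_state_gibbs: "gibbs_measure adj \<beta> \<mu>"
  unfolding gibbs_measure_iff
proof (intro conjI allI impI prob_\<mu> sets_\<mu>)
  fix \<Lambda> :: "'v set" and t :: "'v \<Rightarrow> real" assume L: "finite \<Lambda>" "t \<in> configs \<Lambda>"
  obtain n where n: "closed_nbhd adj \<Lambda> \<subseteq> ball n"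
    using ball_exhausts[OF finite_closed_nbhd[OF L(1)], of 0] by blast
  then have LB: "\<Lambda> \<subseteq> ball n" by (simp add: closed_nbhd_def)
  let ?E = "\<lambda>\<tau>. \<beta> * interior_sum adj (ball n) \<tau>"
  let ?Z = "\<Sum>\<tau>\<in>configs (ball n). exp (?E \<tau>)"
  have Z: "?Z > 0" by (rule sum_exp_pos) simp
  have m: "emeasure \<mu> (cyl (ball n) s) = ennreal (exp (?E s) / ?Z)" if "s \<in> configs (ball n)" for s
    unfolding emeasure_\<mu>_cyl_ball[OF that] free_kernel_ball[OF that] ..
  \<comment> \<open>The factor 1 is the function \<open>F\<close> of
    \<open>finite_volume_dlr\<close>, kept so that the sums match its form.\<close>
  have int: "(\<integral>\<^sup>+\<sigma>. ennreal (f \<sigma>) \<partial>\<mu>) = ennreal ((\<Sum>s\<in>configs (ball n). exp (?E s) * 1 * f s) / ?Z)"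
    if f: "\<And>\<sigma>. f (restrict \<sigma> (ball n)) = f \<sigma>" "\<And>\<sigma>. f \<sigma> \<ge> 0" for f
  proof -
    have "(\<integral>\<^sup>+\<sigma>. ennreal (f \<sigma>) \<partial>\<mu>) = (\<Sum>s\<in>configs (ball n). ennreal (f s) * emeasure \<mu> (cyl (ball n) s))"
      by (rule nn_integral_local[OF sets_\<mu>]) (simp_all add: f)
    also have "\<dots> = (\<Sum>s\<in>configs (ball n). ennreal (exp (?E s) * 1 * f s / ?Z))"
      using Z by (intro sum.cong refl) (simp add: m ennreal_mult[symmetric] f mult.commute)
    also have "\<dots> = ennreal ((\<Sum>s\<in>configs (ball n). exp (?E s) * 1 * f s) / ?Z)"
      using Z by (simp add: f sum_divide_distrib)
    finally show ?thesis .
  qed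
  have BL: "ball n \<inter> \<Lambda> = \<Lambda>" using LB by blast
  have ind: "indicator (cyl \<Lambda> t) \<sigma> = ennreal (if restrict \<sigma> \<Lambda> = t then 1 else 0)"
    if "\<sigma> \<in> space \<mu>" for \<sigma>
    using that by (simp add: indicator_cyl space_\<mu>)
  have "emeasure \<mu> (cyl \<Lambda> t) = (\<integral>\<^sup>+\<sigma>. indicator (cyl \<Lambda> t) \<sigma> \<partial>\<mu>)"
    by (rule nn_integral_indicator[symmetric]) (simp add: sets_\<mu> L)
  also have "\<dots> = (\<integral>\<^sup>+\<sigma>. ennreal (if restrict \<sigma> \<Lambda> = t then 1 else 0) \<partial>\<mu>)"
    by (rule nn_integral_cong) (rule ind)
  also have "\<dots> = ennreal ((\<Sum>s\<in>configs (ball n). exp (?E s) * 1 * (if restrict s \<Lambda> = t then 1 else 0)) / ?Z)"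
    by (rule int) (simp_all add: BL)
  also have "(\<Sum>s\<in>configs (ball n). exp (?E s) * 1 * (if restrict s \<Lambda> = t then 1 else 0)) =
      (\<Sum>s\<in>configs (ball n). exp (?E s) * 1 * kernel adj \<beta> \<Lambda> s t)"
    by (rule finite_volume_dlr[where F = "\<lambda>_. 1" and F0 = "\<lambda>_. 1",
          OF finite_ball LB L(2) interior_sum_merge[OF finite_ball n]]) simp
  also have "ennreal ((\<Sum>s\<in>configs (ball n). exp (?E s) * 1 * kernel adj \<beta> \<Lambda> s t) / ?Z) =
      (\<integral>\<^sup>+\<eta>. ennreal (kernel adj \<beta> \<Lambda> \<eta> t) \<partial>\<mu>)"
    by (rule int[symmetric]) (simp_all add: kernel_restrict[OF n] kernel_nonneg)
  finally show "emeasure \<mu> (cyl \<Lambda> t) = (\<integral>\<^sup>+\<eta>. ennreal (kernel adj \<beta> \<Lambda> \<eta> t) \<partial>\<mu>)" .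
qed

end

section \<open>Combining independent observations of a spin\<close>

text \<open>This is tanh of the sum of \<open>artanh (A c)\<close>: the posterior mean of an
  unbiased spin after independent observations that separately give posterior means
  \<open>A c\<close>. The rational form avoids logarithms.\<close>

definition comb :: "'c set \<Rightarrow> ('c \<Rightarrow> real) \<Rightarrow> real" where
  "comb F A = ((\<Prod>c\<in>F. 1 + A c) - (\<Prod>c\<in>F. 1 - A c)) / ((\<Prod>c\<in>F. 1 + A c) + (\<Prod>c\<in>F. 1 - A c))"

lemma comb_empty [simp]: "comb {} A = 0"
  by (simp add: comb_def)

lemma comb_cong: "(\<And>c. c \<in> F \<Longrightarrow> A c = B c) \<Longrightarrow> comb F A = comb F B"
  by (simp add: comb_def cong: prod.cong)

lemma comb_prods_pos:
  assumes "\<And>c. c \<in> F \<Longrightarrow> \<bar>A c\<bar> < (1::real)"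
  shows "(\<Prod>c\<in>F. 1 + A c) > 0" "(\<Prod>c\<in>F. 1 - A c) > 0"
  using assms by (force intro!: prod_pos simp: abs_less_iff)+

lemma comb_abs:
  assumes "\<And>c. c \<in> F \<Longrightarrow> \<bar>A c\<bar> < (1::real)"
  shows "\<bar>comb F A\<bar> < 1"
  unfolding comb_def using comb_prods_pos[of F A] assms by (simp add: abs_less_iff field_simps)

lemma comb_sign:
  assumes "s = -1 \<or> s = 1"
  shows "comb F (\<lambda>c. s * A c) = s * comb F A"
  using assms by (auto simp: comb_def field_simps minus_divide_left)

text \<open>The addition theorem of tanh; it lets observations be absorbed one at a time.\<close>

lemma comb_insert:
  assumes F: "finite F" "c \<notin> F" and A: "\<And>c'. c' \<in> insert c F \<Longrightarrow> \<bar>A c'\<bar> < (1::real)"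
  shows "comb (insert c F) A = (comb F A + A c) / (1 + comb F A * A c)"
proof -
  define L L' where "L = (\<Prod>c\<in>F. 1 + A c)" and "L' = (\<Prod>c\<in>F. 1 - A c)"
  have pos: "L > 0" "L' > 0"
    unfolding L_def L'_def using comb_prods_pos[of F A] A by auto
  have a: "-1 < A c" "A c < 1" using A[of c] by (auto simp: abs_less_iff)
  have p: "L * (1 + A c) > 0" "L' * (1 - A c) > 0" using pos a by auto
  have "comb (insert c F) A = (L * (1 + A c) - L' * (1 - A c)) / (L * (1 + A c) + L' * (1 - A c))"
    using F by (simp add: comb_def L_def L'_def mult.commute)
  also have "\<dots> = ((L - L') + A c * (L + L')) / ((L + L') + (L - L') * A c)"
    by (simp add: algebra_simps)
  also have "\<dots> = ((L - L') / (L + L') + A c) / (1 + (L - L') / (L + L') * A c)"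
  proof -
    have S: "L + L' \<noteq> 0" using pos by simp
    have "(L - L') / (L + L') + A c = ((L - L') + A c * (L + L')) / (L + L')"
      "1 + (L - L') / (L + L') * A c = ((L + L') + (L - L') * A c) / (L + L')"
      using S by (simp_all add: add_divide_distrib)
    then show ?thesis using S by simp
  qed
  finally show ?thesis by (simp add: comb_def L_def L'_def)
qed

lemma merge_denominator_pos:
  assumes "\<bar>a\<bar> < (1::real)" "\<bar>b\<bar> \<le> 1"
  shows "1 + a * b > 0"
proof -
  have "\<bar>a * b\<bar> \<le> \<bar>a\<bar> * 1" unfolding abs_mult using assms by (intro mult_left_mono) auto
  then show ?thesis using assms by linarith
qed

lemma merge_abs:
  assumes "\<bar>a\<bar> < (1::real)" "\<bar>b\<bar> \<le> 1"
  shows "\<bar>(a + b) / (1 + a * b)\<bar> \<le> 1"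
proof -
  have p: "1 + a * b > 0" by (rule merge_denominator_pos[OF assms])
  have "(1 - a) * (1 - b) \<ge> 0" "(1 + a) * (1 + b) \<ge> 0" using assms by (auto simp: abs_le_iff)
  then have "\<bar>a + b\<bar> \<le> 1 + a * b" by (simp add: algebra_simps abs_le_iff)
  then show ?thesis using p by (simp add: abs_divide)
qed

text \<open>\<open>1/(1+r) = 1 - r + r^2/(1+r)\<close> with \<open>r = ab\<close>.\<close>

lemma merge_le:
  assumes "\<bar>a\<bar> < (1::real)" "\<bar>b\<bar> \<le> 1"
  shows "(a + b) / (1 + a * b) \<le> a + b - a\<^sup>2 * b - a * b\<^sup>2 + a\<^sup>2 * b\<^sup>2"
proof -
  have p: "1 + a * b > 0" by (rule merge_denominator_pos[OF assms])
  have "(a + b) / (1 + a * b) = (a + b) * (1 - a * b) + (a * b)\<^sup>2 * ((a + b) / (1 + a * b))"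
    using p by (simp add: divide_simps) (simp add: algebra_simps power2_eq_square)
  also have "\<dots> \<le> (a + b) * (1 - a * b) + (a * b)\<^sup>2 * 1"
    by (intro add_left_mono mult_left_mono abs_le_D1[OF merge_abs[OF assms]]) simp
  finally show ?thesis by (simp add: algebra_simps power2_eq_square)
qed

text \<open>The law of the magnetization of a plus spin given observations has density proportional to
  \<open>1 + x\<close> with respect to a symmetric law; equivalently, multiplying it by \<open>1 - x\<close> makes it
  symmetric.\<close>

definition nishimori :: "'a measure \<Rightarrow> ('a \<Rightarrow> real) \<Rightarrow> bool" where
  "nishimori M A \<longleftrightarrow> A \<in> borel_measurable M \<and> (\<forall>x\<in>space M. \<bar>A x\<bar> \<le> 1) \<and>
    (\<forall>h\<in>borel_measurable borel. (\<integral>\<^sup>+x. h (A x) * ennreal (1 - A x) \<partial>M) = (\<integral>\<^sup>+x. h (- A x) * ennreal (1 - A x) \<partial>M))"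

lemma nishimoriD:
  assumes "nishimori M A"
  shows "A \<in> borel_measurable M" "\<And>x. x \<in> space M \<Longrightarrow> \<bar>A x\<bar> \<le> 1"
    "\<And>h. h \<in> borel_measurable borel \<Longrightarrow>
      (\<integral>\<^sup>+x. h (A x) * ennreal (1 - A x) \<partial>M) = (\<integral>\<^sup>+x. h (- A x) * ennreal (1 - A x) \<partial>M)"
  using assms unfolding nishimori_def by blast+

context prob_space
begin

lemma integrable_abs_le_1:
  assumes "f \<in> borel_measurable M" "\<And>x. x \<in> space M \<Longrightarrow> \<bar>f x\<bar> \<le> (1::real)"
  shows "integrable M f"
  by (rule integrable_const_bound[where B = 1]) (use assms in auto)

text \<open>Testing the symmetry with \<open>h x = 1 + x\<close> gives equal means for
  \<open>1 - A^2\<close> and \<open>(1 - A)^2\<close>; expanding the square leaves the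
  claim.\<close>

lemma nishimori_mean:
  assumes "nishimori M A"
  shows "expectation (\<lambda>x. (A x)\<^sup>2) = expectation A"
proof -
  note A = nishimoriD[OF assms]
  have [measurable]: "A \<in> borel_measurable M" by (rule A(1))
  have b: "0 \<le> 1 - A x" "0 \<le> 1 + A x" if "x \<in> space M" for x
    using A(2)[OF that] by (auto simp: abs_le_iff)
  have iA: "integrable M A" by (rule integrable_abs_le_1[OF A(1,2)])
  have iA2: "integrable M (\<lambda>x. (A x)\<^sup>2)"
    by (rule integrable_abs_le_1) (use A(2) in \<open>auto simp: abs_square_le_1\<close>)
  have 1: "integrable M (\<lambda>x. (1 + A x) * (1 - A x))" "integrable M (\<lambda>x. (1 - A x) * (1 - A x))"
    using iA iA2 by (simp_all add: algebra_simps power2_eq_square)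
  have "(\<integral>\<^sup>+x. ennreal (1 + A x) * ennreal (1 - A x) \<partial>M) = (\<integral>\<^sup>+x. ennreal (1 + - A x) * ennreal (1 - A x) \<partial>M)"
    by (rule A(3)[of "\<lambda>x. ennreal (1 + x)"]) measurable
  note eq = this
  have "(\<integral>\<^sup>+x. ennreal ((1 + A x) * (1 - A x)) \<partial>M) = (\<integral>\<^sup>+x. ennreal ((1 - A x) * (1 - A x)) \<partial>M)"
  proof -
    have "(\<integral>\<^sup>+x. ennreal ((1 + A x) * (1 - A x)) \<partial>M) = (\<integral>\<^sup>+x. ennreal (1 + A x) * ennreal (1 - A x) \<partial>M)"
      by (intro nn_integral_cong ennreal_mult b)
    also note eq
    also have "(\<integral>\<^sup>+x. ennreal (1 + - A x) * ennreal (1 - A x) \<partial>M) = (\<integral>\<^sup>+x. ennreal ((1 - A x) * (1 - A x)) \<partial>M)"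
    proof (rule nn_integral_cong)
      fix x assume x: "x \<in> space M"
      show "ennreal (1 + - A x) * ennreal (1 - A x) = ennreal ((1 - A x) * (1 - A x))"
        by (simp add: ennreal_mult[OF b(1)[OF x] b(1)[OF x]])
    qed
    finally show ?thesis .
  qed
  moreover have "(\<integral>\<^sup>+x. ennreal ((1 + A x) * (1 - A x)) \<partial>M) = ennreal (expectation (\<lambda>x. (1 + A x) * (1 - A x)))"
    by (rule nn_integral_eq_integral[OF 1(1)]) (intro AE_I2 mult_nonneg_nonneg b)
  moreover have "(\<integral>\<^sup>+x. ennreal ((1 - A x) * (1 - A x)) \<partial>M) = ennreal (expectation (\<lambda>x. (1 - A x) * (1 - A x)))"
    by (rule nn_integral_eq_integral[OF 1(2)]) (intro AE_I2 mult_nonneg_nonneg b)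
  moreover have "expectation (\<lambda>x. (1 + A x) * (1 - A x)) \<ge> 0" "expectation (\<lambda>x. (1 - A x) * (1 - A x)) \<ge> 0"
    by (intro integral_nonneg_AE AE_I2 mult_nonneg_nonneg b; assumption)+
  ultimately have "expectation (\<lambda>x. (1 + A x) * (1 - A x)) = expectation (\<lambda>x. (1 - A x) * (1 - A x))"
    by simp
  moreover have "expectation (\<lambda>x. (1 + A x) * (1 - A x)) = 1 - expectation (\<lambda>x. (A x)\<^sup>2)"
  proof -
    have "expectation (\<lambda>x. (1 + A x) * (1 - A x)) = expectation (\<lambda>x. 1 - (A x)\<^sup>2)"
      by (intro Bochner_Integration.integral_cong refl) (simp add: algebra_simps power2_eq_square)
    then show ?thesis using iA2 by (simp add: prob_space)
  qed
  moreover have "expectation (\<lambda>x. (1 - A x) * (1 - A x)) = expectation (\<lambda>x. 1 - 2 * A x + (A x)\<^sup>2)"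
    by (intro Bochner_Integration.integral_cong refl) (simp add: algebra_simps power2_eq_square)
  moreover have "\<dots> = 1 - 2 * expectation A + expectation (\<lambda>x. (A x)\<^sup>2)"
    using iA iA2 by (simp add: prob_space)
  ultimately show ?thesis by linarith
qed

text \<open>Integrating over two copies of \<open>M\<close> instead of over the laws of
  \<open>A\<close> and \<open>B\<close> keeps integral hypotheses about \<open>B\<close> directly
  applicable with \<open>A\<close> frozen.\<close>

lemma indep_var_nn_integral_decouple:
  fixes A B :: "'a \<Rightarrow> real" and G :: "real \<Rightarrow> real \<Rightarrow> ennreal"
  assumes ind: "indep_var borel A borel B" and G: "case_prod G \<in> borel_measurable (borel \<Otimes>\<^sub>M borel)"
  shows "(\<integral>\<^sup>+\<omega>. G (A \<omega>) (B \<omega>) \<partial>M) = (\<integral>\<^sup>+x. (\<integral>\<^sup>+y. G (A x) (B y) \<partial>M) \<partial>M)"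
proof -
  note [measurable] = indep_var_rv1[OF ind] indep_var_rv2[OF ind] G
  interpret DB: prob_space "distr M borel B" by (rule prob_space_distr) simp
  have "(\<integral>\<^sup>+\<omega>. G (A \<omega>) (B \<omega>) \<partial>M) = (\<integral>\<^sup>+z. case_prod G z \<partial>distr M (borel \<Otimes>\<^sub>M borel) (\<lambda>\<omega>. (A \<omega>, B \<omega>)))"
    by (subst nn_integral_distr) simp_all
  also have "distr M (borel \<Otimes>\<^sub>M borel) (\<lambda>\<omega>. (A \<omega>, B \<omega>)) = distr M borel A \<Otimes>\<^sub>M distr M borel B"
    using ind unfolding indep_var_distribution_eq by simp
  also have "(\<integral>\<^sup>+z. case_prod G z \<partial>(distr M borel A \<Otimes>\<^sub>M distr M borel B)) =
      (\<integral>\<^sup>+a. (\<integral>\<^sup>+b. G a b \<partial>distr M borel B) \<partial>distr M borel A)"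
    by (subst DB.nn_integral_fst[symmetric]) simp_all
  also have "\<dots> = (\<integral>\<^sup>+x. (\<integral>\<^sup>+b. G (A x) b \<partial>distr M borel B) \<partial>M)"
    by (subst nn_integral_distr) simp_all
  also have "\<dots> = (\<integral>\<^sup>+x. (\<integral>\<^sup>+y. G (A x) (B y) \<partial>M) \<partial>M)"
    by (intro nn_integral_cong) (subst nn_integral_distr, simp_all)
  finally show ?thesis .
qed

text \<open>By independence the symmetry of \<open>B\<close> may be used for each frozen value of
  \<open>A\<close>.\<close>

lemma nishimori_flip:
  assumes ind: "indep_var borel A borel B" and B: "nishimori M B"
    and g [measurable]: "case_prod g \<in> borel_measurable (borel \<Otimes>\<^sub>M borel)"
  shows "(\<integral>\<^sup>+\<omega>. g (A \<omega>) (B \<omega>) * ennreal (1 - B \<omega>) \<partial>M) = (\<integral>\<^sup>+\<omega>. g (A \<omega>) (- B \<omega>) * ennreal (1 - B \<omega>) \<partial>M)"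
proof -
  have "(\<integral>\<^sup>+\<omega>. g (A \<omega>) (B \<omega>) * ennreal (1 - B \<omega>) \<partial>M) = (\<integral>\<^sup>+x. (\<integral>\<^sup>+y. g (A x) (B y) * ennreal (1 - B y) \<partial>M) \<partial>M)"
    by (rule indep_var_nn_integral_decouple[OF ind, of "\<lambda>a b. g a b * ennreal (1 - b)"]) measurable
  also have "\<dots> = (\<integral>\<^sup>+x. (\<integral>\<^sup>+y. g (A x) (- B y) * ennreal (1 - B y) \<partial>M) \<partial>M)"
    by (intro nn_integral_cong nishimoriD(3)[OF B]) measurable
  also have "\<dots> = (\<integral>\<^sup>+\<omega>. g (A \<omega>) (- B \<omega>) * ennreal (1 - B \<omega>) \<partial>M)"
    by (rule indep_var_nn_integral_decouple[OF ind, of "\<lambda>a b. g a (- b) * ennreal (1 - b)", symmetric]) measurable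
  finally show ?thesis .
qed

lemma indep_var_swap:
  assumes "indep_var S X T Y"
  shows "indep_var T Y S X"
  unfolding indep_var_eq indep_sets2_eq
proof (intro conjI ballI)
  note i = assms[unfolded indep_var_eq indep_sets2_eq]
  show "random_variable T Y" "random_variable S X"
    by (rule i[THEN conjunct1, THEN conjunct2] i[THEN conjunct1, THEN conjunct1])+
  show "sigma_sets (space M) {Y -` A \<inter> space M |A. A \<in> sets T} \<subseteq> events"
    "sigma_sets (space M) {X -` A \<inter> space M |A. A \<in> sets S} \<subseteq> events"
    by (rule i[THEN conjunct2, THEN conjunct2, THEN conjunct1] i[THEN conjunct2, THEN conjunct1])+
  fix b a assume "b \<in> sigma_sets (space M) {Y -` A \<inter> space M |A. A \<in> sets T}"
    "a \<in> sigma_sets (space M) {X -` A \<inter> space M |A. A \<in> sets S}"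
  then have "prob (a \<inter> b) = prob a * prob b"
    using i[THEN conjunct2, THEN conjunct2, THEN conjunct2] by blast
  then show "prob (b \<inter> a) = prob b * prob a"
    by (simp only: Int_commute[of b a] mult.commute[of "prob b"])
qed

text \<open>One minus the combination equals \<open>(1 - A) * (1 - B) / (1 + A * B)\<close>. Thus
  both tilting factors appear, the signs of \<open>B\<close> and \<open>A\<close> may be flipped in
  turn, and flipping both negates the combination while keeping \<open>1 + A * B\<close>.\<close>

lemma nishimori_merge:
  assumes ind: "indep_var borel A borel B" and A: "nishimori M A" and B: "nishimori M B"
    and A1: "\<And>x. x \<in> space M \<Longrightarrow> \<bar>A x\<bar> < 1"
  shows "nishimori M (\<lambda>x. (A x + B x) / (1 + A x * B x))"
  unfolding nishimori_def
proof (intro conjI ballI)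
  have [measurable]: "A \<in> borel_measurable M" "B \<in> borel_measurable M"
    using nishimoriD(1)[OF A] nishimoriD(1)[OF B] .
  show "(\<lambda>x. (A x + B x) / (1 + A x * B x)) \<in> borel_measurable M" by measurable
  show "\<bar>(A x + B x) / (1 + A x * B x)\<bar> \<le> 1" if "x \<in> space M" for x
    by (rule merge_abs[OF A1[OF that] nishimoriD(2)[OF B that]])
  fix k :: "real \<Rightarrow> ennreal" assume [measurable]: "k \<in> borel_measurable borel"
  \<comment> \<open>The denominator \<open>1 + a * b\<close> is restored only after both flips, so
    \<open>g\<close> has to carry it through the intermediate stage.\<close>
  define g where "g a b = k ((a + b) / (1 + a * b)) * ennreal (1 / (1 + a * b))" for a b
  have g [measurable]: "case_prod g \<in> borel_measurable (borel \<Otimes>\<^sub>M borel)"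
    unfolding g_def by measurable
  have e: "ennreal (1 - (A x + B x) / (1 + A x * B x)) =
      ennreal (1 / (1 + A x * B x)) * (ennreal (1 - A x) * ennreal (1 - B x))" if x: "x \<in> space M" for x
  proof -
    have p: "1 + A x * B x > 0"
      by (rule merge_denominator_pos[OF A1[OF x] nishimoriD(2)[OF B x]])
    have "(1 - A x) * (1 - B x) = (1 + A x * B x) - (A x + B x)"
      by (simp add: algebra_simps)
    then have eq: "1 - (A x + B x) / (1 + A x * B x) = 1 / (1 + A x * B x) * ((1 - A x) * (1 - B x))"
      using p by (simp add: diff_divide_distrib)
    have nn: "0 \<le> 1 - A x" "0 \<le> 1 - B x" "0 \<le> 1 / (1 + A x * B x)"
      using A1[OF x] nishimoriD(2)[OF B x] p by (linarith, linarith, simp)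
    show ?thesis
      unfolding eq by (simp only: ennreal_mult[OF nn(3) mult_nonneg_nonneg[OF nn(1,2)]] ennreal_mult[OF nn(1,2)])
  qed
  have "(\<integral>\<^sup>+x. k ((A x + B x) / (1 + A x * B x)) * ennreal (1 - (A x + B x) / (1 + A x * B x)) \<partial>M) =
      (\<integral>\<^sup>+x. (g (A x) (B x) * ennreal (1 - A x)) * ennreal (1 - B x) \<partial>M)"
    by (intro nn_integral_cong) (simp only: e g_def mult_ac)
  also have "\<dots> = (\<integral>\<^sup>+x. (g (A x) (- B x) * ennreal (1 - A x)) * ennreal (1 - B x) \<partial>M)"
    by (rule nishimori_flip[OF ind B, of "\<lambda>a b. g a b * ennreal (1 - a)"]) measurable
  also have "\<dots> = (\<integral>\<^sup>+x. (g (A x) (- B x) * ennreal (1 - B x)) * ennreal (1 - A x) \<partial>M)"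
    by (simp only: mult_ac)
  also have "\<dots> = (\<integral>\<^sup>+x. (g (- A x) (- B x) * ennreal (1 - B x)) * ennreal (1 - A x) \<partial>M)"
    by (rule nishimori_flip[OF indep_var_swap[OF ind] A, of "\<lambda>b a. g a (- b) * ennreal (1 - b)"]) measurable
  also have "\<dots> = (\<integral>\<^sup>+x. k (- ((A x + B x) / (1 + A x * B x))) * ennreal (1 - (A x + B x) / (1 + A x * B x)) \<partial>M)"
  proof (intro nn_integral_cong)
    fix x assume x: "x \<in> space M"
    have "(- A x + - B x) / (1 + - A x * - B x) = - ((A x + B x) / (1 + A x * B x))"
      by (simp add: minus_divide_left)
    then have "g (- A x) (- B x) = k (- ((A x + B x) / (1 + A x * B x))) * ennreal (1 / (1 + A x * B x))"
      by (simp only: g_def) simp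
    then show "g (- A x) (- B x) * ennreal (1 - B x) * ennreal (1 - A x) =
        k (- ((A x + B x) / (1 + A x * B x))) * ennreal (1 - (A x + B x) / (1 + A x * B x))"
      by (simp only: e[OF x] mult_ac)
  qed
  finally show "(\<integral>\<^sup>+x. k ((A x + B x) / (1 + A x * B x)) * ennreal (1 - (A x + B x) / (1 + A x * B x)) \<partial>M) =
      (\<integral>\<^sup>+x. k (- ((A x + B x) / (1 + A x * B x))) * ennreal (1 - (A x + B x) / (1 + A x * B x)) \<partial>M)" .
qed

text \<open>Independence factorizes each term of the quadratic bound. As second moments equal means,
  the three product terms become \<open>-ab\<close>, \<open>-ab\<close> and \<open>+ab\<close> in
  the means \<open>a\<close> and \<open>b\<close>, leaving \<open>a + b - ab\<close>.\<close>

lemma nishimori_merge_mean: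
  assumes ind: "indep_var borel A borel B" and A: "nishimori M A" and B: "nishimori M B"
    and A1: "\<And>x. x \<in> space M \<Longrightarrow> \<bar>A x\<bar> < 1"
  shows "expectation (\<lambda>x. (A x + B x) / (1 + A x * B x)) \<le> 1 - (1 - expectation A) * (1 - expectation B)"
proof -
  have [measurable]: "A \<in> borel_measurable M" "B \<in> borel_measurable M"
    using nishimoriD(1)[OF A] nishimoriD(1)[OF B] .
  note b = nishimoriD(2)[OF A] nishimoriD(2)[OF B]
  have i: "integrable M A" "integrable M B" "integrable M (\<lambda>x. (A x)\<^sup>2)" "integrable M (\<lambda>x. (B x)\<^sup>2)"
    by (rule integrable_abs_le_1; simp add: b abs_square_le_1)+
  have sq: "(\<lambda>x. x\<^sup>2) \<circ> A = (\<lambda>x. (A x)\<^sup>2)" "(\<lambda>x. x\<^sup>2) \<circ> B = (\<lambda>x. (B x)\<^sup>2)" "(\<lambda>x. x) \<circ> A = A" "(\<lambda>x. x) \<circ> B = B"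
    by auto
  have ind': "indep_var borel (\<lambda>x. (A x)\<^sup>2) borel B" "indep_var borel A borel (\<lambda>x. (B x)\<^sup>2)"
    "indep_var borel (\<lambda>x. (A x)\<^sup>2) borel (\<lambda>x. (B x)\<^sup>2)"
    by (rule indep_var_compose[OF ind, of "\<lambda>x. x\<^sup>2" borel "\<lambda>x. x" borel, unfolded sq]
        indep_var_compose[OF ind, of "\<lambda>x. x" borel "\<lambda>x. x\<^sup>2" borel, unfolded sq]
        indep_var_compose[OF ind, of "\<lambda>x. x\<^sup>2" borel "\<lambda>x. x\<^sup>2" borel, unfolded sq]; simp)+
  note I = indep_var_integrable[OF ind'(1) i(3) i(2)] indep_var_integrable[OF ind'(2) i(1) i(4)]
    indep_var_integrable[OF ind'(3) i(3) i(4)]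
  note E = indep_var_lebesgue_integral[OF ind'(1) i(3) i(2)] indep_var_lebesgue_integral[OF ind'(2) i(1) i(4)]
    indep_var_lebesgue_integral[OF ind'(3) i(3) i(4)]
  have "expectation (\<lambda>x. (A x + B x) / (1 + A x * B x)) \<le>
      expectation (\<lambda>x. A x + B x - (A x)\<^sup>2 * B x - A x * (B x)\<^sup>2 + (A x)\<^sup>2 * (B x)\<^sup>2)"
  proof (rule integral_mono)
    show "integrable M (\<lambda>x. (A x + B x) / (1 + A x * B x))"
      by (rule integrable_abs_le_1[OF _ merge_abs[OF A1 b(2)]]) measurable
    show "integrable M (\<lambda>x. A x + B x - (A x)\<^sup>2 * B x - A x * (B x)\<^sup>2 + (A x)\<^sup>2 * (B x)\<^sup>2)"
      by (intro Bochner_Integration.integrable_add Bochner_Integration.integrable_diff i I)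
  qed (rule merge_le[OF A1 b(2)])
  also have "\<dots> = expectation A + expectation B - expectation A * expectation B"
    by (simp add: i I E nishimori_mean[OF A] nishimori_mean[OF B])
  finally show ?thesis by (simp add: algebra_simps)
qed

text \<open>Conditioning on \<open>X\<close> gives one term with weight
  \<open>p * (1 - \<theta> * R)\<close> and one with \<open>q * (1 + \<theta> * R)\<close>. Their
  difference is \<open>\<theta> * (1 - R)\<close>, the tilting factor of \<open>R\<close> itself:
  the common part is exchanged by the flip, and the excess is symmetric by hypothesis.\<close>

lemma nishimori_edge:
  assumes ind: "indep_var borel X borel R" and R: "nishimori M R"
    and X1: "\<And>x. x \<in> space M \<Longrightarrow> X x = -1 \<or> X x = 1" and th: "0 \<le> \<theta>" "\<theta> < (1::real)"
    and X: "\<And>G. (\<integral>\<^sup>+x. G (X x) \<partial>M) = ennreal ((1 + \<theta>) / 2) * G 1 + ennreal ((1 - \<theta>) / 2) * G (-1)"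
  shows "nishimori M (\<lambda>x. \<theta> * X x * R x)"
  unfolding nishimori_def
proof (intro conjI ballI)
  have [measurable]: "X \<in> borel_measurable M" "R \<in> borel_measurable M"
    using indep_var_rv1[OF ind] nishimoriD(1)[OF R] by simp_all
  note b = nishimoriD(2)[OF R]
  show "(\<lambda>x. \<theta> * X x * R x) \<in> borel_measurable M" by measurable
  show le: "\<bar>\<theta> * X x * R x\<bar> \<le> 1" if "x \<in> space M" for x
  proof -
    have "\<bar>X x\<bar> = 1" using X1[OF that] by auto
    then have "\<bar>\<theta> * X x * R x\<bar> = \<theta> * \<bar>R x\<bar>" using th by (simp add: abs_mult)
    also have "\<dots> \<le> 1 * 1" using th b[OF that] by (intro mult_mono) auto
    finally show ?thesis by simp
  qed
  define p q where "p = (1 + \<theta>) / 2" and "q = (1 - \<theta>) / 2"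
  have pq: "p \<ge> 0" "q \<ge> 0" using th by (simp_all add: p_def q_def)
  have split: "(\<integral>\<^sup>+x. h (\<theta> * X x * R x) * ennreal (1 - \<theta> * X x * R x) \<partial>M) =
      (\<integral>\<^sup>+y. h (\<theta> * R y) * ennreal (p * (1 - \<theta> * R y)) \<partial>M) +
      (\<integral>\<^sup>+y. h (- \<theta> * R y) * ennreal (q * (1 + \<theta> * R y)) \<partial>M)"
    if h [measurable]: "h \<in> borel_measurable borel" for h
  proof -
    have "(\<integral>\<^sup>+x. h (\<theta> * X x * R x) * ennreal (1 - \<theta> * X x * R x) \<partial>M) =
        (\<integral>\<^sup>+x. (\<integral>\<^sup>+y. h (\<theta> * X x * R y) * ennreal (1 - \<theta> * X x * R y) \<partial>M) \<partial>M)"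
      by (rule indep_var_nn_integral_decouple[OF ind, of "\<lambda>a b. h (\<theta> * a * b) * ennreal (1 - \<theta> * a * b)"]) measurable
    also have "\<dots> = ennreal p * (\<integral>\<^sup>+y. h (\<theta> * 1 * R y) * ennreal (1 - \<theta> * 1 * R y) \<partial>M) +
        ennreal q * (\<integral>\<^sup>+y. h (\<theta> * -1 * R y) * ennreal (1 - \<theta> * -1 * R y) \<partial>M)"
      unfolding p_def q_def by (rule X)
    also have "ennreal p * (\<integral>\<^sup>+y. h (\<theta> * 1 * R y) * ennreal (1 - \<theta> * 1 * R y) \<partial>M) =
        (\<integral>\<^sup>+y. h (\<theta> * R y) * ennreal (p * (1 - \<theta> * R y)) \<partial>M)"
      using pq by (subst nn_integral_cmult[symmetric]) (simp_all add: ennreal_mult' mult_ac)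
    also have "ennreal q * (\<integral>\<^sup>+y. h (\<theta> * -1 * R y) * ennreal (1 - \<theta> * -1 * R y) \<partial>M) =
        (\<integral>\<^sup>+y. h (- \<theta> * R y) * ennreal (q * (1 + \<theta> * R y)) \<partial>M)"
      using pq by (subst nn_integral_cmult[symmetric]) (simp_all add: ennreal_mult' mult_ac)
    finally show ?thesis .
  qed
  fix h :: "real \<Rightarrow> ennreal" assume h [measurable]: "h \<in> borel_measurable borel"
  let ?a = "\<lambda>y. h (\<theta> * R y)" and ?b = "\<lambda>y. h (- \<theta> * R y)"
  let ?u = "\<lambda>y. ennreal (q * (1 + \<theta> * R y))" and ?w = "\<lambda>y. ennreal (\<theta> * (1 - R y))"
  have uw: "ennreal (p * (1 - \<theta> * R y)) = ?u y + ?w y" if "y \<in> space M" for y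
  proof -
    have "\<bar>\<theta> * R y\<bar> \<le> 1 * 1" unfolding abs_mult using th b[OF that] by (intro mult_mono) auto
    then have "0 \<le> 1 + \<theta> * R y" "0 \<le> 1 - R y" using b[OF that] by (auto simp: abs_le_iff)
    moreover have "p * (1 - \<theta> * R y) = q * (1 + \<theta> * R y) + \<theta> * (1 - R y)"
      by (simp add: p_def q_def field_simps)
    ultimately show ?thesis using pq th by (simp only: ennreal_plus[symmetric] mult_nonneg_nonneg)
  qed
  have uw': "(\<integral>\<^sup>+y. f y * ennreal (p * (1 - \<theta> * R y)) \<partial>M) = (\<integral>\<^sup>+y. f y * (?u y + ?w y) \<partial>M)" for f
    by (intro nn_integral_cong) (simp only: uw)
  have w: "(\<integral>\<^sup>+y. ?a y * ?w y \<partial>M) = (\<integral>\<^sup>+y. ?b y * ?w y \<partial>M)"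
  proof -
    have *: "(\<integral>\<^sup>+y. f y * ?w y \<partial>M) = ennreal \<theta> * (\<integral>\<^sup>+y. f y * ennreal (1 - R y) \<partial>M)"
      if "f \<in> borel_measurable M" for f
      using that th by (subst nn_integral_cmult[symmetric]) (simp_all add: ennreal_mult' mult_ac)
    have "(\<integral>\<^sup>+y. ?a y * ?w y \<partial>M) = ennreal \<theta> * (\<integral>\<^sup>+y. ?a y * ennreal (1 - R y) \<partial>M)"
      by (rule *) measurable
    also have "(\<integral>\<^sup>+y. ?a y * ennreal (1 - R y) \<partial>M) = (\<integral>\<^sup>+y. h (\<theta> * - R y) * ennreal (1 - R y) \<partial>M)"
      by (rule nishimoriD(3)[OF R, of "\<lambda>x. h (\<theta> * x)"]) measurable
    also have "\<dots> = (\<integral>\<^sup>+y. ?b y * ennreal (1 - R y) \<partial>M)"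
      by simp
    also have "ennreal \<theta> * \<dots> = (\<integral>\<^sup>+y. ?b y * ?w y \<partial>M)"
      by (rule *[symmetric]) measurable
    finally show ?thesis .
  qed
  have "(\<integral>\<^sup>+x. h (\<theta> * X x * R x) * ennreal (1 - \<theta> * X x * R x) \<partial>M) =
      (\<integral>\<^sup>+y. ?a y * (?u y + ?w y) \<partial>M) + (\<integral>\<^sup>+y. ?b y * ?u y \<partial>M)"
    unfolding split[OF h] uw' ..
  also have "(\<integral>\<^sup>+y. ?a y * (?u y + ?w y) \<partial>M) = (\<integral>\<^sup>+y. ?a y * ?u y \<partial>M) + (\<integral>\<^sup>+y. ?a y * ?w y \<partial>M)"
    by (simp add: distrib_left nn_integral_add)
  also have "(\<integral>\<^sup>+y. ?a y * ?u y \<partial>M) + (\<integral>\<^sup>+y. ?a y * ?w y \<partial>M) + (\<integral>\<^sup>+y. ?b y * ?u y \<partial>M) =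
      ((\<integral>\<^sup>+y. ?b y * ?u y \<partial>M) + (\<integral>\<^sup>+y. ?b y * ?w y \<partial>M)) + (\<integral>\<^sup>+y. ?a y * ?u y \<partial>M)"
    unfolding w by (simp only: ac_simps)
  also have "(\<integral>\<^sup>+y. ?b y * ?u y \<partial>M) + (\<integral>\<^sup>+y. ?b y * ?w y \<partial>M) = (\<integral>\<^sup>+y. ?b y * (?u y + ?w y) \<partial>M)"
    by (simp add: distrib_left nn_integral_add)
  also have "(\<integral>\<^sup>+y. ?b y * (?u y + ?w y) \<partial>M) + (\<integral>\<^sup>+y. ?a y * ?u y \<partial>M) =
      (\<integral>\<^sup>+x. h (- (\<theta> * X x * R x)) * ennreal (1 - \<theta> * X x * R x) \<partial>M)"
    using split[of "\<lambda>x. h (- x)"] unfolding uw' by simp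
  finally show "(\<integral>\<^sup>+x. h (\<theta> * X x * R x) * ennreal (1 - \<theta> * X x * R x) \<partial>M) =
      (\<integral>\<^sup>+x. h (- (\<theta> * X x * R x)) * ennreal (1 - \<theta> * X x * R x) \<partial>M)" .
qed

end

section \<open>Decay of the root magnetization\<close>

lemma nishimori_cong:
  assumes "\<And>x. x \<in> space M \<Longrightarrow> A x = B x" "nishimori M A"
  shows "nishimori M B"
  unfolding nishimori_def
proof (intro conjI ballI)
  note A = nishimoriD[OF assms(2)]
  show "B \<in> borel_measurable M"
    using A(1) measurable_cong[of M A B borel] assms(1) by blast
  show "\<bar>B x\<bar> \<le> 1" if "x \<in> space M" for x
    using A(2)[OF that] assms(1)[OF that] by simp
  fix h :: "real \<Rightarrow> ennreal" assume h: "h \<in> borel_measurable borel"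
  have "(\<integral>\<^sup>+x. h (B x) * ennreal (1 - B x) \<partial>M) = (\<integral>\<^sup>+x. h (A x) * ennreal (1 - A x) \<partial>M)"
    by (intro nn_integral_cong) (simp add: assms(1))
  also have "\<dots> = (\<integral>\<^sup>+x. h (- A x) * ennreal (1 - A x) \<partial>M)" by (rule A(3)[OF h])
  also have "\<dots> = (\<integral>\<^sup>+x. h (- B x) * ennreal (1 - B x) \<partial>M)"
    by (intro nn_integral_cong) (simp add: assms(1))
  finally show "(\<integral>\<^sup>+x. h (B x) * ennreal (1 - B x) \<partial>M) = (\<integral>\<^sup>+x. h (- B x) * ennreal (1 - B x) \<partial>M)" .
qed

context ising_tree
begin

text \<open>\<open>R k v\<close> is \<open>\<sigma>\<^sub>v\<close> times the magnetization at \<open>v\<close> given the spins \<open>k\<close> levels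
  below \<open>v\<close>, in edge variables.\<close>

primrec R :: "nat \<Rightarrow> 'v \<Rightarrow> ('v \<Rightarrow> real) \<Rightarrow> real" where
  "R 0 = (\<lambda>v \<xi>. 1)"
| "R (Suc k) = (\<lambda>v \<xi>. comb (ch v) (\<lambda>c. \<theta> * \<xi> c * R k c \<xi>))"

text \<open>Majorant for the mean of \<open>R k v\<close> at a vertex with \<open>d\<close>
  children: an edge multiplies the mean by \<open>\<theta>^2\<close>, and combining multiplies the
  deficits from 1.\<close>

primrec env :: "nat \<Rightarrow> real" where
  "env 0 = 1"
| "env (Suc k) = 1 - (1 - \<theta>\<^sup>2 * env k) ^ d"

text \<open>Since \<open>\<theta> < 1\<close>, the bound is strict even at the initial value
  \<open>R 0 = 1\<close>; strictness keeps all denominators of combinations positive.\<close>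

lemma edge_abs_less_1:
  assumes "\<xi> \<in> space spin_space" "\<bar>y\<bar> \<le> 1"
  shows "\<bar>\<theta> * \<xi> c * y\<bar> < 1"
proof -
  have "\<bar>\<xi> c\<bar> = 1" using spin_values[OF assms(1), of c] by auto
  then have "\<bar>\<theta> * \<xi> c * y\<bar> = \<theta> * \<bar>y\<bar>" using \<theta> by (simp add: abs_mult)
  also have "\<dots> \<le> \<theta> * 1" using \<theta> assms by (intro mult_left_mono) auto
  finally show ?thesis using \<theta> by simp
qed

lemma R_abs: "\<xi> \<in> space spin_space \<Longrightarrow> \<bar>R k v \<xi>\<bar> \<le> 1"
proof (induction k arbitrary: v)
  case (Suc k)
  have "\<bar>comb (ch v) (\<lambda>c. \<theta> * \<xi> c * R k c \<xi>)\<bar> < 1"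
    by (rule comb_abs) (rule edge_abs_less_1[OF Suc.prems Suc.IH[OF Suc.prems]])
  then show ?case by simp
qed simp

lemma comb_measurable:
  assumes "\<And>c. c \<in> F \<Longrightarrow> A c \<in> borel_measurable M"
  shows "(\<lambda>\<xi>. comb F (\<lambda>c. A c \<xi>)) \<in> borel_measurable M"
  unfolding comb_def
  by (intro borel_measurable_divide borel_measurable_diff borel_measurable_add
      borel_measurable_prod borel_measurable_const assms)

lemma R_measurable [measurable]: "R k v \<in> borel_measurable spin_space"
proof (induction k arbitrary: v)
  case (Suc k)
  show ?case
    unfolding R.simps by (intro comb_measurable borel_measurable_times borel_measurable_const borel_measurable_spin Suc)
qed simp

text \<open>The edge variable of \<open>v\<close> itself is excluded, which makes it independent of
  \<open>R k v\<close>.\<close>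

lemma R_local: "(\<And>u. u \<in> desc v - {v} \<Longrightarrow> \<xi> u = \<xi>' u) \<Longrightarrow> R k v \<xi> = R k v \<xi>'"
proof (induction k arbitrary: v)
  case (Suc k)
  have "\<theta> * \<xi> c * R k c \<xi> = \<theta> * \<xi>' c * R k c \<xi>'" if c: "c \<in> ch v" for c
  proof -
    have "\<xi> c = \<xi>' c" using desc_child[OF c] desc_self[of c] by (intro Suc.prems) blast
    moreover have "R k c \<xi> = R k c \<xi>'" using desc_child[OF c] by (intro Suc.IH Suc.prems) blast
    ultimately show ?thesis by simp
  qed
  then show ?case unfolding R.simps by (rule comb_cong)
qed simp

lemma edge_indep_var:
  assumes X: "X \<in> borel_measurable spin_space" "Y \<in> borel_measurable spin_space"
    and depX: "\<And>x y. (\<And>i. i \<in> K1 \<Longrightarrow> x i = y i) \<Longrightarrow> X x = (X y :: real)"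
    and depY: "\<And>x y. (\<And>i. i \<in> K2 \<Longrightarrow> x i = y i) \<Longrightarrow> Y x = (Y y :: real)"
    and disj: "K1 \<inter> K2 = {}"
  shows "E.indep_var borel X borel Y"
  unfolding E.indep_var_def
proof (rule edge_indep[where K = "case_bool K1 K2"])
  show "case_bool X Y j \<in> measurable spin_space (case_bool borel borel j)" for j
    using X by (cases j) simp_all
  show "case_bool X Y j x = case_bool X Y j y" if "\<And>i. i \<in> case_bool K1 K2 j \<Longrightarrow> x i = y i" for j x y
    using that by (cases j) (auto intro: depX depY)
  show "disjoint_family_on (case_bool K1 K2) UNIV"
    using disj by (auto simp: disjoint_family_on_def split: bool.split)
qed

lemma nn_integral_edge_variable:
  assumes v: "v \<noteq> r"
  shows "(\<integral>\<^sup>+\<xi>. G (\<xi> v) \<partial>edge_measure) = ennreal ((1 + \<theta>) / 2) * G 1 + ennreal ((1 - \<theta>) / 2) * G (-1)"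
proof -
  have G: "G \<in> borel_measurable (edge_law v)"
    unfolding measurable_cong_sets[OF sets_edge_law refl] by simp
  have "(\<integral>\<^sup>+\<xi>. G (\<xi> v) \<partial>edge_measure) = (\<integral>\<^sup>+x. G x \<partial>distr edge_measure (edge_law v) (\<lambda>\<xi>. \<xi> v))"
    by (subst nn_integral_distr) (use G in \<open>simp_all add: edge_measure_def\<close>)
  also have "distr edge_measure (edge_law v) (\<lambda>\<xi>. \<xi> v) = edge_law v"
    unfolding edge_measure_def by (rule distr_PiM_component[OF prob_edge_law]) simp
  also have "(\<integral>\<^sup>+x. G x \<partial>edge_law v) = (\<Sum>x\<in>{-1, 1}. ennreal (weight v x) * G x)"
    unfolding edge_law_def by (subst nn_integral_point_measure_finite) (simp_all add: mult.commute)
  also have "\<dots> = ennreal ((1 + \<theta>) / 2) * G 1 + ennreal ((1 - \<theta>) / 2) * G (-1)"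
    using v by (simp add: weight_def add.commute)
  finally show ?thesis .
qed

lemma edge_variable_borel: "(\<lambda>\<xi>. \<xi> v) \<in> borel_measurable edge_measure"
  using borel_measurable_spin by (simp add: measurable_cong_sets[OF sets_edge_measure refl])

lemma integrable_edge_variable: "integrable edge_measure (\<lambda>\<xi>. \<xi> v)"
proof (rule E.integrable_abs_le_1[OF edge_variable_borel])
  show "\<bar>\<xi> v\<bar> \<le> 1" if "\<xi> \<in> space edge_measure" for \<xi>
    using spin_values[of \<xi> v] that by (auto simp: space_edge_measure)
qed

lemma expectation_edge_variable:
  assumes v: "v \<noteq> r"
  shows "E.expectation (\<lambda>\<xi>. \<xi> v) = \<theta>"
proof -
  have nn: "0 \<le> 1 + \<xi> v" if "\<xi> \<in> space edge_measure" for \<xi>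
    using spin_values[of \<xi> v] that by (auto simp: space_edge_measure)
  have i: "integrable edge_measure (\<lambda>\<xi>. 1 + \<xi> v)"
    using integrable_edge_variable by simp
  have "ennreal (E.expectation (\<lambda>\<xi>. 1 + \<xi> v)) = (\<integral>\<^sup>+\<xi>. ennreal (1 + \<xi> v) \<partial>edge_measure)"
    by (rule nn_integral_eq_integral[symmetric, OF i]) (intro AE_I2 nn)
  also have "\<dots> = ennreal ((1 + \<theta>) / 2) * ennreal 2"
    by (subst nn_integral_edge_variable[OF v]) simp
  also have "\<dots> = ennreal (1 + \<theta>)"
  proof -
    have "ennreal ((1 + \<theta>) / 2) * ennreal 2 = ennreal ((1 + \<theta>) / 2 * 2)"
      using \<theta> by (intro ennreal_mult[symmetric]) simp_all
    also have "(1 + \<theta>) / 2 * 2 = 1 + \<theta>" by simp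
    finally show ?thesis .
  qed
  finally have "E.expectation (\<lambda>\<xi>. 1 + \<xi> v) = 1 + \<theta>"
    using \<theta> nn by (subst (asm) ennreal_inj) (auto intro!: integral_nonneg_AE)
  then show ?thesis
    using integrable_edge_variable[of v] by (simp add: E.prob_space)
qed

lemma env_bounds: "0 \<le> env k \<and> env k \<le> 1"
proof (induction k)
  case (Suc k)
  have "\<theta>\<^sup>2 \<le> 1" using \<theta> by (simp add: abs_square_le_1)
  then have "\<theta>\<^sup>2 * env k \<le> 1 * 1" using Suc by (intro mult_mono) auto
  moreover have "0 \<le> \<theta>\<^sup>2 * env k" using Suc by simp
  ultimately have "0 \<le> 1 - \<theta>\<^sup>2 * env k" "1 - \<theta>\<^sup>2 * env k \<le> 1" by simp_all
  then have "0 \<le> (1 - \<theta>\<^sup>2 * env k) ^ d" "(1 - \<theta>\<^sup>2 * env k) ^ d \<le> 1"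
    by (simp_all add: power_le_one)
  then show ?case by simp
qed simp

lemma env_edge_le_1: "\<theta>\<^sup>2 * env k \<le> 1"
proof -
  have "\<theta>\<^sup>2 \<le> 1" using \<theta> by (simp add: abs_square_le_1)
  then have "\<theta>\<^sup>2 * env k \<le> 1 * 1" using env_bounds[of k] by (intro mult_mono) auto
  then show ?thesis by simp
qed

text \<open>The symmetry and the mean bound are proved together, since the bound on a combination
  uses the symmetry of its parts. The symmetry holds at the root too; the mean bound needs exactly
  \<open>d\<close> children.\<close>

lemma R_nishimori_mean:
  "nishimori edge_measure (R k v) \<and> (v \<noteq> r \<longrightarrow> E.expectation (R k v) \<le> env k)"
proof (induction k arbitrary: v)
  case 0
  show ?case by (simp add: nishimori_def E.prob_space)
next
  case (Suc k)
  define A where "A c \<xi> = \<theta> * \<xi> c * R k c \<xi>" for c \<xi>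
  have mR: "R j c \<in> borel_measurable edge_measure" for j c
    by (simp add: measurable_cong_sets[OF sets_edge_measure refl])
  have ind: "E.indep_var borel (\<lambda>\<xi>. \<xi> c) borel (R k c)" for c
    by (rule edge_indep_var[where ?K1.0 = "{c}" and ?K2.0 = "desc c - {c}"]) (auto intro: R_local)
  have A_nish: "nishimori edge_measure (A c)" if "c \<in> ch v" for c
    unfolding A_def
  proof (rule E.nishimori_edge[OF ind conjunct1[OF Suc.IH]])
    show "\<xi> c = -1 \<or> \<xi> c = 1" if "\<xi> \<in> space edge_measure" for \<xi>
      using that by (intro spin_values) (simp add: space_edge_measure)
  qed (use \<theta> chD[OF that] nn_integral_edge_variable in simp_all)
  have A_mean: "E.expectation (A c) \<le> \<theta>\<^sup>2 * env k" if "c \<in> ch v" for c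
  proof -
    have c: "c \<noteq> r" using chD[OF that] by blast
    have iR: "integrable edge_measure (R k c)"
      by (rule E.integrable_abs_le_1[OF mR]) (simp add: R_abs space_edge_measure)
    have "E.expectation (A c) = \<theta> * E.expectation (\<lambda>\<xi>. \<xi> c * R k c \<xi>)"
      unfolding A_def by (simp add: mult.assoc)
    also have "\<dots> = \<theta>\<^sup>2 * E.expectation (R k c)"
      by (simp add: E.indep_var_lebesgue_integral[OF ind integrable_edge_variable iR]
          expectation_edge_variable[OF c] power2_eq_square)
    also have "\<dots> \<le> \<theta>\<^sup>2 * env k"
      using Suc.IH[of c] c by (intro mult_left_mono) auto
    finally show ?thesis .
  qed
  have A_abs: "\<bar>A c \<xi>\<bar> < 1" if "\<xi> \<in> space edge_measure" for c \<xi>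
    unfolding A_def using that by (intro edge_abs_less_1 R_abs) (simp_all add: space_edge_measure)
  have A_meas: "A c \<in> borel_measurable spin_space" for c
    unfolding A_def by measurable
  have A_local: "A c x = A c y" if "\<And>i. i \<in> desc c \<Longrightarrow> x i = y i" for c x y
    unfolding A_def using that desc_self[of c] R_local[of c x y k] by simp
  \<comment> \<open>Induction over subsets of the children, so that each step merges just two
    independent observations.\<close>
  have *: "nishimori edge_measure (\<lambda>\<xi>. comb F (\<lambda>c. A c \<xi>)) \<and>
      E.expectation (\<lambda>\<xi>. comb F (\<lambda>c. A c \<xi>)) \<le> 1 - (1 - \<theta>\<^sup>2 * env k) ^ card F"
    if "finite F" "F \<subseteq> ch v" for F
    using that
  proof (induction F rule: finite_induct)
    case empty
    show ?case by (simp add: nishimori_def)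
  next
    case (insert c F)
    let ?C = "\<lambda>\<xi>. comb F (\<lambda>c. A c \<xi>)"
    have c: "c \<in> ch v" and F: "F \<subseteq> ch v" using insert.prems by auto
    have IH: "nishimori edge_measure ?C" "E.expectation ?C \<le> 1 - (1 - \<theta>\<^sup>2 * env k) ^ card F"
      using insert.IH[OF F] by auto
    have C_abs: "\<bar>?C \<xi>\<bar> < 1" if "\<xi> \<in> space edge_measure" for \<xi>
      by (rule comb_abs) (rule A_abs[OF that])
    have "(\<Union>c'\<in>F. desc c') \<inter> desc c = {}"
    proof -
      have "desc c' \<inter> desc c = {}" if "c' \<in> F" for c'
        using that F c insert.hyps(2) chD[of c' v] chD[of c v] by (intro desc_disjoint) auto
      then show ?thesis by blast
    qed
    then have indC: "E.indep_var borel ?C borel (A c)"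
    proof (rule edge_indep_var[rotated 4])
      show "?C \<in> borel_measurable spin_space" by (rule comb_measurable) (rule A_meas)
      show "A c \<in> borel_measurable spin_space" by (rule A_meas)
      show "?C x = ?C y" if "\<And>i. i \<in> (\<Union>c'\<in>F. desc c') \<Longrightarrow> x i = y i" for x y
        by (rule comb_cong) (rule A_local, use that in blast)
      show "A c x = A c y" if "\<And>i. i \<in> desc c \<Longrightarrow> x i = y i" for x y
        by (rule A_local) (rule that)
    qed
    have eq: "comb (insert c F) (\<lambda>c. A c \<xi>) = (?C \<xi> + A c \<xi>) / (1 + ?C \<xi> * A c \<xi>)"
      if "\<xi> \<in> space edge_measure" for \<xi>
      by (rule comb_insert[OF insert.hyps]) (rule A_abs[OF that])
    have "nishimori edge_measure (\<lambda>\<xi>. comb (insert c F) (\<lambda>c. A c \<xi>))"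
      by (rule nishimori_cong[OF eq[symmetric] E.nishimori_merge[OF indC IH(1) A_nish[OF c] C_abs]])
    moreover have "E.expectation (\<lambda>\<xi>. comb (insert c F) (\<lambda>c. A c \<xi>)) \<le> 1 - (1 - \<theta>\<^sup>2 * env k) ^ card (insert c F)"
    proof -
      have "E.expectation (\<lambda>\<xi>. comb (insert c F) (\<lambda>c. A c \<xi>)) =
          E.expectation (\<lambda>\<xi>. (?C \<xi> + A c \<xi>) / (1 + ?C \<xi> * A c \<xi>))"
        by (intro Bochner_Integration.integral_cong refl eq)
      also have "\<dots> \<le> 1 - (1 - E.expectation ?C) * (1 - E.expectation (A c))"
        by (rule E.nishimori_merge_mean[OF indC IH(1) A_nish[OF c] C_abs])
      also have "\<dots> \<le> 1 - (1 - \<theta>\<^sup>2 * env k) ^ card F * (1 - \<theta>\<^sup>2 * env k)"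
      proof -
        have p: "0 \<le> 1 - \<theta>\<^sup>2 * env k" "0 \<le> (1 - \<theta>\<^sup>2 * env k) ^ card F" using env_edge_le_1[of k] by simp_all
        have q: "(1 - \<theta>\<^sup>2 * env k) ^ card F \<le> 1 - E.expectation ?C" using IH(2) by linarith
        have "(1 - \<theta>\<^sup>2 * env k) ^ card F * (1 - \<theta>\<^sup>2 * env k) \<le> (1 - E.expectation ?C) * (1 - E.expectation (A c))"
          using A_mean[OF c] p q by (intro mult_mono) linarith+
        then show ?thesis by linarith
      qed
      finally show ?thesis using insert.hyps by (simp add: mult.commute)
    qed
    ultimately show ?case by blast
  qed
  have Req: "R (Suc k) v = (\<lambda>\<xi>. comb (ch v) (\<lambda>c. A c \<xi>))"
    by (simp add: A_def)
  show ?case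
  proof (intro conjI impI)
    show "nishimori edge_measure (R (Suc k) v)"
      unfolding Req using *[OF finite_ch subset_refl] by (rule conjunct1)
    assume "v \<noteq> r"
    then show "E.expectation (R (Suc k) v) \<le> env (Suc k)"
      unfolding Req using *[OF finite_ch[of v] subset_refl] by (simp add: card_ch)
  qed
qed

text \<open>Chebyshev's inequality; by the symmetry, the second moment it needs is the mean that
  \<open>env\<close> controls.\<close>

lemma measure_R_large:
  assumes "v \<noteq> r" "0 < \<epsilon>"
  shows "measure edge_measure {\<xi>\<in>space spin_space. \<epsilon> \<le> \<bar>R k v \<xi>\<bar>} \<le> env k / \<epsilon>\<^sup>2"
proof -
  have mR: "R k v \<in> borel_measurable edge_measure"
    by (simp add: measurable_cong_sets[OF sets_edge_measure refl])
  have i: "integrable edge_measure (\<lambda>\<xi>. (R k v \<xi>)\<^sup>2)"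
    by (rule E.integrable_abs_le_1) (use mR in \<open>simp_all add: R_abs space_edge_measure abs_square_le_1\<close>)
  have "\<epsilon> \<le> \<bar>R k v \<xi>\<bar> \<longleftrightarrow> \<epsilon>\<^sup>2 \<le> (R k v \<xi>)\<^sup>2" for \<xi>
    using assms(2) abs_le_square_iff[of \<epsilon> "R k v \<xi>"] by simp
  then have "measure edge_measure {\<xi>\<in>space spin_space. \<epsilon> \<le> \<bar>R k v \<xi>\<bar>} =
      measure edge_measure {\<xi>\<in>space edge_measure. (R k v \<xi>)\<^sup>2 \<ge> \<epsilon>\<^sup>2}"
    by (simp add: space_edge_measure)
  also have "\<dots> \<le> E.expectation (\<lambda>\<xi>. (R k v \<xi>)\<^sup>2) / \<epsilon>\<^sup>2"
    by (rule integral_Markov_inequality_measure[OF i sets.top]) (use assms in simp_all)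
  also have "E.expectation (\<lambda>\<xi>. (R k v \<xi>)\<^sup>2) = E.expectation (R k v)"
    by (rule E.nishimori_mean) (rule conjunct1[OF R_nishimori_mean])
  also have "\<dots> / \<epsilon>\<^sup>2 \<le> env k / \<epsilon>\<^sup>2"
    using R_nishimori_mean[of k v] assms by (intro divide_right_mono) auto
  finally show ?thesis .
qed

text \<open>Bernoulli's inequality makes the sequence decreasing when
  \<open>d * \<theta>^2 \<le> 1\<close>, so it converges to a fixed point. A positive fixed point is
  excluded by the strict form of the same inequality, which covers the critical case as
  well.\<close>

lemma env_tendsto_0:
  assumes crit: "d * \<theta>\<^sup>2 \<le> 1"
  shows "env \<longlonglongrightarrow> 0"
proof -
  have dec: "env (Suc k) \<le> env k" for k
  proof -
    have "1 + real d * (- (\<theta>\<^sup>2 * env k)) \<le> (1 + (- (\<theta>\<^sup>2 * env k))) ^ d"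
      using env_edge_le_1[of k] by (intro Bernoulli_inequality) simp
    then have "env (Suc k) \<le> (d * \<theta>\<^sup>2) * env k" by (simp add: algebra_simps)
    also have "\<dots> \<le> 1 * env k" using crit env_bounds[of k] by (intro mult_right_mono) auto
    finally show ?thesis by simp
  qed
  then have "decseq env" by (intro decseq_SucI)
  then obtain L where L: "env \<longlonglongrightarrow> L"
    using decseq_convergent[of env 0] env_bounds by blast
  have L01: "0 \<le> L" "L \<le> 1"
    using L env_bounds by (auto intro: LIMSEQ_le_const LIMSEQ_le_const2)
  have "(\<lambda>k. env (Suc k)) \<longlonglongrightarrow> 1 - (1 - \<theta>\<^sup>2 * L) ^ d"
    unfolding env.simps by (intro tendsto_intros L)
  with LIMSEQ_Suc[OF L] have fix_L: "L = 1 - (1 - \<theta>\<^sup>2 * L) ^ d"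
    by (rule LIMSEQ_unique)
  have "L = 0"
  proof (rule ccontr)
    assume "L \<noteq> 0"
    then have Lp: "L > 0" using L01 by simp
    \<comment> \<open>The value of \<open>\<theta>^2 * L\<close> at criticality, which is the worst
      case.\<close>
    define y where "y = L / d"
    have d: "real d \<ge> 2" using d2 by simp
    have y: "0 < y" "y < 1" using Lp L01 d by (simp_all add: y_def)
    have "\<theta>\<^sup>2 \<le> 1 / d" using crit d by (simp add: field_simps)
    then have "\<theta>\<^sup>2 * L \<le> y" using mult_right_mono[of "\<theta>\<^sup>2" "1 / d" L] Lp by (simp add: y_def)
    then have "(1 - y) ^ d \<le> (1 - \<theta>\<^sup>2 * L) ^ d" using y by (intro power_mono) auto
    moreover have "1 - d * y < (1 - y) ^ d"
    proof -
      \<comment> \<open>Splitting off one factor of the power leaves the surplus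
        \<open>e * y^2\<close>, positive because \<open>d\<close> is at least 2.\<close>
      obtain e where e: "d = Suc e" "e \<ge> 1" using d2 by (cases d) auto
      have "1 + real e * (- y) \<le> (1 + (- y)) ^ e" using y by (intro Bernoulli_inequality) simp
      then have "(1 - e * y) * (1 - y) \<le> (1 - y) ^ e * (1 - y)" using y by (intro mult_right_mono) auto
      moreover have "(1 - e * y) * (1 - y) = 1 - d * y + e * y\<^sup>2"
        by (simp add: e(1) algebra_simps power2_eq_square)
      moreover have "e * y\<^sup>2 > 0" using e(2) y by simp
      ultimately show ?thesis by (simp add: e(1) mult.commute)
    qed
    moreover have "d * y = L" using d by (simp add: y_def)
    ultimately show False using fix_L by linarith
  qed
  with L show ?thesis by simp
qed

end

section \<open>Extremality below the reconstruction threshold\<close>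

text \<open>Any function of a sign \<open>s\<close> is affine in \<open>s\<close>. Here the constant
  term is the mean of the two products, and the normalized slope is by definition the
  combination.\<close>

lemma prod_eq_comb:
  assumes A: "\<And>c. c \<in> F \<Longrightarrow> \<bar>A c\<bar> < (1::real)" and s: "s = -1 \<or> s = 1"
  shows "(\<Prod>c\<in>F. 1 + s * A c) = ((\<Prod>c\<in>F. 1 + A c) + (\<Prod>c\<in>F. 1 - A c)) / 2 * (1 + s * comb F A)"
proof -
  have p: "(\<Prod>c\<in>F. 1 + A c) > 0" "(\<Prod>c\<in>F. 1 - A c) > 0"
    by (rule comb_prods_pos[of F A], rule A, assumption)+
  have x: "x = (x + y) / 2 * (1 + (x - y) / (x + y))" "y = (x + y) / 2 * (1 - (x - y) / (x + y))"
    if "x > 0" "y > 0" for x y :: real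
    using that by (simp_all add: field_simps)
  from s show ?thesis
  proof
    assume "s = -1"
    then show ?thesis using x(2)[OF p, folded comb_def] by simp
  next
    assume "s = 1"
    then show ?thesis using x(1)[OF p, folded comb_def] by simp
  qed
qed

section \<open>Marginals of finite-volume kernels, by summing out levels\<close>

context ising_tree
begin

text \<open>The belief-propagation recursion: the mean of the spin at \<open>v\<close> given the
  spins of \<eta> exactly \<open>k\<close> levels below it, seen from its subtree alone. It is the
  counterpart in spins of \<open>R\<close>, with the sign of \<open>v\<close> included.\<close>

primrec mag :: "nat \<Rightarrow> 'v \<Rightarrow> ('v \<Rightarrow> real) \<Rightarrow> real" where
  "mag 0 = (\<lambda>v \<eta>. \<eta> v)"
| "mag (Suc k) = (\<lambda>v \<eta>. comb (ch v) (\<lambda>c. \<theta> * mag k c \<eta>))"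

lemma mag_eq: "\<eta> \<in> space spin_space \<Longrightarrow> mag k v \<eta> = \<eta> v * R k v (inc \<eta>)"
proof (induction k arbitrary: v)
  case (Suc k)
  have "\<theta> * mag k c \<eta> = \<eta> v * (\<theta> * inc \<eta> c * R k c (inc \<eta>))" if c: "c \<in> ch v" for c
  proof -
    have "inc \<eta> c = \<eta> c * \<eta> v" using chD[OF c] by (simp add: inc_def)
    then have "\<eta> v * (\<theta> * inc \<eta> c * R k c (inc \<eta>)) = (\<eta> v * \<eta> v) * (\<theta> * (\<eta> c * R k c (inc \<eta>)))"
      by (simp add: mult_ac)
    also have "\<dots> = \<theta> * (\<eta> c * R k c (inc \<eta>))"
      by (simp add: spin_square[OF Suc.prems])
    finally show ?thesis by (simp only: Suc.IH[OF Suc.prems])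
  qed
  then have "mag (Suc k) v \<eta> = comb (ch v) (\<lambda>c. \<eta> v * (\<theta> * inc \<eta> c * R k c (inc \<eta>)))"
    unfolding mag.simps by (rule comb_cong)
  also have "\<dots> = \<eta> v * comb (ch v) (\<lambda>c. \<theta> * inc \<eta> c * R k c (inc \<eta>))"
    by (rule comb_sign[OF spin_values[OF Suc.prems]])
  finally show ?case by simp
qed simp

lemma mag_abs_eq: "\<eta> \<in> space spin_space \<Longrightarrow> \<bar>mag k v \<eta>\<bar> = \<bar>R k v (inc \<eta>)\<bar>"
  using spin_values[of \<eta> v] by (auto simp: mag_eq)

lemma mag_abs: "\<eta> \<in> space spin_space \<Longrightarrow> \<bar>mag k v \<eta>\<bar> \<le> 1"
  by (simp add: mag_abs_eq R_abs inc_space)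

lemma mag_measurable [measurable]: "mag k v \<in> borel_measurable spin_space"
proof (induction k arbitrary: v)
  case (Suc k)
  show ?case
    unfolding mag.simps by (intro comb_measurable borel_measurable_times borel_measurable_const Suc)
qed simp

abbreviation W :: "nat \<Rightarrow> ('v \<Rightarrow> real) \<Rightarrow> real" where
  "W n \<tau> \<equiv> \<Prod>v\<in>ball n. weight v (inc \<tau> v)"

lemma prod_level_Suc: "(\<Prod>c\<in>level (Suc n). f c) = (\<Prod>v\<in>level n. \<Prod>c\<in>ch v. f c)"
  for f :: "'v \<Rightarrow> real"
  unfolding level_Suc by (rule prod.UNION_disjoint) (auto simp: ch_iff)

text \<open>Factors are grouped by parent, and each group is affine in the parent spin. The constant
  \<open>D\<close> does not depend on the configuration, so it will cancel against the partition
  function.\<close>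

lemma prod_children:
  assumes a: "\<And>c. lev c = Suc n \<Longrightarrow> \<bar>a c\<bar> \<le> 1"
  shows "\<exists>D>0. \<forall>\<omega>\<in>configs (ball n). (\<Prod>c\<in>level (Suc n). 1 + \<omega> (par c) * (\<theta> * a c)) =
    D * (\<Prod>v\<in>level n. 1 + \<omega> v * comb (ch v) (\<lambda>c. \<theta> * a c))"
proof -
  define D where "D v = ((\<Prod>c\<in>ch v. 1 + \<theta> * a c) + (\<Prod>c\<in>ch v. 1 - \<theta> * a c)) / 2" for v
  have a1: "\<bar>\<theta> * a c\<bar> < 1" if "c \<in> ch v" "lev v = n" for c v
  proof -
    have "\<bar>a c\<bar> \<le> 1" using a chD[OF that(1)] that(2) by simp
    then have "\<theta> * \<bar>a c\<bar> \<le> \<theta> * 1" using \<theta> by (intro mult_left_mono) auto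
    then show ?thesis using \<theta> by (simp add: abs_mult)
  qed
  have D: "D v > 0" if "lev v = n" for v
    using comb_prods_pos[of "ch v" "\<lambda>c. \<theta> * a c"] a1[OF _ that] by (simp add: D_def)
  have "(\<Prod>c\<in>level (Suc n). 1 + \<omega> (par c) * (\<theta> * a c)) =
    (\<Prod>v\<in>level n. D v) * (\<Prod>v\<in>level n. 1 + \<omega> v * comb (ch v) (\<lambda>c. \<theta> * a c))"
    if w: "\<omega> \<in> configs (ball n)" for \<omega>
  proof -
    have "(\<Prod>c\<in>ch v. 1 + \<omega> (par c) * (\<theta> * a c)) = D v * (1 + \<omega> v * comb (ch v) (\<lambda>c. \<theta> * a c))"
      if v: "lev v = n" for v
    proof -
      have "v \<in> ball n" using v by (simp add: ball_def)
      then have "(\<Prod>c\<in>ch v. 1 + \<omega> v * (\<theta> * a c)) = D v * (1 + \<omega> v * comb (ch v) (\<lambda>c. \<theta> * a c))"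
        unfolding D_def by (intro prod_eq_comb a1[OF _ v] configs_values[OF w])
      moreover have "(\<Prod>c\<in>ch v. 1 + \<omega> (par c) * (\<theta> * a c)) = (\<Prod>c\<in>ch v. 1 + \<omega> v * (\<theta> * a c))"
        by (intro prod.cong refl) (simp add: ch_iff)
      ultimately show ?thesis by simp
    qed
    then show ?thesis unfolding prod_level_Suc by (simp add: prod.distrib[symmetric])
  qed
  moreover have "(\<Prod>v\<in>level n. D v) > 0" by (rule prod_pos) (simp add: D)
  ultimately show ?thesis by blast
qed

text \<open>Summing over one spin of the outer level, the average of
  \<open>(1 + \<theta> * x * w) * (1 + x * a)\<close> over the signs \<open>x\<close> is
  \<open>1 + \<theta> * w * a\<close> for a parent spin \<open>w\<close>. One constant
  \<open>D\<close> serves all \<open>G\<close>, so numerators and partition functions can be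
  compared.\<close>

lemma sum_out_level:
  assumes a: "\<And>c. lev c = Suc n \<Longrightarrow> \<bar>a c\<bar> \<le> 1"
  shows "\<exists>D>0. \<forall>G. (\<Sum>\<tau>\<in>configs (ball (Suc n)). G (restrict \<tau> (ball n)) * W (Suc n) \<tau> * (\<Prod>c\<in>level (Suc n). 1 + \<tau> c * a c)) =
    D * (\<Sum>\<omega>\<in>configs (ball n). G \<omega> * W n \<omega> * (\<Prod>v\<in>level n. 1 + \<omega> v * comb (ch v) (\<lambda>c. \<theta> * a c)))"
proof -
  let ?L = "level (Suc n)"
  obtain D where D: "D > 0" "\<And>\<omega>. \<omega> \<in> configs (ball n) \<Longrightarrow> (\<Prod>c\<in>?L. 1 + \<omega> (par c) * (\<theta> * a c)) =
      D * (\<Prod>v\<in>level n. 1 + \<omega> v * comb (ch v) (\<lambda>c. \<theta> * a c))"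
    using prod_children[of n a, OF a] by blast
  have LB: "?L \<subseteq> ball (Suc n)" and BL: "ball (Suc n) - ?L = ball n"
    by (auto simp: ball_def)
  have "(\<Sum>\<tau>\<in>configs (ball (Suc n)). G (restrict \<tau> (ball n)) * W (Suc n) \<tau> * (\<Prod>c\<in>?L. 1 + \<tau> c * a c)) =
    D * (\<Sum>\<omega>\<in>configs (ball n). G \<omega> * W n \<omega> * (\<Prod>v\<in>level n. 1 + \<omega> v * comb (ch v) (\<lambda>c. \<theta> * a c)))" for G
    unfolding sum_configs_split[OF LB] BL sum_distrib_left
  proof (rule sum.cong[OF refl])
    fix \<omega> assume w: "\<omega> \<in> configs (ball n)"
    have nL: "v \<notin> ?L" if "v \<in> ball n" for v using that by (simp add: ball_def)
    have wv: "\<omega> v = -1 \<or> \<omega> v = 1" if "v \<in> ball n" for v by (rule configs_values[OF w that])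
    have pB: "par c \<in> ball n" "c \<noteq> r" if "c \<in> ?L" for c
    proof -
      show "c \<noteq> r" using that by auto
      from par(2)[OF this] show "par c \<in> ball n" using that by (simp add: ball_def)
    qed
    have factor: "G (restrict (merge_at ?L t \<omega>) (ball n)) * W (Suc n) (merge_at ?L t \<omega>) * (\<Prod>c\<in>?L. 1 + merge_at ?L t \<omega> c * a c) =
        G \<omega> * W n \<omega> * (\<Prod>c\<in>?L. (1 + \<theta> * (t c * \<omega> (par c))) / 2 * (1 + t c * a c))" for t
    proof -
      have "restrict (merge_at ?L t \<omega>) (ball n) = \<omega>"
        using w nL by (auto simp: merge_at_def configs_def PiE_iff extensional_def restrict_def fun_eq_iff)
      moreover have "W (Suc n) (merge_at ?L t \<omega>) = W n \<omega> * (\<Prod>c\<in>?L. (1 + \<theta> * (t c * \<omega> (par c))) / 2)"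
      proof -
        have "W (Suc n) (merge_at ?L t \<omega>) =
            (\<Prod>v\<in>ball n. weight v (inc (merge_at ?L t \<omega>) v)) * (\<Prod>c\<in>?L. weight c (inc (merge_at ?L t \<omega>) c))"
          unfolding ball_Suc using nL by (intro prod.union_disjoint) auto
        also have "(\<Prod>v\<in>ball n. weight v (inc (merge_at ?L t \<omega>) v)) = W n \<omega>"
          using nL par_ball by (intro prod.cong refl) (simp add: inc_def merge_at_def)
        also have "(\<Prod>c\<in>?L. weight c (inc (merge_at ?L t \<omega>) c)) = (\<Prod>c\<in>?L. (1 + \<theta> * (t c * \<omega> (par c))) / 2)"
        proof (rule prod.cong[OF refl])
          fix c assume c: "c \<in> ?L"
          show "weight c (inc (merge_at ?L t \<omega>) c) = (1 + \<theta> * (t c * \<omega> (par c))) / 2"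
            using pB(2)[OF c] nL[OF pB(1)[OF c]] c by (simp add: weight_def inc_def merge_at_def)
        qed
        finally show ?thesis .
      qed
      moreover have "(\<Prod>c\<in>?L. 1 + merge_at ?L t \<omega> c * a c) = (\<Prod>c\<in>?L. 1 + t c * a c)"
        by (intro prod.cong refl) (simp add: merge_at_def)
      ultimately show ?thesis by (simp only: prod.distrib mult.assoc)
    qed
    have "(\<Sum>t\<in>configs ?L. G (restrict (merge_at ?L t \<omega>) (ball n)) * W (Suc n) (merge_at ?L t \<omega>) * (\<Prod>c\<in>?L. 1 + merge_at ?L t \<omega> c * a c)) =
        G \<omega> * W n \<omega> * (\<Sum>t\<in>configs ?L. \<Prod>c\<in>?L. (1 + \<theta> * (t c * \<omega> (par c))) / 2 * (1 + t c * a c))"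
      unfolding factor sum_distrib_left ..
    also have "(\<Sum>t\<in>configs ?L. \<Prod>c\<in>?L. (1 + \<theta> * (t c * \<omega> (par c))) / 2 * (1 + t c * a c)) =
        (\<Prod>c\<in>?L. \<Sum>x\<in>{-1, 1}. (1 + \<theta> * (x * \<omega> (par c))) / 2 * (1 + x * a c))"
      unfolding configs_def by (rule prod_sum_PiE[symmetric]) simp_all
    also have "\<dots> = (\<Prod>c\<in>?L. 1 + \<omega> (par c) * (\<theta> * a c))"
      by (intro prod.cong refl) (simp add: field_simps)
    also have "\<dots> = D * (\<Prod>v\<in>level n. 1 + \<omega> v * comb (ch v) (\<lambda>c. \<theta> * a c))"
      by (rule D(2)[OF w])
    also have "G \<omega> * W n \<omega> * (D * (\<Prod>v\<in>level n. 1 + \<omega> v * comb (ch v) (\<lambda>c. \<theta> * a c))) =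
        D * (G \<omega> * W n \<omega> * (\<Prod>v\<in>level n. 1 + \<omega> v * comb (ch v) (\<lambda>c. \<theta> * a c)))"
      by (simp only: mult_ac)
    finally show "(\<Sum>t\<in>configs ?L. G (restrict (merge_at ?L t \<omega>) (ball n)) * W (Suc n) (merge_at ?L t \<omega>) * (\<Prod>c\<in>?L. 1 + merge_at ?L t \<omega> c * a c)) =
        D * (G \<omega> * W n \<omega> * (\<Prod>v\<in>level n. 1 + \<omega> v * comb (ch v) (\<lambda>c. \<theta> * a c)))" .
  qed
  then show ?thesis using D(1) by blast
qed

text \<open>The index \<open>j\<close> is general because every level removed advances
  \<open>mag\<close> by one.\<close>

lemma sum_out_levels:
  assumes \<eta>: "\<eta> \<in> space spin_space"
  shows "\<exists>D>0. \<forall>G. (\<Sum>\<tau>\<in>configs (ball (n + k)). G (restrict \<tau> (ball n)) * W (n + k) \<tau> * (\<Prod>c\<in>level (n + k). 1 + \<tau> c * mag j c \<eta>)) =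
    D * (\<Sum>\<omega>\<in>configs (ball n). G \<omega> * W n \<omega> * (\<Prod>v\<in>level n. 1 + \<omega> v * mag (j + k) v \<eta>))"
proof (induction k arbitrary: j)
  case 0
  show ?case by (rule exI[of _ 1]) (auto simp: restrict_configs_eq intro!: sum.cong)
next
  case (Suc k)
  obtain D1 where D1: "D1 > 0" "\<And>G. (\<Sum>\<tau>\<in>configs (ball (Suc (n + k))). G (restrict \<tau> (ball (n + k))) * W (Suc (n + k)) \<tau> * (\<Prod>c\<in>level (Suc (n + k)). 1 + \<tau> c * mag j c \<eta>)) =
    D1 * (\<Sum>\<omega>\<in>configs (ball (n + k)). G \<omega> * W (n + k) \<omega> * (\<Prod>v\<in>level (n + k). 1 + \<omega> v * mag (Suc j) v \<eta>))"
    using sum_out_level[of "n + k" "\<lambda>c. mag j c \<eta>"] mag_abs[OF \<eta>] unfolding mag.simps by blast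
  obtain D2 where D2: "D2 > 0" "\<And>G. (\<Sum>\<tau>\<in>configs (ball (n + k)). G (restrict \<tau> (ball n)) * W (n + k) \<tau> * (\<Prod>c\<in>level (n + k). 1 + \<tau> c * mag (Suc j) c \<eta>)) =
    D2 * (\<Sum>\<omega>\<in>configs (ball n). G \<omega> * W n \<omega> * (\<Prod>v\<in>level n. 1 + \<omega> v * mag (Suc j + k) v \<eta>))"
    using Suc.IH by blast
  have int: "ball (n + k) \<inter> ball n = ball n" by (auto simp: ball_def)
  have idx: "n + Suc k = Suc (n + k)" "j + Suc k = Suc j + k" by simp_all
  show ?case
  proof (intro exI[of _ "D1 * D2"] conjI allI)
    show "0 < D1 * D2" using D1(1) D2(1) by simp
    fix G
    have "restrict (restrict \<tau> (ball (n + k))) (ball n) = restrict \<tau> (ball n)" for \<tau> :: "'v \<Rightarrow> real"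
      using int by simp
    then show "(\<Sum>\<tau>\<in>configs (ball (n + Suc k)). G (restrict \<tau> (ball n)) * W (n + Suc k) \<tau> * (\<Prod>c\<in>level (n + Suc k). 1 + \<tau> c * mag j c \<eta>)) =
      D1 * D2 * (\<Sum>\<omega>\<in>configs (ball n). G \<omega> * W n \<omega> * (\<Prod>v\<in>level n. 1 + \<omega> v * mag (j + Suc k) v \<eta>))"
      using D1(2)[of "\<lambda>\<tau>. G (restrict \<tau> (ball n))"] unfolding idx D2(2) by (simp only: mult.assoc)
  qed
qed

lemma boundary_sum_ball:
  "boundary_sum adj (ball n) \<eta> \<tau> = (\<Sum>c\<in>level (Suc n). \<tau> (par c) * \<eta> c)"
proof -
  have E: "{(u, v). u \<in> ball n \<and> v \<notin> ball n \<and> adj u v} = (\<lambda>c. (par c, c)) ` level (Suc n)"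
  proof (intro equalityI subsetI)
    fix e assume "e \<in> {(u, v). u \<in> ball n \<and> v \<notin> ball n \<and> adj u v}"
    then obtain u v where uv: "e = (u, v)" "lev u \<le> n" "\<not> lev v \<le> n" "adj u v"
      by (auto simp: ball_def)
    have "v \<noteq> r \<and> u = par v" using par_unique[OF sym[OF uv(4)]] uv by simp
    moreover have "lev v = Suc n" using lev_step[OF uv(4)] uv by simp
    ultimately show "e \<in> (\<lambda>c. (par c, c)) ` level (Suc n)" using uv(1) by blast
  next
    fix e assume "e \<in> (\<lambda>c. (par c, c)) ` level (Suc n)"
    then obtain c where c: "e = (par c, c)" "lev c = Suc n" by blast
    then have "c \<noteq> r" by auto
    from par[OF this] c show "e \<in> {(u, v). u \<in> ball n \<and> v \<notin> ball n \<and> adj u v}"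
      using sym[of c "par c"] by (simp add: ball_def)
  qed
  have "inj_on (\<lambda>c. (par c, c)) (level (Suc n))" by (rule inj_onI) simp
  then show ?thesis unfolding boundary_sum_def E by (simp add: sum.reindex)
qed

text \<open>A boundary edge contributes \<open>cosh \<beta> * (1 + \<theta> * x)\<close> in its spin
  product \<open>x\<close>, so the boundary spins act as the magnetizations \<open>mag 0\<close> of
  one further level, which \<open>prod_children\<close> absorbs.\<close>

lemma exp_energy_ball:
  assumes \<eta>: "\<eta> \<in> space spin_space"
  shows "\<exists>C>0. \<forall>\<tau>\<in>configs (ball n). exp (energy adj \<beta> (ball n) \<eta> \<tau>) =
    C * (W n \<tau> * (\<Prod>v\<in>level n. 1 + \<tau> v * mag 1 v \<eta>))"
proof -
  obtain D where D: "D > 0" "\<And>\<omega>. \<omega> \<in> configs (ball n) \<Longrightarrow> (\<Prod>c\<in>level (Suc n). 1 + \<omega> (par c) * (\<theta> * mag 0 c \<eta>)) =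
      D * (\<Prod>v\<in>level n. 1 + \<omega> v * mag 1 v \<eta>)"
    using prod_children[of n "\<lambda>c. mag 0 c \<eta>"] mag_abs[OF \<eta>, of 0] by (auto simp del: mag.simps(1) simp: One_nat_def)
  define C where "C = 2 * (2 * cosh \<beta>) ^ card (ball n - {r}) * (cosh \<beta> ^ card (level (Suc n)) * D)"
  have "exp (energy adj \<beta> (ball n) \<eta> \<tau>) = C * (W n \<tau> * (\<Prod>v\<in>level n. 1 + \<tau> v * mag 1 v \<eta>))"
    if t: "\<tau> \<in> configs (ball n)" for \<tau>
  proof -
    have sgn: "\<tau> (par c) * \<eta> c = -1 \<or> \<tau> (par c) * \<eta> c = 1" if "lev c = Suc n" for c
    proof -
      have "c \<noteq> r" using that by auto
      from par(2)[OF this] have "par c \<in> ball n" using that by (simp add: ball_def)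
      then show ?thesis using configs_values[OF t] spin_values[OF \<eta>, of c] by fastforce
    qed
    have "exp (\<beta> * boundary_sum adj (ball n) \<eta> \<tau>) = (\<Prod>c\<in>level (Suc n). exp (\<beta> * (\<tau> (par c) * \<eta> c)))"
      unfolding boundary_sum_ball sum_distrib_left by (simp add: exp_sum)
    also have "\<dots> = (\<Prod>c\<in>level (Suc n). cosh \<beta> * (1 + \<tau> (par c) * (\<theta> * mag 0 c \<eta>)))"
      using sgn by (intro prod.cong refl) (simp add: exp_spin mult_ac)
    also have "\<dots> = cosh \<beta> ^ card (level (Suc n)) * (D * (\<Prod>v\<in>level n. 1 + \<tau> v * mag 1 v \<eta>))"
      unfolding prod.distrib prod_constant D(2)[OF t] ..
    finally show ?thesis
      unfolding energy_def exp_add exp_interior_sum_ball[OF t] C_def by (simp only: mult_ac)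
  qed
  moreover have "C > 0" using D(1) by (simp add: C_def)
  ultimately show ?thesis by blast
qed

text \<open>Summing out \<open>k\<close> levels turns the boundary condition into a tilt of the free
  weights on the inner ball. The index is \<open>Suc k\<close> because the boundary spins sit at
  level \<open>n + k + 1\<close>.\<close>

lemma kernel_ball_marginal:
  fixes n k :: nat
  assumes \<eta>: "\<eta> \<in> space spin_space" and s: "s \<in> configs (ball n)"
  defines "Q \<equiv> \<lambda>s. W n s * (\<Prod>v\<in>level n. 1 + s v * mag (Suc k) v \<eta>)"
  shows "(\<Sum>\<tau>\<in>{\<tau>\<in>configs (ball (n + k)). restrict \<tau> (ball n) = s}. kernel adj \<beta> (ball (n + k)) \<eta> \<tau>) =
    Q s / (\<Sum>s'\<in>configs (ball n). Q s')"
proof -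
  obtain C where C: "C > 0" "\<And>\<tau>. \<tau> \<in> configs (ball (n + k)) \<Longrightarrow> exp (energy adj \<beta> (ball (n + k)) \<eta> \<tau>) =
      C * (W (n + k) \<tau> * (\<Prod>v\<in>level (n + k). 1 + \<tau> v * mag 1 v \<eta>))"
    using exp_energy_ball[OF \<eta>] by blast
  obtain D where D: "D > 0" "\<And>G. (\<Sum>\<tau>\<in>configs (ball (n + k)). G (restrict \<tau> (ball n)) * W (n + k) \<tau> * (\<Prod>c\<in>level (n + k). 1 + \<tau> c * mag 1 c \<eta>)) =
    D * (\<Sum>\<omega>\<in>configs (ball n). G \<omega> * W n \<omega> * (\<Prod>v\<in>level n. 1 + \<omega> v * mag (1 + k) v \<eta>))"
    using sum_out_levels[OF \<eta>] by blast
  have S: "(\<Sum>\<tau>\<in>configs (ball (n + k)). G (restrict \<tau> (ball n)) * exp (energy adj \<beta> (ball (n + k)) \<eta> \<tau>)) =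
      C * D * (\<Sum>\<omega>\<in>configs (ball n). G \<omega> * Q \<omega>)" for G
  proof -
    have "(\<Sum>\<tau>\<in>configs (ball (n + k)). G (restrict \<tau> (ball n)) * exp (energy adj \<beta> (ball (n + k)) \<eta> \<tau>)) =
        C * (\<Sum>\<tau>\<in>configs (ball (n + k)). G (restrict \<tau> (ball n)) * W (n + k) \<tau> * (\<Prod>c\<in>level (n + k). 1 + \<tau> c * mag 1 c \<eta>))"
      unfolding sum_distrib_left by (intro sum.cong refl) (simp only: C(2) mult_ac)
    also have "\<dots> = C * D * (\<Sum>\<omega>\<in>configs (ball n). G \<omega> * Q \<omega>)"
      unfolding D(2) Q_def by (simp add: mult.assoc)
    finally show ?thesis .
  qed
  \<comment> \<open>The constant test function yields the partition function and the indicator of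
    \<open>s\<close> the numerator, with the same factor \<open>C * D\<close>.\<close>
  have Z: "(\<Sum>\<tau>\<in>configs (ball (n + k)). exp (energy adj \<beta> (ball (n + k)) \<eta> \<tau>)) = C * D * (\<Sum>\<omega>\<in>configs (ball n). Q \<omega>)"
    using S[of "\<lambda>_. 1"] by simp
  have "(\<Sum>\<tau>\<in>{\<tau>\<in>configs (ball (n + k)). restrict \<tau> (ball n) = s}. exp (energy adj \<beta> (ball (n + k)) \<eta> \<tau>)) =
      (\<Sum>\<tau>\<in>configs (ball (n + k)). (if restrict \<tau> (ball n) = s then 1 else 0) * exp (energy adj \<beta> (ball (n + k)) \<eta> \<tau>))"
    by (rule sum.mono_neutral_cong_left) auto
  also have "\<dots> = C * D * (\<Sum>\<omega>\<in>configs (ball n). (if \<omega> = s then 1 else 0) * Q \<omega>)"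
    by (rule S)
  also have "(\<Sum>\<omega>\<in>configs (ball n). (if \<omega> = s then 1 else 0) * Q \<omega>) = (\<Sum>\<omega>\<in>configs (ball n). if \<omega> = s then Q \<omega> else 0)"
    by (intro sum.cong refl) simp
  also have "\<dots> = Q s" using s by simp
  finally have num: "(\<Sum>\<tau>\<in>{\<tau>\<in>configs (ball (n + k)). restrict \<tau> (ball n) = s}. exp (energy adj \<beta> (ball (n + k)) \<eta> \<tau>)) = C * D * Q s" .
  show ?thesis
    unfolding kernel_def sum_divide_distrib[symmetric] Z num using C(1) D(1) by simp
qed

text \<open>With all magnetizations at most \<epsilon>, every tilt lies between the powers of
  \<open>1 - \<epsilon>\<close> and \<open>1 + \<epsilon>\<close>; the free weights sum to 1, so the
  normalization is at least the lower one.\<close>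

lemma kernel_ball_marginal_le:
  assumes \<eta>: "\<eta> \<in> space spin_space" and s: "s \<in> configs (ball n)" and e: "0 < \<epsilon>" "\<epsilon> < 1"
    and small: "\<And>v. lev v = n \<Longrightarrow> \<bar>mag (Suc k) v \<eta>\<bar> \<le> \<epsilon>"
  shows "(\<Sum>\<tau>\<in>{\<tau>\<in>configs (ball (n + k)). restrict \<tau> (ball n) = s}. kernel adj \<beta> (ball (n + k)) \<eta> \<tau>) \<le>
    W n s * ((1 + \<epsilon>) / (1 - \<epsilon>)) ^ card (level n)"
proof -
  let ?K = "card (level n)"
  define Q where "Q s = W n s * (\<Prod>v\<in>level n. 1 + s v * mag (Suc k) v \<eta>)" for s
  have W0: "W n t \<ge> 0" if "t \<in> configs (ball n)" for t
    unfolding free_kernel_ball[OF that, symmetric] by (simp add: sum_nonneg)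
  have bnd: "1 - \<epsilon> \<le> 1 + t v * mag (Suc k) v \<eta> \<and> 1 + t v * mag (Suc k) v \<eta> \<le> 1 + \<epsilon>"
    if "t \<in> configs (ball n)" "lev v = n" for t v
    using configs_values[OF that(1), of v] small[OF that(2)] that(2) by (auto simp: ball_def abs_le_iff)
  have up: "Q t \<le> W n t * (1 + \<epsilon>) ^ ?K" if t: "t \<in> configs (ball n)" for t
  proof -
    have "(\<Prod>v\<in>level n. 1 + t v * mag (Suc k) v \<eta>) \<le> (\<Prod>v\<in>level n. 1 + \<epsilon>)"
      using bnd[OF t] e by (intro prod_mono) (auto intro: order_trans[of 0 "1 - \<epsilon>"])
    then show ?thesis unfolding Q_def prod_constant by (rule mult_left_mono[OF _ W0[OF t]])
  qed
  have low: "W n t * (1 - \<epsilon>) ^ ?K \<le> Q t" if t: "t \<in> configs (ball n)" for t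
  proof -
    have "(\<Prod>v\<in>level n. 1 - \<epsilon>) \<le> (\<Prod>v\<in>level n. 1 + t v * mag (Suc k) v \<eta>)"
      using bnd[OF t] e by (intro prod_mono) auto
    then show ?thesis unfolding Q_def prod_constant by (rule mult_left_mono[OF _ W0[OF t]])
  qed
  have "(1 - \<epsilon>) ^ ?K = (\<Sum>t\<in>configs (ball n). W n t * (1 - \<epsilon>) ^ ?K)"
    by (simp add: sum_distrib_right[symmetric] sum_weight_inc)
  also have "\<dots> \<le> (\<Sum>t\<in>configs (ball n). Q t)" by (rule sum_mono) (rule low)
  finally have Z: "(1 - \<epsilon>) ^ ?K \<le> (\<Sum>t\<in>configs (ball n). Q t)" .
  have "Q s / (\<Sum>t\<in>configs (ball n). Q t) \<le> (W n s * (1 + \<epsilon>) ^ ?K) / (1 - \<epsilon>) ^ ?K"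
    by (rule frac_le[OF _ up[OF s] _ Z]) (use W0[OF s] e in simp_all)
  also have "\<dots> = W n s * ((1 + \<epsilon>) / (1 - \<epsilon>)) ^ ?K" by (simp add: power_divide)
  finally show ?thesis
    unfolding kernel_ball_marginal[OF \<eta> s] Q_def .
qed

end

section \<open>From small magnetizations to extremality\<close>

context free_ising_tree
begin

lemma measure_mag_large:
  assumes "v \<noteq> r" "0 < \<epsilon>"
  shows "measure \<mu> {\<eta>\<in>space spin_space. \<epsilon> \<le> \<bar>mag k v \<eta>\<bar>} \<le> env k / \<epsilon>\<^sup>2"
proof -
  let ?A = "{\<xi>\<in>space spin_space. \<epsilon> \<le> \<bar>R k v \<xi>\<bar>}"
  have A: "?A \<in> sets spin_space" by measurable
  have "{\<eta>\<in>space spin_space. \<epsilon> \<le> \<bar>mag k v \<eta>\<bar>} = {\<sigma>\<in>space spin_space. inc \<sigma> \<in> ?A}"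
    by (rule Collect_cong) (auto simp: mag_abs_eq inc_space)
  then show ?thesis
    using measure_inc[OF A] measure_R_large[OF assms] by simp
qed

text \<open>Smallness of the magnetizations is known only under \<mu>; domination transfers it to
  \<nu> at the price of a factor \<open>1 / t\<close>. Off the bad event the conditional marginals
  of \<nu> are nearly free. First \<open>k\<close> tends to infinity with \<epsilon> fixed, then
  \<epsilon> to 0.\<close>

lemma dominated_gibbs_cyl_le:
  assumes g: "gibbs_measure adj \<beta> \<nu>" and crit: "d * \<theta>\<^sup>2 \<le> 1" and t: "0 < t"
    and dom: "\<And>A. A \<in> sets spin_space \<Longrightarrow> t * measure \<nu> A \<le> measure \<mu> A"
    and n: "1 \<le> n" and s: "s \<in> configs (ball n)"
  shows "measure \<nu> (cyl (ball n) s) \<le> measure \<mu> (cyl (ball n) s)"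
proof -
  have S: "sets \<nu> = sets spin_space" and sp: "space \<nu> = space spin_space" and "prob_space \<nu>"
    by (rule gibbs_measureD[OF g])+
  interpret \<nu>: prob_space \<nu> by fact
  let ?L = "level n"
  define K where "K = card ?L"
  have W: "measure \<mu> (cyl (ball n) s) = W n s" and W0: "0 \<le> W n s"
  proof -
    show "0 \<le> W n s"
      unfolding free_kernel_ball[OF s, symmetric] by (simp add: sum_nonneg)
    then show "measure \<mu> (cyl (ball n) s) = W n s"
      using emeasure_\<mu>_cyl_ball[OF s] by (simp add: measure_def)
  qed
  have bound: "measure \<nu> (cyl (ball n) s) \<le> W n s * ((1 + \<epsilon>) / (1 - \<epsilon>)) ^ K + K * env (Suc k) / \<epsilon>\<^sup>2 / t"
    if e: "0 < \<epsilon>" "\<epsilon> < 1" for \<epsilon> k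
  proof -
    define big where "big v = {\<eta>\<in>space spin_space. \<epsilon> \<le> \<bar>mag (Suc k) v \<eta>\<bar>}" for v
    have big: "big v \<in> sets spin_space" for v unfolding big_def by measurable
    let ?bad = "\<Union>v\<in>?L. big v"
    have bad: "?bad \<in> sets spin_space" by (intro sets.finite_UN finite_level big)
    let ?T = "{\<tau>\<in>configs (ball (n + k)). restrict \<tau> (ball n) = s}"
    define c where "c = W n s * ((1 + \<epsilon>) / (1 - \<epsilon>)) ^ K"
    have c0: "0 \<le> c" unfolding c_def using W0 e by simp
    have BB: "ball (n + k) \<inter> ball n = ball n" by (auto simp: ball_def)
    have "emeasure \<nu> (cyl (ball n) s) = emeasure \<nu> {\<sigma>\<in>space spin_space. restrict \<sigma> (ball n) = s}"
      by (simp add: cyl_def)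
    also have "\<dots> = (\<Sum>\<tau>\<in>?T. emeasure \<nu> (cyl (ball (n + k)) \<tau>))"
      by (rule emeasure_local(1)[OF S finite_ball]) (simp only: restrict_restrict BB)
    also have "\<dots> = (\<Sum>\<tau>\<in>?T. \<integral>\<^sup>+\<eta>. ennreal (kernel adj \<beta> (ball (n + k)) \<eta> \<tau>) \<partial>\<nu>)"
      using g[unfolded gibbs_measure_iff, THEN conjunct2, THEN conjunct2, rule_format, OF finite_ball]
      by (intro sum.cong refl) blast
    also have "\<dots> = (\<integral>\<^sup>+\<eta>. (\<Sum>\<tau>\<in>?T. ennreal (kernel adj \<beta> (ball (n + k)) \<eta> \<tau>)) \<partial>\<nu>)"
      by (intro nn_integral_sum[symmetric]) (simp only: measurable_cong_sets[OF S refl] kernel_measurable[OF finite_ball])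
    also have "\<dots> \<le> (\<integral>\<^sup>+\<eta>. ennreal c + indicator ?bad \<eta> \<partial>\<nu>)"
    proof (rule nn_integral_mono)
      fix \<eta> assume "\<eta> \<in> space \<nu>"
      then have h: "\<eta> \<in> space spin_space" by (simp add: sp)
      have eq: "(\<Sum>\<tau>\<in>?T. ennreal (kernel adj \<beta> (ball (n + k)) \<eta> \<tau>)) =
          ennreal (\<Sum>\<tau>\<in>?T. kernel adj \<beta> (ball (n + k)) \<eta> \<tau>)"
        by (rule sum_ennreal) (rule kernel_nonneg)
      show "(\<Sum>\<tau>\<in>?T. ennreal (kernel adj \<beta> (ball (n + k)) \<eta> \<tau>)) \<le> ennreal c + indicator ?bad \<eta>"
      proof (cases "\<eta> \<in> ?bad")
        case True
        have "(\<Sum>\<tau>\<in>?T. kernel adj \<beta> (ball (n + k)) \<eta> \<tau>) \<le> (\<Sum>\<tau>\<in>configs (ball (n + k)). kernel adj \<beta> (ball (n + k)) \<eta> \<tau>)"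
          by (rule sum_mono2) (auto simp: kernel_nonneg)
        then have "(\<Sum>\<tau>\<in>?T. kernel adj \<beta> (ball (n + k)) \<eta> \<tau>) \<le> 1"
          unfolding kernel_sum[OF finite_ball] .
        then have "(\<Sum>\<tau>\<in>?T. ennreal (kernel adj \<beta> (ball (n + k)) \<eta> \<tau>)) \<le> 1"
          unfolding eq by simp
        also have "1 \<le> ennreal c + indicator ?bad \<eta>"
          using True by (simp add: indicator_def)
        finally show ?thesis .
      next
        case False
        have small: "\<bar>mag (Suc k) v \<eta>\<bar> \<le> \<epsilon>" if "lev v = n" for v
        proof (rule ccontr)
          assume "\<not> \<bar>mag (Suc k) v \<eta>\<bar> \<le> \<epsilon>"
          then have "\<eta> \<in> big v" unfolding big_def using h by simp
          with False that show False by blast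
        qed
        have "(\<Sum>\<tau>\<in>?T. ennreal (kernel adj \<beta> (ball (n + k)) \<eta> \<tau>)) \<le> ennreal c"
          unfolding eq c_def K_def by (rule ennreal_leI[OF kernel_ball_marginal_le[OF h s e small]])
        then show ?thesis by (rule order_trans) simp
      qed
    qed
    also have "\<dots> = ennreal c + emeasure \<nu> ?bad"
    proof (subst nn_integral_add)
      show "indicator ?bad \<in> borel_measurable \<nu>" by (rule borel_measurable_indicator) (simp only: S bad)
    qed (simp_all only: borel_measurable_const nn_integral_indicator S bad nn_integral_const \<nu>.emeasure_space_1 mult_1_right)
    finally have "measure \<nu> (cyl (ball n) s) \<le> c + measure \<nu> ?bad"
      using c0 by (simp add: \<nu>.emeasure_eq_measure ennreal_plus[symmetric] del: ennreal_plus)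
    moreover have "t * measure \<nu> ?bad \<le> K * (env (Suc k) / \<epsilon>\<^sup>2)"
    proof -
      have "t * measure \<nu> ?bad \<le> measure \<mu> ?bad" by (rule dom[OF bad])
      also have "\<dots> \<le> (\<Sum>v\<in>?L. measure \<mu> (big v))"
        by (rule \<mu>.finite_measure_subadditive_finite) (use big in \<open>auto simp: sets_\<mu>\<close>)
      also have "\<dots> \<le> (\<Sum>v\<in>?L. env (Suc k) / \<epsilon>\<^sup>2)"
        unfolding big_def using n e by (intro sum_mono measure_mag_large) auto
      also have "\<dots> = K * (env (Suc k) / \<epsilon>\<^sup>2)" by (simp only: sum_constant K_def)
      finally show ?thesis .
    qed
    then have "measure \<nu> ?bad \<le> K * (env (Suc k) / \<epsilon>\<^sup>2) / t"
      by (simp only: pos_le_divide_eq[OF t] mult.commute[of _ t])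
    ultimately show ?thesis by (simp add: c_def)
  qed
  have bound': "measure \<nu> (cyl (ball n) s) \<le> W n s * ((1 + \<epsilon>) / (1 - \<epsilon>)) ^ K"
    if e: "0 < \<epsilon>" "\<epsilon> < 1" for \<epsilon>
  proof (rule LIMSEQ_le_const)
    have "(\<lambda>k. K * env (Suc k) / \<epsilon>\<^sup>2 / t) \<longlonglongrightarrow> real K * 0 / \<epsilon>\<^sup>2 / t"
      by (intro tendsto_divide tendsto_mult tendsto_const LIMSEQ_Suc[OF env_tendsto_0[OF crit]]) (use e t in simp_all)
    then have "(\<lambda>k. W n s * ((1 + \<epsilon>) / (1 - \<epsilon>)) ^ K + K * env (Suc k) / \<epsilon>\<^sup>2 / t) \<longlonglongrightarrow>
        W n s * ((1 + \<epsilon>) / (1 - \<epsilon>)) ^ K + real K * 0 / \<epsilon>\<^sup>2 / t"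
      by (rule tendsto_add[OF tendsto_const])
    then show "(\<lambda>k. W n s * ((1 + \<epsilon>) / (1 - \<epsilon>)) ^ K + K * env (Suc k) / \<epsilon>\<^sup>2 / t) \<longlonglongrightarrow>
        W n s * ((1 + \<epsilon>) / (1 - \<epsilon>)) ^ K" by simp
    show "\<exists>N. \<forall>k\<ge>N. measure \<nu> (cyl (ball n) s) \<le> W n s * ((1 + \<epsilon>) / (1 - \<epsilon>)) ^ K + K * env (Suc k) / \<epsilon>\<^sup>2 / t"
      using bound[OF e] by blast
  qed
  have "measure \<nu> (cyl (ball n) s) \<le> W n s"
  proof (rule LIMSEQ_le_const)
    \<comment> \<open>The double successor keeps every \<open>?e j\<close> strictly below 1.\<close>
    let ?e = "\<lambda>j. inverse (real (Suc (Suc j)))"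
    have "?e \<longlonglongrightarrow> 0" by (rule LIMSEQ_Suc[OF LIMSEQ_inverse_real_of_nat])
    then have "(\<lambda>j. W n s * ((1 + ?e j) / (1 - ?e j)) ^ K) \<longlonglongrightarrow> W n s * ((1 + 0) / (1 - 0)) ^ K"
      by (intro tendsto_intros) auto
    then show "(\<lambda>j. W n s * ((1 + ?e j) / (1 - ?e j)) ^ K) \<longlonglongrightarrow> W n s" by simp
    have "0 < ?e j" "?e j < 1" for j
      by (simp_all add: inverse_less_1_iff)
    then show "\<exists>N. \<forall>j\<ge>N. measure \<nu> (cyl (ball n) s) \<le> W n s * ((1 + ?e j) / (1 - ?e j)) ^ K"
      using bound' by blast
  qed
  then show ?thesis unfolding W .
qed

text \<open>Both components of a decomposition are dominated by multiples of \<mu>, so neither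
  exceeds \<mu> on a cylinder; as \<mu> is a proper average of the two, both must equal it
  there.\<close>

theorem free_state_extremal:
  assumes crit: "d * \<theta>\<^sup>2 \<le> 1"
  shows "extremal_gibbs adj \<beta> \<mu>"
  unfolding extremal_gibbs_def
proof (intro conjI notI free_state_gibbs)
  assume "\<exists>t \<mu>1 \<mu>2. 0 < t \<and> t < 1 \<and> gibbs_measure adj \<beta> \<mu>1 \<and> gibbs_measure adj \<beta> \<mu>2 \<and> \<mu>1 \<noteq> \<mu>2 \<and>
    (\<forall>A\<in>sets spin_space. measure \<mu> A = t * measure \<mu>1 A + (1 - t) * measure \<mu>2 A)"
  then obtain t \<mu>1 \<mu>2 where t: "0 < t" "t < 1" and g: "gibbs_measure adj \<beta> \<mu>1" "gibbs_measure adj \<beta> \<mu>2"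
    and ne: "\<mu>1 \<noteq> \<mu>2"
    and mix: "\<And>A. A \<in> sets spin_space \<Longrightarrow> measure \<mu> A = t * measure \<mu>1 A + (1 - t) * measure \<mu>2 A"
    by blast
  have dom: "t * measure \<mu>1 A \<le> measure \<mu> A" "(1 - t) * measure \<mu>2 A \<le> measure \<mu> A"
    if "A \<in> sets spin_space" for A
    using mix[OF that] t by simp_all
  interpret m1: prob_space \<mu>1 by (rule gibbs_measureD[OF g(1)])
  interpret m2: prob_space \<mu>2 by (rule gibbs_measureD[OF g(2)])
  have "\<mu>1 = \<mu>2"
  proof (rule measure_eqI_cyl)
    show "sets \<mu>1 = sets spin_space" "sets \<mu>2 = sets spin_space" by (rule gibbs_measureD[OF g(1)] gibbs_measureD[OF g(2)])+
    show "finite_measure \<mu>1" by (rule m1.finite_measure_axioms)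
    fix J :: "'v set" assume "finite J"
    then obtain n where n: "1 \<le> n" "J \<subseteq> ball n" using ball_exhausts[of J 1] by blast
    have "emeasure \<mu>1 (cyl (ball n) s) = emeasure \<mu>2 (cyl (ball n) s)" if s: "s \<in> configs (ball n)" for s
    proof -
      let ?C = "cyl (ball n) s"
      have le: "measure \<mu>1 ?C \<le> measure \<mu> ?C" "measure \<mu>2 ?C \<le> measure \<mu> ?C"
        using dominated_gibbs_cyl_le[OF g(1) crit _ dom(1) n(1) s]
          dominated_gibbs_cyl_le[OF g(2) crit _ dom(2) n(1) s] t by simp_all
      have m: "measure \<mu> ?C = t * measure \<mu>1 ?C + (1 - t) * measure \<mu>2 ?C"
        by (rule mix[OF cyl_sets[OF finite_ball s]])
      have "t * (measure \<mu> ?C - measure \<mu>1 ?C) + (1 - t) * (measure \<mu> ?C - measure \<mu>2 ?C) = 0"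
        using m by (simp add: algebra_simps)
      moreover have "0 \<le> t * (measure \<mu> ?C - measure \<mu>1 ?C)" "0 \<le> (1 - t) * (measure \<mu> ?C - measure \<mu>2 ?C)"
        using le t by simp_all
      ultimately have "t * (measure \<mu> ?C - measure \<mu>1 ?C) = 0" "(1 - t) * (measure \<mu> ?C - measure \<mu>2 ?C) = 0"
        by linarith+
      then show ?thesis using t by (simp add: m1.emeasure_eq_measure m2.emeasure_eq_measure)
    qed
    then show "\<exists>K. finite K \<and> J \<subseteq> K \<and> (\<forall>s\<in>configs K. emeasure \<mu>1 (cyl K s) = emeasure \<mu>2 (cyl K s))"
      using n by (intro exI[of _ "ball n"]) simp
  qed
  with ne show False by contradiction
qed

end

section \<open>Tail events above the reconstruction threshold\<close>

text \<open>A form of ``the limit is positive'' that is visibly measurable.\<close>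

definition evpos :: "(nat \<Rightarrow> real) \<Rightarrow> bool" where
  "evpos f \<longleftrightarrow> (\<exists>m N. \<forall>n\<ge>N. 1 / real (Suc m) \<le> f n)"

lemma evpos_limit:
  assumes "f \<longlonglongrightarrow> l" "0 < l"
  shows "evpos f"
proof -
  obtain m where m: "1 / real (Suc m) < l"
    using nat_approx_posE[OF assms(2)] by blast
  then have "eventually (\<lambda>n. 1 / real (Suc m) < f n) sequentially"
    using assms(1) by (rule order_tendstoD(1)[rotated])
  then show ?thesis
    unfolding evpos_def eventually_sequentially using less_imp_le by blast
qed

lemma evpos_mult:
  assumes "evpos f" "evpos g"
  shows "evpos (\<lambda>n. f n * g n)"
proof -
  obtain m N m' N' where f: "\<And>n. n \<ge> N \<Longrightarrow> 1 / real (Suc m) \<le> f n" and g: "\<And>n. n \<ge> N' \<Longrightarrow> 1 / real (Suc m') \<le> g n"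
    using assms unfolding evpos_def by blast
  have "1 / real (Suc (Suc m * Suc m')) \<le> f n * g n" if n: "n \<ge> max N N'" for n
  proof -
    have "1 / real (Suc (Suc m * Suc m')) \<le> 1 / real (Suc m * Suc m')"
      by (intro divide_left_mono) (simp_all del: of_nat_Suc of_nat_mult mult_Suc mult_Suc_right)
    also have "\<dots> = (1 / real (Suc m)) * (1 / real (Suc m'))"
      by (simp only: of_nat_mult times_divide_times_eq mult_1)
    also have "\<dots> \<le> f n * g n"
    proof (rule mult_mono)
      show "1 / real (Suc m) \<le> f n" "1 / real (Suc m') \<le> g n" using n by (intro f g; simp)+
      have "0 \<le> 1 / real (Suc m)" by simp
      then show "0 \<le> f n" using \<open>1 / real (Suc m) \<le> f n\<close> by linarith
    qed simp
    finally show ?thesis .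
  qed
  then show ?thesis unfolding evpos_def by blast
qed

lemma evpos_not_neg: "evpos f \<Longrightarrow> \<not> evpos (\<lambda>n. - f n)"
proof
  assume "evpos f" "evpos (\<lambda>n. - f n)"
  then obtain m N m' N' where f: "\<And>n. n \<ge> N \<Longrightarrow> 1 / real (Suc m) \<le> f n" and g: "\<And>n. n \<ge> N' \<Longrightarrow> 1 / real (Suc m') \<le> - f n"
    unfolding evpos_def by blast
  have "1 / real (Suc m) \<le> f (max N N')" "1 / real (Suc m') \<le> - f (max N N')"
    by (intro f g; simp)+
  moreover have "0 < 1 / real (Suc m)" "0 < 1 / real (Suc m')" by simp_all
  ultimately show False by linarith
qed

lemma evpos_tail:
  assumes "evpos f" "\<And>n. n \<ge> M \<Longrightarrow> f n = g n"
  shows "evpos g"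
proof -
  obtain m N where f: "\<And>n. n \<ge> N \<Longrightarrow> 1 / real (Suc m) \<le> f n"
    using assms(1) unfolding evpos_def by blast
  have "1 / real (Suc m) \<le> g n" if "n \<ge> max N M" for n
    using f[of n] assms(2)[of n] that by simp
  then show ?thesis unfolding evpos_def by blast
qed

lemma evpos_sets:
  assumes "\<And>n. f n \<in> borel_measurable M"
  shows "{x\<in>space M. evpos (\<lambda>n. f n x)} \<in> sets M"
proof -
  note [measurable] = assms
  show ?thesis unfolding evpos_def by measurable
qed

section \<open>Second moments and convergence of the normalized spin sums\<close>

context ising_tree
begin

text \<open>The factor by which second moments shrink per generation: \<open>d\<close> independent
  children, each divided by \<open>(d * \<theta>)^2\<close>. It is below 1 exactly above the
  threshold.\<close>

definition \<rho> :: real where "\<rho> = 1 / (d * \<theta>\<^sup>2)"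

text \<open>In spins, this is \<open>\<sigma> v\<close> times the sum of the spins \<open>n\<close>
  levels below \<open>v\<close>, divided by \<open>(d * \<theta>)^n\<close>. With \<open>d\<close>
  children, each edge having mean \<theta>, the normalization preserves the mean.\<close>

primrec Y :: "nat \<Rightarrow> 'v \<Rightarrow> ('v \<Rightarrow> real) \<Rightarrow> real" where
  "Y 0 = (\<lambda>v \<xi>. 1)"
| "Y (Suc n) = (\<lambda>v \<xi>. (\<Sum>c\<in>ch v. \<xi> c * Y n c \<xi>) / (d * \<theta>))"

definition \<Delta> :: "nat \<Rightarrow> 'v \<Rightarrow> ('v \<Rightarrow> real) \<Rightarrow> real" where
  "\<Delta> n v \<xi> = Y (Suc n) v \<xi> - Y n v \<xi>"

text \<open>The recursion is linear, so increments obey it too; they differ only in starting with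
  mean zero.\<close>

lemma \<Delta>_Suc: "\<Delta> (Suc n) v \<xi> = (\<Sum>c\<in>ch v. \<xi> c * \<Delta> n c \<xi>) / (d * \<theta>)"
  by (simp only: \<Delta>_def Y.simps(2)[of "Suc n"] Y.simps(2)[of n] diff_divide_distrib[symmetric] sum_subtractf[symmetric]
      right_diff_distrib[symmetric])

lemma Y_measurable [measurable]: "Y n v \<in> borel_measurable spin_space"
proof (induction n arbitrary: v)
  case (Suc n)
  show ?case
    unfolding Y.simps
    by (intro borel_measurable_divide borel_measurable_sum borel_measurable_times borel_measurable_const borel_measurable_spin Suc)
qed simp

lemma Y_local: "(\<And>u. u \<in> desc v - {v} \<Longrightarrow> \<xi> u = \<xi>' u) \<Longrightarrow> Y n v \<xi> = Y n v \<xi>'"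
proof (induction n arbitrary: v)
  case (Suc n)
  have "\<xi> c * Y n c \<xi> = \<xi>' c * Y n c \<xi>'" if c: "c \<in> ch v" for c
  proof -
    have "\<xi> c = \<xi>' c" using desc_child[OF c] desc_self[of c] by (intro Suc.prems) blast
    moreover have "Y n c \<xi> = Y n c \<xi>'" using desc_child[OF c] by (intro Suc.IH Suc.prems) blast
    ultimately show ?thesis by simp
  qed
  then have "(\<Sum>c\<in>ch v. \<xi> c * Y n c \<xi>) = (\<Sum>c\<in>ch v. \<xi>' c * Y n c \<xi>')" by (rule sum.cong[OF refl])
  then show ?case by simp
qed simp

definition bounded_local :: "'v \<Rightarrow> (('v \<Rightarrow> real) \<Rightarrow> real) \<Rightarrow> bool" where
  "bounded_local v Z \<longleftrightarrow> Z \<in> borel_measurable spin_space \<and> (\<exists>B. \<forall>\<xi>\<in>space spin_space. \<bar>Z \<xi>\<bar> \<le> B) \<and>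
    (\<forall>\<xi> \<xi>'. (\<forall>u\<in>desc v. \<xi> u = \<xi>' u) \<longrightarrow> Z \<xi> = Z \<xi>')"

lemma bounded_integrable:
  fixes Z :: "('v \<Rightarrow> real) \<Rightarrow> real"
  assumes "Z \<in> borel_measurable spin_space" "\<And>\<xi>. \<xi> \<in> space spin_space \<Longrightarrow> \<bar>Z \<xi>\<bar> \<le> B"
  shows "integrable edge_measure Z"
proof (rule E.integrable_const_bound[where B = B])
  show "Z \<in> borel_measurable edge_measure"
    using assms(1) by (simp only: measurable_cong_sets[OF sets_edge_measure refl])
  show "AE \<xi> in edge_measure. norm (Z \<xi>) \<le> B"
    by (intro AE_I2) (use assms(2) in \<open>simp add: space_edge_measure\<close>)
qed

lemma bounded_square_integrable:
  fixes Z :: "('v \<Rightarrow> real) \<Rightarrow> real"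
  assumes "Z \<in> borel_measurable spin_space" "\<exists>B. \<forall>\<xi>\<in>space spin_space. \<bar>Z \<xi>\<bar> \<le> B"
  shows "integrable edge_measure (\<lambda>\<xi>. (Z \<xi>)\<^sup>2)"
proof -
  obtain B where B: "\<And>\<xi>. \<xi> \<in> space spin_space \<Longrightarrow> \<bar>Z \<xi>\<bar> \<le> B" using assms(2) by blast
  have Z2: "(\<lambda>\<xi>. (Z \<xi>)\<^sup>2) \<in> borel_measurable spin_space" using assms(1) by measurable
  show ?thesis
  proof (rule bounded_integrable[OF Z2, where B = "B\<^sup>2"])
    fix \<xi> :: "'v \<Rightarrow> real" assume "\<xi> \<in> space spin_space"
    from power_mono[OF B[OF this] abs_ge_zero, of 2] show "\<bar>(Z \<xi>)\<^sup>2\<bar> \<le> B\<^sup>2" by simp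
  qed
qed

lemma bounded_local_integrable:
  assumes "bounded_local v Z"
  shows "integrable edge_measure Z" "integrable edge_measure (\<lambda>\<xi>. (Z \<xi>)\<^sup>2)"
proof -
  have Z: "Z \<in> borel_measurable spin_space" and B: "\<exists>B. \<forall>\<xi>\<in>space spin_space. \<bar>Z \<xi>\<bar> \<le> B"
    using assms unfolding bounded_local_def by blast+
  show "integrable edge_measure Z"
    using B bounded_integrable[OF Z] by blast
  show "integrable edge_measure (\<lambda>\<xi>. (Z \<xi>)\<^sup>2)"
    by (rule bounded_square_integrable[OF Z B])
qed

lemma Y_bounded: "\<exists>B. \<forall>\<xi>\<in>space spin_space. \<bar>Y n v \<xi>\<bar> \<le> B"
proof (induction n arbitrary: v)
  case 0
  show ?case by (rule exI[of _ 1]) simp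
next
  case (Suc n)
  then obtain B where B: "\<And>v \<xi>. \<xi> \<in> space spin_space \<Longrightarrow> \<bar>Y n v \<xi>\<bar> \<le> B v" by metis
  have "\<bar>Y (Suc n) v \<xi>\<bar> \<le> (\<Sum>c\<in>ch v. B c) / \<bar>d * \<theta>\<bar>" if x: "\<xi> \<in> space spin_space" for \<xi>
  proof -
    have "\<bar>\<Sum>c\<in>ch v. \<xi> c * Y n c \<xi>\<bar> \<le> (\<Sum>c\<in>ch v. \<bar>\<xi> c * Y n c \<xi>\<bar>)" by (rule sum_abs)
    also have "\<dots> \<le> (\<Sum>c\<in>ch v. B c)"
    proof (rule sum_mono)
      fix c
      have "\<bar>\<xi> c\<bar> = 1" using spin_values[OF x, of c] by auto
      then show "\<bar>\<xi> c * Y n c \<xi>\<bar> \<le> B c" using B[OF x] by (simp add: abs_mult)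
    qed
    finally show ?thesis unfolding Y.simps abs_divide by (rule divide_right_mono) simp
  qed
  then show ?case by blast
qed

lemma bounded_local_edge:
  assumes Z: "Z \<in> borel_measurable spin_space" "\<exists>B. \<forall>\<xi>\<in>space spin_space. \<bar>Z \<xi>\<bar> \<le> B"
    "\<And>\<xi> \<xi>'. (\<And>u. u \<in> desc c - {c} \<Longrightarrow> \<xi> u = \<xi>' u) \<Longrightarrow> Z \<xi> = Z \<xi>'"
  shows "bounded_local c (\<lambda>\<xi>. \<xi> c * Z \<xi>)"
  unfolding bounded_local_def
proof (intro conjI allI impI)
  show "(\<lambda>\<xi>. \<xi> c * Z \<xi>) \<in> borel_measurable spin_space"
    by (intro borel_measurable_times borel_measurable_spin Z)
  obtain B where B: "\<And>\<xi>. \<xi> \<in> space spin_space \<Longrightarrow> \<bar>Z \<xi>\<bar> \<le> B" using Z(2) by blast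
  have "\<bar>\<xi> c * Z \<xi>\<bar> \<le> B" if x: "\<xi> \<in> space spin_space" for \<xi>
  proof -
    have "\<bar>\<xi> c\<bar> = 1" using spin_values[OF x, of c] by auto
    then show ?thesis using B[OF x] by (simp add: abs_mult)
  qed
  then show "\<exists>B. \<forall>\<xi>\<in>space spin_space. \<bar>\<xi> c * Z \<xi>\<bar> \<le> B" by blast
  fix \<xi> \<xi>' :: "'v \<Rightarrow> real" assume *: "\<forall>u\<in>desc c. \<xi> u = \<xi>' u"
  then have "\<xi> c = \<xi>' c" using desc_self[of c] by blast
  moreover have "Z \<xi> = Z \<xi>'" using * by (intro Z(3)) blast
  ultimately show "\<xi> c * Z \<xi> = \<xi>' c * Z \<xi>'" by simp
qed

lemma bounded_local_sum:
  assumes "finite F" "\<And>c. c \<in> F \<Longrightarrow> bounded_local c (Z c)"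
  shows "(\<lambda>\<xi>. \<Sum>c\<in>F. Z c \<xi>) \<in> borel_measurable spin_space"
    "\<exists>B. \<forall>\<xi>\<in>space spin_space. \<bar>\<Sum>c\<in>F. Z c \<xi>\<bar> \<le> B"
proof -
  show "(\<lambda>\<xi>. \<Sum>c\<in>F. Z c \<xi>) \<in> borel_measurable spin_space"
    using assms(2) by (intro borel_measurable_sum) (simp add: bounded_local_def)
  obtain B where B: "\<And>c \<xi>. c \<in> F \<Longrightarrow> \<xi> \<in> space spin_space \<Longrightarrow> \<bar>Z c \<xi>\<bar> \<le> B c"
    using assms(2) unfolding bounded_local_def by metis
  have "\<bar>\<Sum>c\<in>F. Z c \<xi>\<bar> \<le> (\<Sum>c\<in>F. B c)" if "\<xi> \<in> space spin_space" for \<xi>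
    by (rule order_trans[OF sum_abs]) (rule sum_mono, rule B[OF _ that])
  then show "\<exists>B. \<forall>\<xi>\<in>space spin_space. \<bar>\<Sum>c\<in>F. Z c \<xi>\<bar> \<le> B" by blast
qed

text \<open>Additivity of variance over disjoint subtrees, weakened by dropping the squares of the
  individual means.\<close>

lemma second_moment_sum_le:
  assumes "finite F" "F \<subseteq> ch v" and Z: "\<And>c. c \<in> F \<Longrightarrow> bounded_local c (Z c)"
  shows "E.expectation (\<lambda>\<xi>. (\<Sum>c\<in>F. Z c \<xi>)\<^sup>2) \<le>
    (\<Sum>c\<in>F. E.expectation (\<lambda>\<xi>. (Z c \<xi>)\<^sup>2)) + (\<Sum>c\<in>F. E.expectation (Z c))\<^sup>2"
  using assms
proof (induction F rule: finite_induct)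
  case (insert c F)
  let ?S = "\<lambda>\<xi>. \<Sum>c\<in>F. Z c \<xi>"
  have Zc: "bounded_local c (Z c)" and ZF: "\<And>c'. c' \<in> F \<Longrightarrow> bounded_local c' (Z c')"
    using insert.prems by auto
  note S = bounded_local_sum[OF insert.hyps(1) ZF]
  have iS: "integrable edge_measure ?S" using S(2) bounded_integrable[OF S(1)] by blast
  have iS2: "integrable edge_measure (\<lambda>\<xi>. (?S \<xi>)\<^sup>2)" by (rule bounded_square_integrable[OF S])
  note iZ = bounded_local_integrable[OF Zc]
  have ind: "E.indep_var borel ?S borel (Z c)"
  proof (rule edge_indep_var[where ?K1.0 = "\<Union>c'\<in>F. desc c'" and ?K2.0 = "desc c"])
    show "?S \<in> borel_measurable spin_space" by (rule S(1))
    show "Z c \<in> borel_measurable spin_space" using Zc unfolding bounded_local_def by blast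
    show "?S x = ?S y" if "\<And>i. i \<in> (\<Union>c'\<in>F. desc c') \<Longrightarrow> x i = y i" for x y
    proof (rule sum.cong[OF refl])
      fix c' assume "c' \<in> F"
      then have "\<forall>u\<in>desc c'. x u = y u" using that by blast
      then show "Z c' x = Z c' y" using ZF[OF \<open>c' \<in> F\<close>] unfolding bounded_local_def by blast
    qed
    show "Z c x = Z c y" if "\<And>i. i \<in> desc c \<Longrightarrow> x i = y i" for x y
      using that Zc unfolding bounded_local_def by blast
    have "desc c' \<inter> desc c = {}" if "c' \<in> F" for c'
      using that insert.prems(1) insert.hyps(2) chD[of c' v] chD[of c v] by (intro desc_disjoint) auto
    then show "(\<Union>c'\<in>F. desc c') \<inter> desc c = {}" by blast
  qed
  have iSZ: "integrable edge_measure (\<lambda>\<xi>. ?S \<xi> * Z c \<xi>)"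
    by (rule E.indep_var_integrable[OF ind iS iZ(1)])
  have ES: "E.expectation ?S = (\<Sum>c\<in>F. E.expectation (Z c))"
    by (rule Bochner_Integration.integral_sum) (rule bounded_local_integrable(1)[OF ZF])
  have IH: "E.expectation (\<lambda>\<xi>. (?S \<xi>)\<^sup>2) \<le> (\<Sum>c\<in>F. E.expectation (\<lambda>\<xi>. (Z c \<xi>)\<^sup>2)) + (\<Sum>c\<in>F. E.expectation (Z c))\<^sup>2"
    using insert.prems by (intro insert.IH) auto
  have "E.expectation (\<lambda>\<xi>. (\<Sum>c\<in>insert c F. Z c \<xi>)\<^sup>2) =
      E.expectation (\<lambda>\<xi>. (?S \<xi>)\<^sup>2 + (2 * (?S \<xi> * Z c \<xi>) + (Z c \<xi>)\<^sup>2))"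
    using insert.hyps by (intro Bochner_Integration.integral_cong refl) (simp add: power2_sum algebra_simps)
  also have "\<dots> = E.expectation (\<lambda>\<xi>. (?S \<xi>)\<^sup>2) + (2 * (E.expectation ?S * E.expectation (Z c)) + E.expectation (\<lambda>\<xi>. (Z c \<xi>)\<^sup>2))"
    using iS2 iSZ iZ by (simp add: E.indep_var_lebesgue_integral[OF ind iS iZ(1)])
  \<comment> \<open>The added square of the new mean completes the square of the sum of
    means.\<close>
  also have "\<dots> \<le> ((\<Sum>c\<in>F. E.expectation (\<lambda>\<xi>. (Z c \<xi>)\<^sup>2)) + (\<Sum>c\<in>F. E.expectation (Z c))\<^sup>2) +
      (2 * (E.expectation ?S * E.expectation (Z c)) + E.expectation (\<lambda>\<xi>. (Z c \<xi>)\<^sup>2)) + (E.expectation (Z c))\<^sup>2"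
    using IH zero_le_power2[of "E.expectation (Z c)"] by linarith
  also have "\<dots> = (\<Sum>c\<in>insert c F. E.expectation (\<lambda>\<xi>. (Z c \<xi>)\<^sup>2)) + (\<Sum>c\<in>insert c F. E.expectation (Z c))\<^sup>2"
    unfolding ES using insert.hyps by (simp add: power2_sum algebra_simps)
  finally show ?case .
qed simp

lemma edge_square: "\<xi> \<in> space edge_measure \<Longrightarrow> (\<xi> c * z)\<^sup>2 = z\<^sup>2"
  using spin_values[of \<xi> c] by (auto simp: space_edge_measure power_mult_distrib)

lemma expectation_edge_mult:
  assumes c: "c \<noteq> r" and Z: "Z \<in> borel_measurable spin_space" "\<exists>B. \<forall>\<xi>\<in>space spin_space. \<bar>Z \<xi>\<bar> \<le> B"
    "\<And>\<xi> \<xi>'. (\<And>u. u \<in> desc c - {c} \<Longrightarrow> \<xi> u = \<xi>' u) \<Longrightarrow> Z \<xi> = Z \<xi>'"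
  shows "E.expectation (\<lambda>\<xi>. \<xi> c * Z \<xi>) = \<theta> * E.expectation Z"
proof -
  have ind: "E.indep_var borel (\<lambda>\<xi>. \<xi> c) borel Z"
  proof (rule edge_indep_var[where ?K1.0 = "{c}" and ?K2.0 = "desc c - {c}"])
    show "Z x = Z y" if "\<And>i. i \<in> desc c - {c} \<Longrightarrow> x i = y i" for x y
      by (rule Z(3)) (rule that)
  qed (use Z(1) in simp_all)
  obtain B where B: "\<And>\<xi>. \<xi> \<in> space spin_space \<Longrightarrow> \<bar>Z \<xi>\<bar> \<le> B" using Z(2) by blast
  show ?thesis
    using E.indep_var_lebesgue_integral[OF ind integrable_edge_variable bounded_integrable[OF Z(1) B]]
    by (simp add: expectation_edge_variable[OF c])
qed

lemma \<Delta>_local: "(\<And>u. u \<in> desc v - {v} \<Longrightarrow> \<xi> u = \<xi>' u) \<Longrightarrow> \<Delta> n v \<xi> = \<Delta> n v \<xi>'"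
  using Y_local[of v \<xi> \<xi>' n] Y_local[of v \<xi> \<xi>' "Suc n"] unfolding \<Delta>_def by metis

lemma \<Delta>_measurable: "\<Delta> n v \<in> borel_measurable spin_space"
  unfolding \<Delta>_def[abs_def] by (intro borel_measurable_diff Y_measurable)

lemma \<Delta>_bounded: "\<exists>B. \<forall>\<xi>\<in>space spin_space. \<bar>\<Delta> n v \<xi>\<bar> \<le> B"
proof -
  obtain B B' where B: "\<And>\<xi>. \<xi> \<in> space spin_space \<Longrightarrow> \<bar>Y (Suc n) v \<xi>\<bar> \<le> B"
      "\<And>\<xi>. \<xi> \<in> space spin_space \<Longrightarrow> \<bar>Y n v \<xi>\<bar> \<le> B'"
    using Y_bounded[of "Suc n" v] Y_bounded[of n v] by blast
  have "\<bar>\<Delta> n v \<xi>\<bar> \<le> B + B'" if "\<xi> \<in> space spin_space" for \<xi>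
    unfolding \<Delta>_def using B[OF that] by linarith
  then show ?thesis by blast
qed

lemma Y_integrable: "integrable edge_measure (Y n v)"
  using Y_bounded[of n v] bounded_integrable[OF Y_measurable] by blast

lemma \<Delta>_integrable: "integrable edge_measure (\<Delta> n v)"
  using \<Delta>_bounded[of n v] bounded_integrable[OF \<Delta>_measurable] by blast

text \<open>In contrast to \<open>bounded_local\<close>, the edge variable of \<open>v\<close>
  itself is excluded and hence independent of \<open>Z\<close>.\<close>

definition strict_local :: "'v \<Rightarrow> (('v \<Rightarrow> real) \<Rightarrow> real) \<Rightarrow> bool" where
  "strict_local v Z \<longleftrightarrow> Z \<in> borel_measurable spin_space \<and> (\<exists>B. \<forall>\<xi>\<in>space spin_space. \<bar>Z \<xi>\<bar> \<le> B) \<and>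
    (\<forall>\<xi> \<xi>'. (\<forall>u\<in>desc v - {v}. \<xi> u = \<xi>' u) \<longrightarrow> Z \<xi> = Z \<xi>')"

lemma strict_localD:
  assumes "strict_local v Z"
  shows "Z \<in> borel_measurable spin_space" "\<exists>B. \<forall>\<xi>\<in>space spin_space. \<bar>Z \<xi>\<bar> \<le> B"
    "\<And>\<xi> \<xi>'. (\<And>u. u \<in> desc v - {v} \<Longrightarrow> \<xi> u = \<xi>' u) \<Longrightarrow> Z \<xi> = Z \<xi>'"
  using assms unfolding strict_local_def by blast+

lemma Y_strict_local: "strict_local v (Y n v)"
  unfolding strict_local_def
proof (intro conjI allI impI)
  show "Y n v \<xi> = Y n v \<xi>'" if "\<forall>u\<in>desc v - {v}. \<xi> u = \<xi>' u" for \<xi> \<xi>'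
    by (rule Y_local) (use that in blast)
qed (rule Y_measurable Y_bounded)+

lemma \<Delta>_strict_local: "strict_local v (\<Delta> n v)"
  unfolding strict_local_def
proof (intro conjI allI impI)
  show "\<Delta> n v \<xi> = \<Delta> n v \<xi>'" if "\<forall>u\<in>desc v - {v}. \<xi> u = \<xi>' u" for \<xi> \<xi>'
    by (rule \<Delta>_local) (use that in blast)
qed (rule \<Delta>_measurable \<Delta>_bounded)+

definition evpos_event :: "'v \<Rightarrow> ('v \<Rightarrow> real) set" where
  "evpos_event v = {\<xi>\<in>space spin_space. evpos (\<lambda>n. Y n v \<xi>)}"

lemma evpos_event_sets: "evpos_event v \<in> sets spin_space"
  unfolding evpos_event_def by (rule evpos_sets) (rule Y_measurable)

context
  assumes ks: "1 < d * \<theta>\<^sup>2"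
begin

lemma \<theta>_pos: "0 < \<theta>"
proof (rule ccontr)
  assume "\<not> 0 < \<theta>"
  then have "\<theta> = 0" using \<theta> by simp
  with ks show False by simp
qed

lemma \<rho>: "0 < \<rho>" "\<rho> < 1"
  using ks by (simp_all add: \<rho>_def)

lemma d\<theta>_pos: "0 < d * \<theta>"
  using \<theta>_pos d2 by simp

lemma \<rho>_eq: "d / (d * \<theta>)\<^sup>2 = \<rho>"
  using d2 by (simp add: \<rho>_def power2_eq_square)

text \<open>Means add to \<open>d * \<theta> * m\<close> and second moments of signed terms are
  those of \<open>Z\<close>, so the normalization leaves \<open>m\<close> and \<rho> times
  \<open>M\<close> plus \<open>m^2\<close>. The general form serves both \<open>Y\<close> with mean
  1 and its increments with mean 0.\<close>

lemma branching_moments: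
  fixes Z :: "'v \<Rightarrow> ('v \<Rightarrow> real) \<Rightarrow> real"
  assumes v: "v \<noteq> r"
    and Z: "\<And>c. c \<in> ch v \<Longrightarrow> strict_local c (Z c)"
    and m: "\<And>c. c \<in> ch v \<Longrightarrow> E.expectation (Z c) = m"
    and M: "\<And>c. c \<in> ch v \<Longrightarrow> E.expectation (\<lambda>\<xi>. (Z c \<xi>)\<^sup>2) \<le> M"
  shows "E.expectation (\<lambda>\<xi>. (\<Sum>c\<in>ch v. \<xi> c * Z c \<xi>) / (d * \<theta>)) = m"
    "E.expectation (\<lambda>\<xi>. ((\<Sum>c\<in>ch v. \<xi> c * Z c \<xi>) / (d * \<theta>))\<^sup>2) \<le> \<rho> * M + m\<^sup>2"
proof -
  have bl: "bounded_local c (\<lambda>\<xi>. \<xi> c * Z c \<xi>)" if "c \<in> ch v" for c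
    by (rule bounded_local_edge[OF strict_localD[OF Z[OF that]]])
  have mean: "E.expectation (\<lambda>\<xi>. \<xi> c * Z c \<xi>) = \<theta> * m" if "c \<in> ch v" for c
  proof -
    have "c \<noteq> r" using chD[OF that] by blast
    from expectation_edge_mult[OF this strict_localD[OF Z[OF that]]] show ?thesis by (simp only: m[OF that])
  qed
  have card: "card (ch v) = d" by (rule card_ch[OF v])
  have "E.expectation (\<lambda>\<xi>. \<Sum>c\<in>ch v. \<xi> c * Z c \<xi>) = (\<Sum>c\<in>ch v. E.expectation (\<lambda>\<xi>. \<xi> c * Z c \<xi>))"
    by (rule Bochner_Integration.integral_sum) (rule bounded_local_integrable(1)[OF bl])
  also have "\<dots> = d * \<theta> * m" using mean by (simp add: card)
  finally have sum: "E.expectation (\<lambda>\<xi>. \<Sum>c\<in>ch v. \<xi> c * Z c \<xi>) = d * \<theta> * m" .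
  have ne: "d * \<theta> \<noteq> 0" using d\<theta>_pos by linarith
  show "E.expectation (\<lambda>\<xi>. (\<Sum>c\<in>ch v. \<xi> c * Z c \<xi>) / (d * \<theta>)) = m"
    by (simp only: integral_divide_zero sum nonzero_mult_div_cancel_left[OF ne])
  have "E.expectation (\<lambda>\<xi>. (\<Sum>c\<in>ch v. \<xi> c * Z c \<xi>)\<^sup>2) \<le>
      (\<Sum>c\<in>ch v. E.expectation (\<lambda>\<xi>. (\<xi> c * Z c \<xi>)\<^sup>2)) + (\<Sum>c\<in>ch v. E.expectation (\<lambda>\<xi>. \<xi> c * Z c \<xi>))\<^sup>2"
    by (rule second_moment_sum_le[OF finite_ch subset_refl bl])
  also have "\<dots> \<le> d * M + (d * \<theta> * m)\<^sup>2"
  proof -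
    have "E.expectation (\<lambda>\<xi>. (\<xi> c * Z c \<xi>)\<^sup>2) \<le> M" if "c \<in> ch v" for c
    proof -
      have "E.expectation (\<lambda>\<xi>. (\<xi> c * Z c \<xi>)\<^sup>2) = E.expectation (\<lambda>\<xi>. (Z c \<xi>)\<^sup>2)"
        by (intro Bochner_Integration.integral_cong refl edge_square)
      then show ?thesis using M[OF that] by simp
    qed
    then have "(\<Sum>c\<in>ch v. E.expectation (\<lambda>\<xi>. (\<xi> c * Z c \<xi>)\<^sup>2)) \<le> (\<Sum>c\<in>ch v. M)" by (rule sum_mono)
    moreover have "(\<Sum>c\<in>ch v. E.expectation (\<lambda>\<xi>. \<xi> c * Z c \<xi>)) = d * \<theta> * m" using mean by (simp add: card)
    ultimately show ?thesis by (simp add: card)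
  qed
  finally have le: "E.expectation (\<lambda>\<xi>. (\<Sum>c\<in>ch v. \<xi> c * Z c \<xi>)\<^sup>2) \<le> d * M + (d * \<theta> * m)\<^sup>2" .
  have "E.expectation (\<lambda>\<xi>. ((\<Sum>c\<in>ch v. \<xi> c * Z c \<xi>) / (d * \<theta>))\<^sup>2) =
      E.expectation (\<lambda>\<xi>. (\<Sum>c\<in>ch v. \<xi> c * Z c \<xi>)\<^sup>2) / (d * \<theta>)\<^sup>2"
    by (simp only: power_divide integral_divide_zero)
  also have "\<dots> \<le> (d * M + (d * \<theta> * m)\<^sup>2) / (d * \<theta>)\<^sup>2"
    by (rule divide_right_mono[OF le]) simp
  also have "\<dots> = d / (d * \<theta>)\<^sup>2 * M + m\<^sup>2"
  proof -
    have nz: "(d * \<theta>)\<^sup>2 \<noteq> 0" using ne by (rule power_not_zero)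
    show ?thesis
      by (simp only: add_divide_distrib power_mult_distrib[of "d * \<theta>" m] nonzero_mult_div_cancel_left[OF nz] times_divide_eq_left)
  qed
  finally show "E.expectation (\<lambda>\<xi>. ((\<Sum>c\<in>ch v. \<xi> c * Z c \<xi>) / (d * \<theta>))\<^sup>2) \<le> \<rho> * M + m\<^sup>2"
    unfolding \<rho>_eq .
qed

text \<open>The bound \<open>1 / (1 - \<rho>)\<close> is the fixed point of the recursion
  \<open>M \<mapsto> \<rho> * M + 1\<close>.\<close>

lemma Y_moments:
  "v \<noteq> r \<Longrightarrow> E.expectation (Y n v) = 1 \<and> E.expectation (\<lambda>\<xi>. (Y n v \<xi>)\<^sup>2) \<le> 1 / (1 - \<rho>)"
proof (induction n arbitrary: v)
  case 0
  show ?case using \<rho> by (simp add: E.prob_space)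
next
  case (Suc n)
  have c: "E.expectation (Y n c) = 1" "E.expectation (\<lambda>\<xi>. (Y n c \<xi>)\<^sup>2) \<le> 1 / (1 - \<rho>)" if "c \<in> ch v" for c
    using Suc.IH[of c] chD[OF that] by auto
  have "E.expectation (\<lambda>\<xi>. (Y (Suc n) v \<xi>)\<^sup>2) \<le> \<rho> * (1 / (1 - \<rho>)) + 1\<^sup>2"
    unfolding Y.simps by (rule branching_moments(2)[where Z = "Y n", OF Suc.prems Y_strict_local c])
  also have "\<dots> = 1 / (1 - \<rho>)" using \<rho> by (simp add: field_simps)
  finally have "E.expectation (\<lambda>\<xi>. (Y (Suc n) v \<xi>)\<^sup>2) \<le> 1 / (1 - \<rho>)" .
  moreover have "E.expectation (Y (Suc n) v) = 1"
    unfolding Y.simps by (rule branching_moments(1)[where Z = "Y n", OF Suc.prems Y_strict_local c])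
  ultimately show ?case by blast
qed

text \<open>Mean zero removes the additive term, so the second moment decays geometrically, starting
  from the variance of \<open>Y 1 v\<close>, which is at most \<rho>.\<close>

lemma \<Delta>_moments:
  "v \<noteq> r \<Longrightarrow> E.expectation (\<Delta> n v) = 0 \<and> E.expectation (\<lambda>\<xi>. (\<Delta> n v \<xi>)\<^sup>2) \<le> \<rho> ^ Suc n"
proof (induction n arbitrary: v)
  case 0
  have c: "E.expectation (Y 0 c) = 1" "E.expectation (\<lambda>\<xi>. (Y 0 c \<xi>)\<^sup>2) \<le> 1" for c
    by (simp_all add: E.prob_space)
  have Y1: "Y 1 v = (\<lambda>\<xi>. (\<Sum>c\<in>ch v. \<xi> c * Y 0 c \<xi>) / (d * \<theta>))"
    by (simp only: One_nat_def Y.simps(2))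
  have \<Delta>0: "\<Delta> 0 v = (\<lambda>\<xi>. Y 1 v \<xi> - 1)"
    by (intro ext) (simp only: \<Delta>_def One_nat_def Y.simps(1))
  have m1: "E.expectation (Y 1 v) = 1" and M1: "E.expectation (\<lambda>\<xi>. (Y 1 v \<xi>)\<^sup>2) \<le> \<rho> * 1 + 1\<^sup>2"
    unfolding Y1
    by (rule branching_moments(1)[where Z = "Y 0", OF 0 Y_strict_local c], rule branching_moments(2)[where Z = "Y 0", OF 0 Y_strict_local c])
  have i: "integrable edge_measure (Y 1 v)" "integrable edge_measure (\<lambda>\<xi>. (Y 1 v \<xi>)\<^sup>2)"
    by (rule Y_integrable, rule bounded_square_integrable[OF Y_measurable Y_bounded])
  have "E.expectation (\<lambda>\<xi>. (\<Delta> 0 v \<xi>)\<^sup>2) = E.expectation (\<lambda>\<xi>. (Y 1 v \<xi>)\<^sup>2 - 2 * Y 1 v \<xi> + 1)"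
    unfolding \<Delta>0 by (intro Bochner_Integration.integral_cong refl) (simp add: power2_diff del: Y.simps One_nat_def)
  also have "\<dots> = E.expectation (\<lambda>\<xi>. (Y 1 v \<xi>)\<^sup>2) - 2 * E.expectation (Y 1 v) + 1"
    using i by (simp add: E.prob_space del: Y.simps One_nat_def)
  also have "\<dots> \<le> \<rho>" using M1 unfolding m1 mult_1_right power_one by linarith
  finally have "E.expectation (\<lambda>\<xi>. (\<Delta> 0 v \<xi>)\<^sup>2) \<le> \<rho>" .
  moreover have "E.expectation (\<Delta> 0 v) = 0"
    unfolding \<Delta>0 using i m1 by (simp add: E.prob_space del: Y.simps One_nat_def)
  ultimately show ?case by simp
next
  case (Suc n)
  have c: "E.expectation (\<Delta> n c) = 0" "E.expectation (\<lambda>\<xi>. (\<Delta> n c \<xi>)\<^sup>2) \<le> \<rho> ^ Suc n" if "c \<in> ch v" for c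
    using Suc.IH[of c] chD[OF that] by auto
  have D: "\<Delta> (Suc n) v = (\<lambda>\<xi>. (\<Sum>c\<in>ch v. \<xi> c * \<Delta> n c \<xi>) / (d * \<theta>))"
    by (intro ext) (rule \<Delta>_Suc)
  have "E.expectation (\<lambda>\<xi>. (\<Delta> (Suc n) v \<xi>)\<^sup>2) \<le> \<rho> * \<rho> ^ Suc n + 0\<^sup>2"
    unfolding D by (rule branching_moments(2)[where Z = "\<Delta> n", OF Suc.prems \<Delta>_strict_local c])
  moreover have "E.expectation (\<Delta> (Suc n) v) = 0"
    unfolding D by (rule branching_moments(1)[where Z = "\<Delta> n", OF Suc.prems \<Delta>_strict_local c])
  ultimately show ?case by simp
qed

text \<open>The square of a mean is at most the second moment, by nonnegativity of the
  variance.\<close>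

lemma expectation_abs_\<Delta>_le:
  assumes v: "v \<noteq> r"
  shows "E.expectation (\<lambda>\<xi>. \<bar>\<Delta> n v \<xi>\<bar>) \<le> sqrt \<rho> ^ Suc n"
proof -
  have i: "integrable edge_measure (\<lambda>\<xi>. \<bar>\<Delta> n v \<xi>\<bar>)" "integrable edge_measure (\<lambda>\<xi>. \<bar>\<Delta> n v \<xi>\<bar>\<^sup>2)"
    using \<Delta>_integrable bounded_square_integrable[OF \<Delta>_measurable \<Delta>_bounded] by simp_all
  have "(E.expectation (\<lambda>\<xi>. \<bar>\<Delta> n v \<xi>\<bar>))\<^sup>2 \<le> E.expectation (\<lambda>\<xi>. \<bar>\<Delta> n v \<xi>\<bar>\<^sup>2)"
    using E.variance_positive[of "\<lambda>\<xi>. \<bar>\<Delta> n v \<xi>\<bar>"] E.variance_eq[OF i] by linarith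
  also have "\<dots> \<le> \<rho> ^ Suc n" using \<Delta>_moments[OF v, of n] by simp
  also have "\<dots> = (sqrt \<rho> ^ Suc n)\<^sup>2"
  proof -
    have "(sqrt \<rho> ^ Suc n)\<^sup>2 = ((sqrt \<rho>)\<^sup>2) ^ Suc n"
      unfolding power_mult[symmetric] by (subst mult.commute) (rule refl)
    also have "(sqrt \<rho>)\<^sup>2 = \<rho>" by (rule real_sqrt_pow2) (rule less_imp_le[OF \<rho>(1)])
    finally show ?thesis by (rule HOL.sym)
  qed
  finally show ?thesis
    by (rule power2_le_imp_le) (intro zero_le_power real_sqrt_ge_zero less_imp_le[OF \<rho>(1)])
qed

text \<open>The absolute increments have geometrically decaying means with ratio
  \<open>sqrt \<rho>\<close>, so they are almost surely summable and the telescoping series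
  converges.\<close>

lemma Y_converges_AE:
  assumes v: "v \<noteq> r"
  shows "AE \<xi> in edge_measure. convergent (\<lambda>n. Y n v \<xi>)"
proof -
  have m: "(\<lambda>\<xi>. ennreal \<bar>\<Delta> n v \<xi>\<bar>) \<in> borel_measurable edge_measure" for n
    using \<Delta>_integrable[of n v] by (intro measurable_compose[OF _ measurable_ennreal] borel_measurable_abs) (rule borel_measurable_integrable)
  have "(\<integral>\<^sup>+\<xi>. (\<Sum>n. ennreal \<bar>\<Delta> n v \<xi>\<bar>) \<partial>edge_measure) = (\<Sum>n. \<integral>\<^sup>+\<xi>. ennreal \<bar>\<Delta> n v \<xi>\<bar> \<partial>edge_measure)"
    by (rule nn_integral_suminf[OF m])
  also have "\<dots> = (\<Sum>n. ennreal (E.expectation (\<lambda>\<xi>. \<bar>\<Delta> n v \<xi>\<bar>)))"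
    by (intro suminf_cong nn_integral_eq_integral integrable_abs \<Delta>_integrable) simp
  also have "\<dots> \<le> (\<Sum>n. ennreal (sqrt \<rho> ^ Suc n))"
    by (intro suminf_le summableI ennreal_leI expectation_abs_\<Delta>_le[OF v])
  also have "\<dots> < \<infinity>"
  proof -
    have "summable (\<lambda>n. sqrt \<rho> ^ Suc n)"
      unfolding power_Suc using \<rho> by (intro summable_mult summable_geometric) simp
    then have "(\<Sum>n. ennreal (sqrt \<rho> ^ Suc n)) \<noteq> top"
      by (rule ennreal_suminf_neq_top) (use \<rho> in simp)
    then show ?thesis by (simp add: less_top)
  qed
  finally have "AE \<xi> in edge_measure. (\<Sum>n. ennreal \<bar>\<Delta> n v \<xi>\<bar>) \<noteq> \<infinity>"
    by (intro nn_integral_noteq_infinite[OF borel_measurable_suminf_order[OF m]]) (simp add: less_top[symmetric])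
  then show ?thesis
  proof (rule AE_mp, intro AE_I2 impI)
    fix \<xi> assume "(\<Sum>n. ennreal \<bar>\<Delta> n v \<xi>\<bar>) \<noteq> \<infinity>"
    then have "summable (\<lambda>n. \<bar>\<Delta> n v \<xi>\<bar>)"
      by (intro summable_suminf_not_top) simp_all
    then have "summable (\<lambda>n. \<Delta> n v \<xi>)" by (rule summable_rabs_cancel)
    then have lim: "(\<lambda>n. \<Sum>k<n. \<Delta> k v \<xi>) \<longlonglongrightarrow> (\<Sum>n. \<Delta> n v \<xi>)" by (rule summable_LIMSEQ)
    have "(\<Sum>k<n. \<Delta> k v \<xi>) = Y n v \<xi> - Y 0 v \<xi>" for n
      unfolding \<Delta>_def by (rule sum_lessThan_telescope)
    from tendsto_add[OF lim[unfolded this] tendsto_const[of "Y 0 v \<xi>"]]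
    have "(\<lambda>n. Y n v \<xi>) \<longlonglongrightarrow> (\<Sum>n. \<Delta> n v \<xi>) + Y 0 v \<xi>"
      by (simp only: diff_add_cancel)
    then show "convergent (\<lambda>n. Y n v \<xi>)" by (rule convergentI)
  qed
qed

text \<open>A Paley-Zygmund bound: mean 1 and bounded second moment prevent the mass from sitting
  below \<open>1 / 2\<close>. Pointwise, a value \<open>y \<ge> 1 / 2\<close> is at most
  \<open>a / 2 * y^2 + 1 / (2 * a)\<close>, since \<open>(a * y - 1)^2\<close> is
  nonnegative.\<close>

lemma prob_Y_ge_half:
  assumes v: "v \<noteq> r"
  shows "(1 - \<rho>) / 4 \<le> measure edge_measure {\<xi>\<in>space edge_measure. 1 / 2 \<le> Y n v \<xi>}"
proof -
  let ?B = "{\<xi>\<in>space edge_measure. 1 / 2 \<le> Y n v \<xi>}"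
  \<comment> \<open>Chosen so that the second-moment term contributes exactly \<open>1 / 4\<close>,
    half of the gap between \<open>1 / 2\<close> and 1.\<close>
  define a where "a = (1 - \<rho>) / 2"
  have a: "0 < a" using \<rho> by (simp add: a_def)
  have mY: "Y n v \<in> borel_measurable edge_measure" by (rule borel_measurable_integrable[OF Y_integrable])
  have B: "?B \<in> sets edge_measure" using mY by measurable
  have i: "integrable edge_measure (\<lambda>\<xi>. (Y n v \<xi>)\<^sup>2)" "integrable edge_measure (indicator ?B :: _ \<Rightarrow> real)"
    by (rule bounded_square_integrable[OF Y_measurable Y_bounded], rule integrable_real_indicator[OF B])
      (simp add: E.emeasure_eq_measure)
  have "1 = E.expectation (Y n v)" using Y_moments[OF v, of n] by simp
  also have "\<dots> \<le> E.expectation (\<lambda>\<xi>. 1 / 2 + (a / 2 * (Y n v \<xi>)\<^sup>2 + 1 / (2 * a) * indicator ?B \<xi>))"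
  proof (rule integral_mono[OF Y_integrable])
    show "integrable edge_measure (\<lambda>\<xi>. 1 / 2 + (a / 2 * (Y n v \<xi>)\<^sup>2 + 1 / (2 * a) * indicator ?B \<xi>))"
      by (intro Bochner_Integration.integrable_add integrable_mult_right i E.integrable_const)
    fix \<xi> assume x: "\<xi> \<in> space edge_measure"
    show "Y n v \<xi> \<le> 1 / 2 + (a / 2 * (Y n v \<xi>)\<^sup>2 + 1 / (2 * a) * indicator ?B \<xi>)"
    proof (cases "1 / 2 \<le> Y n v \<xi>")
      case True
      have "0 \<le> (a * Y n v \<xi> - 1)\<^sup>2 / (2 * a)" using a by simp
      also have "\<dots> = a / 2 * (Y n v \<xi>)\<^sup>2 + 1 / (2 * a) - Y n v \<xi>"
        using a by (simp add: power2_diff field_simps power2_eq_square)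
      finally show ?thesis using True x by simp
    next
      case False
      then have "1 / (2 * a) * indicator ?B \<xi> = 0" by simp
      moreover have "0 \<le> a / 2 * (Y n v \<xi>)\<^sup>2" using a by simp
      ultimately show ?thesis using False by linarith
    qed
  qed
  also have "\<dots> = 1 / 2 + (a / 2 * E.expectation (\<lambda>\<xi>. (Y n v \<xi>)\<^sup>2) + 1 / (2 * a) * measure edge_measure ?B)"
    using i B by (simp add: E.prob_space)
  also have "\<dots> \<le> 1 / 2 + (a / 2 * (1 / (1 - \<rho>)) + 1 / (2 * a) * measure edge_measure ?B)"
    using Y_moments[OF v, of n] a by (intro add_left_mono add_right_mono mult_left_mono) simp_all
  also have "a / 2 * (1 / (1 - \<rho>)) = 1 / 4" using \<rho> by (simp add: a_def)
  finally have "1 / 4 \<le> measure edge_measure ?B / (2 * a)" by simp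
  then have "1 / 4 * (2 * a) \<le> measure edge_measure ?B" using a by (simp only: pos_le_divide_eq)
  then show ?thesis by (simp add: a_def)
qed

text \<open>The uniform bound passes to the event that \<open>Y n v \<ge> 1 / 2\<close> infinitely
  often; where the sequence converges, the limit is then at least \<open>1 / 2\<close>.\<close>

lemma prob_evpos_event:
  assumes v: "v \<noteq> r"
  shows "(1 - \<rho>) / 4 \<le> measure edge_measure (evpos_event v)"
proof -
  define B where "B n = {\<xi>\<in>space edge_measure. 1 / 2 \<le> Y n v \<xi>}" for n
  define U where "U N = (\<Union>n\<in>{N..}. B n)" for N
  have mY: "Y n v \<in> borel_measurable edge_measure" for n by (rule borel_measurable_integrable[OF Y_integrable])
  have B: "B n \<in> sets edge_measure" for n unfolding B_def using mY by measurable
  have U: "U N \<in> sets edge_measure" for N unfolding U_def using B by (intro sets.countable_UN') auto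
  have "decseq U" unfolding U_def decseq_def by fastforce
  then have lim: "(\<lambda>N. measure edge_measure (U N)) \<longlonglongrightarrow> measure edge_measure (\<Inter>N. U N)"
    using U by (intro E.finite_Lim_measure_decseq) auto
  have "(1 - \<rho>) / 4 \<le> measure edge_measure (U N)" for N
  proof -
    have "(1 - \<rho>) / 4 \<le> measure edge_measure (B N)" unfolding B_def by (rule prob_Y_ge_half[OF v])
    also have "\<dots> \<le> measure edge_measure (U N)"
      by (rule E.finite_measure_mono[OF _ U]) (auto simp: U_def)
    finally show ?thesis .
  qed
  then have "(1 - \<rho>) / 4 \<le> measure edge_measure (\<Inter>N. U N)"
    by (intro LIMSEQ_le_const[OF lim]) blast
  also have "\<dots> \<le> measure edge_measure (evpos_event v)"
  proof (rule E.finite_measure_mono_AE)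
    show "evpos_event v \<in> sets edge_measure" using evpos_event_sets by (simp only: sets_edge_measure)
    show "AE \<xi> in edge_measure. \<xi> \<in> (\<Inter>N. U N) \<longrightarrow> \<xi> \<in> evpos_event v"
      using Y_converges_AE[OF v]
    proof (rule AE_mp, intro AE_I2 impI)
      fix \<xi> assume x: "\<xi> \<in> space edge_measure" and conv: "convergent (\<lambda>n. Y n v \<xi>)" and "\<xi> \<in> (\<Inter>N. U N)"
      then have freq: "\<exists>n\<ge>N. 1 / 2 \<le> Y n v \<xi>" for N by (auto simp: U_def B_def)
      obtain l where l: "(\<lambda>n. Y n v \<xi>) \<longlonglongrightarrow> l" using conv by (auto simp: convergent_def)
      have "1 / 2 \<le> l"
      proof (rule ccontr)
        assume "\<not> 1 / 2 \<le> l"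
        then have "eventually (\<lambda>n. Y n v \<xi> < 1 / 2) sequentially" by (intro order_tendstoD(2)[OF l]) linarith
        then obtain N where "\<And>n. n \<ge> N \<Longrightarrow> Y n v \<xi> < 1 / 2" unfolding eventually_sequentially by blast
        with freq[of N] show False by force
      qed
      then have "evpos (\<lambda>n. Y n v \<xi>)" by (intro evpos_limit[OF l]) simp
      then show "\<xi> \<in> evpos_event v" using x by (simp add: evpos_event_def space_edge_measure)
    qed
  qed
  finally show ?thesis .
qed

end

section \<open>Independent sign comparisons at pairs of siblings\<close>

lemma prob_inter_indep:
  assumes A: "{\<xi>\<in>space spin_space. PA \<xi>} \<in> sets spin_space" and B: "{\<xi>\<in>space spin_space. PB \<xi>} \<in> sets spin_space"
    and depA: "\<And>x y. (\<And>i. i \<in> K1 \<Longrightarrow> x i = y i) \<Longrightarrow> PA x = PA y"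
    and depB: "\<And>x y. (\<And>i. i \<in> K2 \<Longrightarrow> x i = y i) \<Longrightarrow> PB x = PB y"
    and disj: "K1 \<inter> K2 = {}"
  shows "measure edge_measure {\<xi>\<in>space spin_space. PA \<xi> \<and> PB \<xi>} =
    measure edge_measure {\<xi>\<in>space spin_space. PA \<xi>} * measure edge_measure {\<xi>\<in>space spin_space. PB \<xi>}"
proof -
  let ?f = "\<lambda>Q \<xi>. if Q \<xi> then 1 else 0 :: real"
  have m: "?f Q \<in> borel_measurable spin_space" if "{\<xi>\<in>space spin_space. Q \<xi>} \<in> sets spin_space" for Q
    using that by (intro measurable_If) simp_all
  have i: "integrable edge_measure (?f Q)" if "{\<xi>\<in>space spin_space. Q \<xi>} \<in> sets spin_space" for Q
    by (rule bounded_integrable[OF m[OF that], where B = 1]) simp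
  have e: "E.expectation (?f Q) = measure edge_measure {\<xi>\<in>space spin_space. Q \<xi>}"
    if "{\<xi>\<in>space spin_space. Q \<xi>} \<in> sets spin_space" for Q
  proof -
    have "E.expectation (?f Q) = E.expectation (indicator {\<xi>\<in>space spin_space. Q \<xi>})"
      by (intro Bochner_Integration.integral_cong refl) (simp add: space_edge_measure indicator_def)
    also have "\<dots> = measure edge_measure {\<xi>\<in>space spin_space. Q \<xi>}"
      using that by (simp add: sets_edge_measure space_edge_measure)
    finally show ?thesis .
  qed
  have AB: "{\<xi>\<in>space spin_space. PA \<xi> \<and> PB \<xi>} \<in> sets spin_space"
  proof -
    have "{\<xi>\<in>space spin_space. PA \<xi> \<and> PB \<xi>} = {\<xi>\<in>space spin_space. PA \<xi>} \<inter> {\<xi>\<in>space spin_space. PB \<xi>}" by blast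
    then show ?thesis using A B by simp
  qed
  have ind: "E.indep_var borel (?f PA) borel (?f PB)"
  proof (rule edge_indep_var[OF m[OF A] m[OF B] _ _ disj])
    show "?f PA x = ?f PA y" if "\<And>i. i \<in> K1 \<Longrightarrow> x i = y i" for x y using depA[OF that] by simp
    show "?f PB x = ?f PB y" if "\<And>i. i \<in> K2 \<Longrightarrow> x i = y i" for x y using depB[OF that] by simp
  qed
  have "measure edge_measure {\<xi>\<in>space spin_space. PA \<xi> \<and> PB \<xi>} = E.expectation (\<lambda>\<xi>. ?f PA \<xi> * ?f PB \<xi>)"
    unfolding e[OF AB, symmetric] by (intro Bochner_Integration.integral_cong refl) simp
  also have "\<dots> = E.expectation (?f PA) * E.expectation (?f PB)"
    by (rule E.indep_var_lebesgue_integral[OF ind i[OF A] i[OF B]])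
  finally show ?thesis unfolding e[OF A] e[OF B] .
qed

lemma prob_edge_variable_ge:
  assumes c: "c \<noteq> r" and a: "a = -1 \<or> a = (1::real)"
  shows "(1 - \<theta>) / 2 \<le> measure edge_measure {\<xi>\<in>space spin_space. \<xi> c = a}"
proof -
  have S: "{\<xi>\<in>space spin_space. \<xi> c = a} \<in> sets edge_measure"
    unfolding sets_edge_measure by measurable
  have "emeasure edge_measure {\<xi>\<in>space spin_space. \<xi> c = a} = (\<integral>\<^sup>+\<xi>. (if \<xi> c = a then 1 else 0) \<partial>edge_measure)"
    unfolding nn_integral_indicator[OF S, symmetric]
    by (intro nn_integral_cong) (simp add: indicator_def space_edge_measure)
  also have "\<dots> = ennreal ((1 + \<theta>) / 2) * (if 1 = a then 1 else 0) + ennreal ((1 - \<theta>) / 2) * (if -1 = a then 1 else 0)"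
    by (rule nn_integral_edge_variable[OF c])
  also have "\<dots> \<ge> ennreal ((1 - \<theta>) / 2)"
    using a \<theta> by (auto intro!: ennreal_leI)
  finally show ?thesis by (simp add: E.emeasure_eq_measure)
qed

lemma prob_Inter_levels:
  assumes V: "finite V" "\<And>v w. v \<in> V \<Longrightarrow> w \<in> V \<Longrightarrow> lev v = lev w"
    and S: "\<And>v. v \<in> V \<Longrightarrow> S v \<in> sets spin_space"
    and dep: "\<And>v x y. v \<in> V \<Longrightarrow> x \<in> space spin_space \<Longrightarrow> y \<in> space spin_space \<Longrightarrow>
      (\<And>i. i \<in> desc v \<Longrightarrow> x i = y i) \<Longrightarrow> x \<in> S v \<longleftrightarrow> y \<in> S v"
  shows "measure edge_measure {\<xi>\<in>space spin_space. \<forall>v\<in>V. \<xi> \<in> S v} = (\<Prod>v\<in>V. measure edge_measure (S v))"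
proof -
  let ?f = "\<lambda>v. indicator (S v) :: _ \<Rightarrow> real"
  have ind: "E.indep_vars (\<lambda>_. borel) ?f V"
  proof (rule edge_indep[where K = desc])
    show "?f v \<in> borel_measurable spin_space" if "v \<in> V" for v
      by (rule borel_measurable_indicator[OF S[OF that]])
    show "?f v x = ?f v y" if "v \<in> V" "x \<in> space spin_space" "y \<in> space spin_space" "\<And>i. i \<in> desc v \<Longrightarrow> x i = y i" for v x y
      using dep[OF that] by (simp add: indicator_def)
    show "disjoint_family_on desc V"
      unfolding disjoint_family_on_def using V(2) desc_disjoint by blast
  qed
  have int: "integrable edge_measure (?f v)" if "v \<in> V" for v
    using S[OF that] by (intro integrable_real_indicator) (simp_all add: sets_edge_measure E.emeasure_eq_measure)
  have A: "{\<xi>\<in>space spin_space. \<forall>v\<in>V. \<xi> \<in> S v} \<in> sets edge_measure"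
    unfolding sets_edge_measure using V(1) S by (intro sets.sets_Collect_finite_All) auto
  have "measure edge_measure {\<xi>\<in>space spin_space. \<forall>v\<in>V. \<xi> \<in> S v} = E.expectation (indicator {\<xi>\<in>space spin_space. \<forall>v\<in>V. \<xi> \<in> S v})"
    using A sets.sets_into_space[OF A] by (simp add: Int_absorb2)
  also have "\<dots> = E.expectation (\<lambda>\<xi>. \<Prod>v\<in>V. ?f v \<xi>)"
  proof (intro Bochner_Integration.integral_cong refl)
    fix \<xi> assume "\<xi> \<in> space edge_measure"
    then show "indicator {\<xi>\<in>space spin_space. \<forall>v\<in>V. \<xi> \<in> S v} \<xi> = (\<Prod>v\<in>V. ?f v \<xi>)"
      using V(1) by (auto simp: indicator_def space_edge_measure prod_zero_iff)
  qed
  also have "\<dots> = (\<Prod>v\<in>V. E.expectation (?f v))"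
    by (rule E.indep_vars_lebesgue_integral[OF V(1) ind int])
  also have "\<dots> = (\<Prod>v\<in>V. measure edge_measure (S v))"
  proof (intro prod.cong refl)
    fix v assume "v \<in> V"
    from S[OF this] have "S v \<in> sets edge_measure" by (simp only: sets_edge_measure)
    then show "E.expectation (?f v) = measure edge_measure (S v)"
      using sets.sets_into_space[of "S v" edge_measure] by (simp add: Int_absorb2)
  qed
  finally show ?thesis .
qed

text \<open>The limits of the normalized spin sums below \<open>c\<close> and \<open>c'\<close> have the same sign; by spin-flip
  symmetry this is an event in the edge variables below the common parent of \<open>c\<close> and \<open>c'\<close> only.\<close>

definition agree :: "'v \<Rightarrow> 'v \<Rightarrow> ('v \<Rightarrow> real) set" where
  "agree c c' = {\<xi>\<in>space spin_space. evpos (\<lambda>n. (\<xi> c * Y n c \<xi>) * (\<xi> c' * Y n c' \<xi>))}"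

lemma agree_sets: "agree c c' \<in> sets spin_space"
  unfolding agree_def by (rule evpos_sets) (intro borel_measurable_times borel_measurable_spin Y_measurable)

lemma agree_local:
  assumes c: "c \<in> ch v" "c' \<in> ch v" and x: "x \<in> space spin_space" "y \<in> space spin_space"
    and eq: "\<And>i. i \<in> desc v \<Longrightarrow> x i = y i"
  shows "x \<in> agree c c' \<longleftrightarrow> y \<in> agree c c'"
proof -
  have "x e * Y n e x = y e * Y n e y" if "e \<in> ch v" for e n
  proof -
    have "x e = y e" using desc_child[OF that] desc_self[of e] by (intro eq) blast
    moreover have "Y n e x = Y n e y" using desc_child[OF that] by (intro Y_local eq) blast
    ultimately show ?thesis by simp
  qed
  from this[OF c(1)] this[OF c(2)] show ?thesis using x by (simp add: agree_def)
qed

text \<open>One factor for each of two siblings: a prescribed edge sign has probability at least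
  \<open>(1 - \<theta>) / 2\<close>, a positive limit at least
  \<open>(1 - \<rho>) / 4\<close>.\<close>

definition \<delta> :: real where "\<delta> = ((1 - \<theta>) / 2 * ((1 - \<rho>) / 4))\<^sup>2"

context
  assumes ks: "1 < d * \<theta>\<^sup>2"
begin

lemma \<delta>_pos: "0 < \<delta>"
  using \<theta> \<rho>[OF ks] by (simp add: \<delta>_def)

lemma prob_sign_event:
  assumes c: "c \<noteq> r" and a: "a = -1 \<or> a = (1::real)"
  shows "(1 - \<theta>) / 2 * ((1 - \<rho>) / 4) \<le>
    measure edge_measure {\<xi>\<in>space spin_space. \<xi> c = a \<and> evpos (\<lambda>n. Y n c \<xi>)}"
proof -
  have "measure edge_measure {\<xi>\<in>space spin_space. \<xi> c = a \<and> evpos (\<lambda>n. Y n c \<xi>)} =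
    measure edge_measure {\<xi>\<in>space spin_space. \<xi> c = a} * measure edge_measure {\<xi>\<in>space spin_space. evpos (\<lambda>n. Y n c \<xi>)}"
  proof (rule prob_inter_indep[where ?K1.0 = "{c}" and ?K2.0 = "desc c - {c}"])
    show "{\<xi>\<in>space spin_space. \<xi> c = a} \<in> sets spin_space" by measurable
    show "{\<xi>\<in>space spin_space. evpos (\<lambda>n. Y n c \<xi>)} \<in> sets spin_space"
      by (rule evpos_sets) (rule Y_measurable)
    show "evpos (\<lambda>n. Y n c x) = evpos (\<lambda>n. Y n c y)" if "\<And>i. i \<in> desc c - {c} \<Longrightarrow> x i = y i" for x y
    proof -
      have "Y n c x = Y n c y" for n by (rule Y_local) (rule that)
      then show ?thesis by simp
    qed
  qed simp_all
  moreover have "(1 - \<theta>) / 2 * ((1 - \<rho>) / 4) \<le>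
      measure edge_measure {\<xi>\<in>space spin_space. \<xi> c = a} * measure edge_measure {\<xi>\<in>space spin_space. evpos (\<lambda>n. Y n c \<xi>)}"
    using prob_edge_variable_ge[OF c a] prob_evpos_event[OF ks c] \<theta> \<rho>[OF ks]
    unfolding evpos_event_def by (intro mult_mono) simp_all
  ultimately show ?thesis by simp
qed

text \<open>Both limits being positive, equal edge signs force agreement and opposite ones forbid
  it; each of these scenarios has probability at least \<delta>. Nothing has to be known about
  vanishing limits.\<close>

lemma prob_agree:
  assumes c: "c \<in> ch v" "c' \<in> ch v" "c \<noteq> c'"
  shows "\<delta> \<le> measure edge_measure (agree c c')" "measure edge_measure (agree c c') \<le> 1 - \<delta>"
proof -
  let ?P = "\<lambda>c a \<xi>. \<xi> c = a \<and> evpos (\<lambda>n. Y n c \<xi>)"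
  have cr: "c \<noteq> r" "c' \<noteq> r" and l: "lev c = lev c'" using chD[OF c(1)] chD[OF c(2)] by auto
  have S: "{\<xi>\<in>space spin_space. ?P e a \<xi>} \<in> sets spin_space" for e a
  proof -
    have "{\<xi>\<in>space spin_space. \<xi> e = a} \<in> sets spin_space" by measurable
    moreover have "{\<xi>\<in>space spin_space. evpos (\<lambda>n. Y n e \<xi>)} \<in> sets spin_space"
      by (rule evpos_sets) (rule Y_measurable)
    moreover have "{\<xi>\<in>space spin_space. ?P e a \<xi>} =
        {\<xi>\<in>space spin_space. \<xi> e = a} \<inter> {\<xi>\<in>space spin_space. evpos (\<lambda>n. Y n e \<xi>)}" by blast
    ultimately show ?thesis by simp
  qed
  have loc: "?P e a x = ?P e a y" if "\<And>i. i \<in> desc e \<Longrightarrow> x i = y i" for e a x y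
  proof -
    have "x e = y e" by (rule that[OF desc_self])
    moreover have "Y n e x = Y n e y" for n using that by (intro Y_local) blast
    ultimately show ?thesis by simp
  qed
  have SS: "{\<xi>\<in>space spin_space. ?P c a \<xi> \<and> ?P c' b \<xi>} \<in> sets spin_space" for a b
  proof -
    have "{\<xi>\<in>space spin_space. ?P c a \<xi> \<and> ?P c' b \<xi>} = {\<xi>\<in>space spin_space. ?P c a \<xi>} \<inter> {\<xi>\<in>space spin_space. ?P c' b \<xi>}" by blast
    then show ?thesis using S by simp
  qed
  have lb: "\<delta> \<le> measure edge_measure {\<xi>\<in>space spin_space. ?P c a \<xi> \<and> ?P c' b \<xi>}"
    if "a = -1 \<or> a = (1::real)" "b = -1 \<or> b = (1::real)" for a b
  proof -
    have p: "0 \<le> (1 - \<theta>) / 2 * ((1 - \<rho>) / 4)" using \<theta> \<rho>[OF ks] by simp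
    have "measure edge_measure {\<xi>\<in>space spin_space. ?P c a \<xi> \<and> ?P c' b \<xi>} =
        measure edge_measure {\<xi>\<in>space spin_space. ?P c a \<xi>} * measure edge_measure {\<xi>\<in>space spin_space. ?P c' b \<xi>}"
      by (rule prob_inter_indep[OF S S loc loc desc_disjoint[OF l c(3)]])
    moreover have "\<delta> \<le> \<dots>"
      unfolding \<delta>_def power2_eq_square
      by (rule mult_mono[OF prob_sign_event[OF cr(1) that(1)] prob_sign_event[OF cr(2) that(2)] order_trans[OF p prob_sign_event[OF cr(1) that(1)]] p])
    ultimately show ?thesis by simp
  qed
  have A: "agree c c' \<in> sets edge_measure" using agree_sets by (simp only: sets_edge_measure)
  have "\<delta> \<le> measure edge_measure {\<xi>\<in>space spin_space. ?P c 1 \<xi> \<and> ?P c' 1 \<xi>}" by (rule lb) simp_all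
  also have "\<dots> \<le> measure edge_measure (agree c c')"
    by (rule E.finite_measure_mono[OF _ A]) (auto simp: agree_def intro: evpos_mult)
  finally show "\<delta> \<le> measure edge_measure (agree c c')" .
  have "{\<xi>\<in>space spin_space. ?P c (-1) \<xi> \<and> ?P c' 1 \<xi>} \<subseteq> space edge_measure - agree c c'"
  proof
    fix \<xi> assume x: "\<xi> \<in> {\<xi>\<in>space spin_space. ?P c (-1) \<xi> \<and> ?P c' 1 \<xi>}"
    then have "evpos (\<lambda>n. Y n c \<xi> * Y n c' \<xi>)" by (intro evpos_mult) simp_all
    then have "\<not> evpos (\<lambda>n. - (Y n c \<xi> * Y n c' \<xi>))" by (rule evpos_not_neg)
    then show "\<xi> \<in> space edge_measure - agree c c'" using x by (simp add: agree_def space_edge_measure)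
  qed
  then have "measure edge_measure {\<xi>\<in>space spin_space. ?P c (-1) \<xi> \<and> ?P c' 1 \<xi>} \<le> measure edge_measure (space edge_measure - agree c c')"
    using A by (intro E.finite_measure_mono) auto
  also have "\<dots> = 1 - measure edge_measure (agree c c')" by (rule E.prob_compl[OF A])
  finally show "measure edge_measure (agree c c') \<le> 1 - \<delta>"
    using lb[of "-1" 1] by simp
qed

end

text \<open>The version of \<open>Y\<close> in spins. It reads only the spins of one level, which
  makes invariance under finite changes visible, whereas a single spin enters several edge
  variables.\<close>

primrec X :: "nat \<Rightarrow> 'v \<Rightarrow> ('v \<Rightarrow> real) \<Rightarrow> real" where
  "X 0 = (\<lambda>v \<sigma>. \<sigma> v)"
| "X (Suc n) = (\<lambda>v \<sigma>. (\<Sum>c\<in>ch v. X n c \<sigma>) / (d * \<theta>))"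

lemma X_eq: "\<sigma> \<in> space spin_space \<Longrightarrow> X n v \<sigma> = \<sigma> v * Y n v (inc \<sigma>)"
proof (induction n arbitrary: v)
  case (Suc n)
  have "X n c \<sigma> = \<sigma> v * (inc \<sigma> c * Y n c (inc \<sigma>))" if c: "c \<in> ch v" for c
  proof -
    have "inc \<sigma> c = \<sigma> c * \<sigma> v" using chD[OF c] by (simp add: inc_def)
    then have "\<sigma> v * (inc \<sigma> c * Y n c (inc \<sigma>)) = (\<sigma> v * \<sigma> v) * (\<sigma> c * Y n c (inc \<sigma>))"
      by (simp add: mult_ac)
    also have "\<dots> = \<sigma> c * Y n c (inc \<sigma>)" by (simp add: spin_square[OF Suc.prems])
    finally show ?thesis by (simp only: Suc.IH[OF Suc.prems])
  qed
  then have "(\<Sum>c\<in>ch v. X n c \<sigma>) = (\<Sum>c\<in>ch v. \<sigma> v * (inc \<sigma> c * Y n c (inc \<sigma>)))" by (rule sum.cong[OF refl])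
  then show ?case by (simp add: sum_distrib_left[symmetric])
qed simp

lemma X_level: "(\<And>u. lev u = lev v + n \<Longrightarrow> \<sigma> u = \<sigma>' u) \<Longrightarrow> X n v \<sigma> = X n v \<sigma>'"
proof (induction n arbitrary: v)
  case (Suc n)
  have "X n c \<sigma> = X n c \<sigma>'" if c: "c \<in> ch v" for c
  proof (rule Suc.IH)
    fix u assume "lev u = lev c + n"
    then show "\<sigma> u = \<sigma>' u" using chD[OF c] by (intro Suc.prems) simp
  qed
  then have "(\<Sum>c\<in>ch v. X n c \<sigma>) = (\<Sum>c\<in>ch v. X n c \<sigma>')" by (rule sum.cong[OF refl])
  then show ?case by simp
qed simp

text \<open>Both edge variables contain the spin of the common parent, whose square is 1.\<close>

lemma agree_spins:
  assumes c: "c \<in> ch v" "c' \<in> ch v"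
  shows "{\<sigma>\<in>space spin_space. inc \<sigma> \<in> agree c c'} = {\<sigma>\<in>space spin_space. evpos (\<lambda>n. X n c \<sigma> * X n c' \<sigma>)}"
proof (rule Collect_cong, rule conj_cong[OF refl])
  fix \<sigma> :: "'v \<Rightarrow> real" assume s: "\<sigma> \<in> space spin_space"
  have "(inc \<sigma> c * Y n c (inc \<sigma>)) * (inc \<sigma> c' * Y n c' (inc \<sigma>)) = X n c \<sigma> * X n c' \<sigma>" for n
  proof -
    have i: "inc \<sigma> c = \<sigma> c * \<sigma> v" "inc \<sigma> c' = \<sigma> c' * \<sigma> v" using chD[OF c(1)] chD[OF c(2)] by (simp_all add: inc_def)
    have "(inc \<sigma> c * Y n c (inc \<sigma>)) * (inc \<sigma> c' * Y n c' (inc \<sigma>)) =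
        (\<sigma> v * \<sigma> v) * ((\<sigma> c * Y n c (inc \<sigma>)) * (\<sigma> c' * Y n c' (inc \<sigma>)))"
      unfolding i by (simp only: mult_ac)
    then show ?thesis by (simp only: X_eq[OF s] spin_square[OF s] mult_1)
  qed
  then show "inc \<sigma> \<in> agree c c' \<longleftrightarrow> evpos (\<lambda>n. X n c \<sigma> * X n c' \<sigma>)"
    using inc_space[OF s] by (simp add: agree_def)
qed

text \<open>A change inside \<open>ball m\<close> affects only the terms with
  \<open>n \<le> m\<close>, and \<open>evpos\<close> ignores finitely many terms.\<close>

lemma agree_tail_event:
  assumes c: "c \<in> ch v" "c' \<in> ch v"
  shows "tail_event {\<sigma>\<in>space spin_space. inc \<sigma> \<in> agree c c'}"
  unfolding tail_event_def
proof (intro conjI allI impI)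
  show "{\<sigma>\<in>space spin_space. inc \<sigma> \<in> agree c c'} \<in> sets spin_space"
  proof -
    have "inc -` agree c c' \<inter> space spin_space \<in> sets spin_space"
      by (rule measurable_sets[OF inc_measurable agree_sets])
    also have "inc -` agree c c' \<inter> space spin_space = {\<sigma>\<in>space spin_space. inc \<sigma> \<in> agree c c'}" by blast
    finally show ?thesis .
  qed
  fix \<Lambda> :: "'v set" and \<sigma> \<sigma>' :: "'v \<Rightarrow> real"
  assume L: "finite \<Lambda>" and s: "\<sigma> \<in> space spin_space" "\<sigma>' \<in> space spin_space"
    and eq: "\<forall>v. v \<notin> \<Lambda> \<longrightarrow> \<sigma> v = \<sigma>' v"
  obtain m where m: "\<Lambda> \<subseteq> ball m" using ball_exhausts[OF L, of 0] by blast
  have X: "X n e \<sigma> = X n e \<sigma>'" if "n \<ge> Suc m" for n e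
  proof (rule X_level)
    fix u assume "lev u = lev e + n"
    then have "u \<notin> ball m" using that by (simp add: ball_def)
    then show "\<sigma> u = \<sigma>' u" using m eq by blast
  qed
  assume "\<sigma> \<in> {\<sigma>\<in>space spin_space. inc \<sigma> \<in> agree c c'}"
  then have "evpos (\<lambda>n. X n c \<sigma> * X n c' \<sigma>)" unfolding agree_spins[OF c] by blast
  then have "evpos (\<lambda>n. X n c \<sigma>' * X n c' \<sigma>')" by (rule evpos_tail[where M = "Suc m"]) (simp only: X)
  then show "\<sigma>' \<in> {\<sigma>\<in>space spin_space. inc \<sigma> \<in> agree c c'}" unfolding agree_spins[OF c] using s by blast
qed

end

section \<open>Extremal measures are not dominated by the free state\<close>

context free_ising_tree
begin

text \<open>Under \<nu> each sibling comparison is deterministic, so \<nu> gives mass 1 to one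
  prescribed outcome at all vertices of level \<open>N\<close>. Under the free state these outcomes
  are independent, each of probability at most \<open>1 - \<delta>\<close>, so domination would
  force \<open>a \<le> (1 - \<delta>)^N\<close> for all \<open>N\<close>.\<close>

lemma extremal_not_dominated:
  assumes ks: "1 < d * \<theta>\<^sup>2" and e: "extremal_gibbs adj \<beta> \<nu>" and a: "0 < a"
  shows "\<exists>A\<in>sets spin_space. measure \<mu> A < a * measure \<nu> A"
proof (rule ccontr)
  assume "\<not> ?thesis"
  then have dom: "a * measure \<nu> A \<le> measure \<mu> A" if "A \<in> sets spin_space" for A
    using that by (meson not_le)
  have g: "gibbs_measure adj \<beta> \<nu>" using e unfolding extremal_gibbs_def by blast
  interpret \<nu>: prob_space \<nu> by (rule gibbs_measureD[OF g])
  have s\<nu>: "sets \<nu> = sets spin_space" and sp\<nu>: "space \<nu> = space spin_space" by (rule gibbs_measureD[OF g])+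
  have "\<exists>c c'. c \<in> ch v \<and> c' \<in> ch v \<and> c \<noteq> c'" for v
    using card_ch_ge[of v] card_le_Suc0_iff_eq[OF finite_ch, of v] by (metis not_less_eq_eq numeral_2_eq_2)
  then obtain c c' where c: "\<And>v. c v \<in> ch v" "\<And>v. c' v \<in> ch v" "\<And>v. c v \<noteq> c' v" by metis
  define T where "T v = {\<sigma>\<in>space spin_space. inc \<sigma> \<in> agree (c v) (c' v)}" for v
  \<comment> \<open>Whichever of agreement and its complement has full mass under \<nu>; the bounds
    of \<open>prob_agree\<close> are symmetric, so both choices cost a factor
    \<open>1 - \<delta>\<close>.\<close>
  define S where "S v = (if measure \<nu> (T v) = 1 then agree (c v) (c' v) else space spin_space - agree (c v) (c' v))" for v
  have T: "tail_event (T v)" for v unfolding T_def by (rule agree_tail_event[OF c(1,2)])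
  have S: "S v \<in> sets spin_space" for v unfolding S_def using agree_sets by auto
  have incS: "{\<sigma>\<in>space spin_space. inc \<sigma> \<in> A} \<in> sets spin_space" if "A \<in> sets spin_space" for A
  proof -
    have "inc -` A \<inter> space spin_space \<in> sets spin_space" by (rule measurable_sets[OF inc_measurable that])
    also have "inc -` A \<inter> space spin_space = {\<sigma>\<in>space spin_space. inc \<sigma> \<in> A}" by blast
    finally show ?thesis .
  qed
  have \<nu>S: "measure \<nu> {\<sigma>\<in>space spin_space. inc \<sigma> \<in> S v} = 1" for v
  proof (cases "measure \<nu> (T v) = 1")
    case True
    then show ?thesis by (simp add: S_def T_def)
  next
    case False
    then have "measure \<nu> (T v) = 0" using extremal_tail_trivial[OF e T] by blast
    moreover have "T v \<in> sets \<nu>" using T unfolding tail_event_def by (simp add: s\<nu>)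
    ultimately have "measure \<nu> (space \<nu> - T v) = 1" by (simp add: \<nu>.prob_compl)
    moreover have "{\<sigma>\<in>space spin_space. inc \<sigma> \<in> S v} = space \<nu> - T v"
      using False inc_space by (auto simp: S_def T_def sp\<nu>)
    ultimately show ?thesis by simp
  qed
  have bound: "a \<le> (1 - \<delta>) ^ N" for N
  proof -
    let ?V = "level N"
    let ?A = "{\<xi>\<in>space spin_space. \<forall>v\<in>?V. \<xi> \<in> S v}"
    have A: "?A \<in> sets spin_space" using S by (intro sets.sets_Collect_finite_All) auto
    have "AE \<sigma> in \<nu>. \<forall>v\<in>?V. inc \<sigma> \<in> S v"
    proof (rule AE_finite_allI[OF finite_level])
      fix v
      have "{\<sigma>\<in>space spin_space. inc \<sigma> \<in> S v} \<in> sets \<nu>" using incS[OF S] by (simp only: s\<nu>)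
      from \<nu>.AE_in_set_eq_1[OF this] \<nu>S[of v] have "AE \<sigma> in \<nu>. \<sigma> \<in> {\<sigma>\<in>space spin_space. inc \<sigma> \<in> S v}" by blast
      then show "AE \<sigma> in \<nu>. inc \<sigma> \<in> S v" by (rule AE_mp) (rule AE_I2, blast)
    qed
    then have "AE \<sigma> in \<nu>. \<sigma> \<in> {\<sigma>\<in>space spin_space. inc \<sigma> \<in> ?A}"
      by (rule AE_mp) (rule AE_I2, use inc_space sp\<nu> in auto)
    moreover have "{\<sigma>\<in>space spin_space. inc \<sigma> \<in> ?A} \<in> sets \<nu>" using incS[OF A] by (simp only: s\<nu>)
    ultimately have "measure \<nu> {\<sigma>\<in>space spin_space. inc \<sigma> \<in> ?A} = 1"
      using \<nu>.AE_in_set_eq_1 by blast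
    then have "a \<le> measure \<mu> {\<sigma>\<in>space spin_space. inc \<sigma> \<in> ?A}"
      using dom[OF incS[OF A]] by simp
    also have "\<dots> = measure edge_measure ?A" by (rule measure_inc[OF A])
    also have "\<dots> = (\<Prod>v\<in>?V. measure edge_measure (S v))"
    proof (rule prob_Inter_levels[OF finite_level _ S])
      show "x \<in> S v \<longleftrightarrow> y \<in> S v" if "v \<in> ?V" "x \<in> space spin_space" "y \<in> space spin_space" "\<And>i. i \<in> desc v \<Longrightarrow> x i = y i" for v x y
        using agree_local[OF c(1)[of v] c(2)[of v] that(2,3) that(4)] that(2,3) by (simp add: S_def)
    qed simp
    also have "\<dots> \<le> (\<Prod>v\<in>?V. 1 - \<delta>)"
    proof (rule prod_mono, rule conjI)
      fix v
      show "0 \<le> measure edge_measure (S v)" by simp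
      have ag: "\<delta> \<le> measure edge_measure (agree (c v) (c' v))" "measure edge_measure (agree (c v) (c' v)) \<le> 1 - \<delta>"
        by (rule prob_agree[OF ks c])+
      have "agree (c v) (c' v) \<in> sets edge_measure" using agree_sets by (simp only: sets_edge_measure)
      from E.prob_compl[OF this] ag show "measure edge_measure (S v) \<le> 1 - \<delta>"
        by (simp add: S_def space_edge_measure)
    qed
    also have "\<dots> = (1 - \<delta>) ^ card ?V" by simp
    also have "\<dots> \<le> (1 - \<delta>) ^ N"
    proof (rule power_decreasing)
      show "N \<le> card ?V" using card_level_ge[of N] by simp
      show "0 \<le> 1 - \<delta>"
        using prob_agree(2)[OF ks c, of r] measure_nonneg[of edge_measure "agree (c r) (c' r)"] by linarith
      show "1 - \<delta> \<le> 1" using \<delta>_pos[OF ks] by simp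
    qed
    finally show ?thesis .
  qed
  have "0 \<le> 1 - \<delta>"
    using prob_agree(2)[OF ks c, of r] measure_nonneg[of edge_measure "agree (c r) (c' r)"] by linarith
  then have "(\<lambda>N. (1 - \<delta>) ^ N) \<longlonglongrightarrow> 0"
    using \<delta>_pos[OF ks] by (intro LIMSEQ_realpow_zero) simp_all
  then have "a \<le> 0" by (rule LIMSEQ_le_const) (use bound in blast)
  with a show False by simp
qed

end

section \<open>Atoms and support of the extremal decomposition\<close>

context rooted_cayley_tree
begin

text \<open>A measure on spin space is determined by countably many evaluations, those on cylinders
  over balls, and evaluations are measurable.\<close>

lemma singleton_extremal_space:
  assumes "extremal_gibbs adj \<beta> \<nu>"
  shows "{\<nu>} \<in> sets (extremal_space adj \<beta>)"
proof -
  have g: "gibbs_measure adj \<beta> \<nu>" using assms unfolding extremal_gibbs_def by blast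
  note D = gibbs_measureD[OF g]
  have sp: "space (extremal_space adj \<beta>) = {\<nu>. prob_space \<nu> \<and> sets \<nu> = sets spin_space \<and> extremal_gibbs adj \<beta> \<nu>}"
    by (auto simp: extremal_space_def space_restrict_space space_prob_algebra)
  have meas: "(\<lambda>\<nu>'. emeasure \<nu>' A) \<in> borel_measurable (extremal_space adj \<beta>)" if "A \<in> sets spin_space" for A
    unfolding extremal_space_def prob_algebra_def
    by (intro measurable_restrict_space1 measurable_emeasure_subprob_algebra that)
  let ?C = "\<lambda>n s. {\<nu>'\<in>space (extremal_space adj \<beta>). emeasure \<nu>' (cyl (ball n) s) = emeasure \<nu> (cyl (ball n) s)}"
  have C: "?C n s \<in> sets (extremal_space adj \<beta>)" if "s \<in> configs (ball n)" for n s
  proof -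
    note [measurable] = meas[OF cyl_sets[OF finite_ball that]]
    show ?thesis by measurable
  qed
  have "{\<nu>} = {\<nu>'\<in>space (extremal_space adj \<beta>). \<forall>n. \<forall>s\<in>configs (ball n). emeasure \<nu>' (cyl (ball n) s) = emeasure \<nu> (cyl (ball n) s)}"
  proof (intro equalityI subsetI)
    fix \<nu>' assume "\<nu>' \<in> {\<nu>}"
    then show "\<nu>' \<in> {\<nu>'\<in>space (extremal_space adj \<beta>). \<forall>n. \<forall>s\<in>configs (ball n). emeasure \<nu>' (cyl (ball n) s) = emeasure \<nu> (cyl (ball n) s)}"
      using assms D by (simp add: sp)
  next
    fix \<nu>' assume n: "\<nu>' \<in> {\<nu>'\<in>space (extremal_space adj \<beta>). \<forall>n. \<forall>s\<in>configs (ball n). emeasure \<nu>' (cyl (ball n) s) = emeasure \<nu> (cyl (ball n) s)}"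
    have "\<nu>' = \<nu>"
    proof (rule measure_eqI_cyl)
      show "sets \<nu>' = sets spin_space" using n by (simp add: sp)
      show "sets \<nu> = sets spin_space" by (rule D)
      show "finite_measure \<nu>'" using n by (simp add: sp prob_space.finite_measure)
      fix J :: "'v set" assume "finite J"
      then obtain m where "J \<subseteq> ball m" using ball_exhausts[of J 0] by blast
      then show "\<exists>K. finite K \<and> J \<subseteq> K \<and> (\<forall>s\<in>configs K. emeasure \<nu>' (cyl K s) = emeasure \<nu> (cyl K s))"
        using n by (intro exI[of _ "ball m"]) simp
    qed
    then show "\<nu>' \<in> {\<nu>}" by simp
  qed
  also have "\<dots> \<in> sets (extremal_space adj \<beta>)"
    by (intro sets.sets_Collect_countable_All sets.sets_Collect_finite_All C finite_configs finite_ball)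
  finally show ?thesis .
qed

end

context free_ising_tree
begin

text \<open>Restricting the mixture to the point \<nu> shows that \<mu> dominates \<nu> times its
  mass under \<open>L\<close>, which is impossible for positive mass.\<close>

theorem extremal_decomposition_no_atoms:
  assumes ks: "1 < d * \<theta>\<^sup>2" and L: "extremal_decomposition adj \<beta> \<mu> L" and e: "extremal_gibbs adj \<beta> \<nu>"
  shows "{\<nu>} \<in> null_sets L"
proof -
  interpret L: prob_space L using L unfolding extremal_decomposition_def by blast
  have sing: "{\<nu>} \<in> sets L"
    using L singleton_extremal_space[OF e] unfolding extremal_decomposition_def by blast
  have mix: "emeasure \<mu> A = (\<integral>\<^sup>+\<nu>. emeasure \<nu> A \<partial>L)" if "A \<in> sets spin_space" for A
    using L that unfolding extremal_decomposition_def by blast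
  have g: "gibbs_measure adj \<beta> \<nu>" using e unfolding extremal_gibbs_def by blast
  interpret \<nu>: prob_space \<nu> by (rule gibbs_measureD[OF g])
  have "measure L {\<nu>} * measure \<nu> A \<le> measure \<mu> A" if A: "A \<in> sets spin_space" for A
  proof -
    have "emeasure \<nu> A * emeasure L {\<nu>} = (\<integral>\<^sup>+\<nu>'. emeasure \<nu> A * indicator {\<nu>} \<nu>' \<partial>L)"
      using sing by (rule nn_integral_cmult_indicator[symmetric])
    also have "\<dots> \<le> (\<integral>\<^sup>+\<nu>'. emeasure \<nu>' A \<partial>L)"
      by (rule nn_integral_mono) (simp add: indicator_def)
    also have "\<dots> = emeasure \<mu> A" by (rule mix[OF A, symmetric])
    finally have "ennreal (measure \<nu> A * measure L {\<nu>}) \<le> ennreal (measure \<mu> A)"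
      by (simp add: \<nu>.emeasure_eq_measure L.emeasure_eq_measure \<mu>.emeasure_eq_measure ennreal_mult)
    then show ?thesis by (simp add: mult.commute)
  qed
  then have "\<not> 0 < measure L {\<nu>}"
    using extremal_not_dominated[OF ks e, of "measure L {\<nu>}"] by (meson not_le)
  then have "emeasure L {\<nu>} = 0"
    using measure_nonneg[of L "{\<nu>}"] by (simp add: L.emeasure_eq_measure)
  then show ?thesis using sing by blast
qed

text \<open>A countable \<open>S\<close> would meet the space of \<open>L\<close>, which consists of
  extremal measures, in a countable union of null singletons.\<close>

theorem extremal_decomposition_support_uncountable:
  assumes ks: "1 < d * \<theta>\<^sup>2" and L: "extremal_decomposition adj \<beta> \<mu> L" and S: "AE \<nu> in L. \<nu> \<in> S"
  shows "uncountable S"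
proof
  assume "countable S"
  interpret L: prob_space L using L unfolding extremal_decomposition_def by blast
  have "sets L = sets (extremal_space adj \<beta>)" using L unfolding extremal_decomposition_def by blast
  then have "space L = space (extremal_space adj \<beta>)" by (rule sets_eq_imp_space_eq)
  then have ext: "extremal_gibbs adj \<beta> \<nu>" if "\<nu> \<in> space L" for \<nu>
    using that by (auto simp: extremal_space_def space_restrict_space)
  have "(\<Union>\<nu>\<in>S \<inter> space L. {\<nu>}) \<in> null_sets L"
  proof (rule null_sets_UN')
    show "countable (S \<inter> space L)" using \<open>countable S\<close> by simp
    show "{\<nu>} \<in> null_sets L" if "\<nu> \<in> S \<inter> space L" for \<nu>
      using that ext by (intro extremal_decomposition_no_atoms[OF ks L]) blast
  qed
  then have "AE \<nu> in L. \<nu> \<notin> (\<Union>\<nu>\<in>S \<inter> space L. {\<nu>})" by (rule AE_not_in)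
  with S AE_space have "AE \<nu> in L. False"
    by eventually_elim blast
  then show False by simp
qed

end

section \<open>The threshold expressed through the inverse hyperbolic tangent\<close>

lemma artanh_le_iff:
  fixes x y :: real
  assumes "\<bar>x\<bar> < 1" "\<bar>y\<bar> < 1"
  shows "artanh x \<le> artanh y \<longleftrightarrow> x \<le> y"
proof -
  have p: "0 < 1 - x" "0 < 1 - y" "0 < 1 + x" "0 < 1 + y" using assms by (auto simp: abs_less_iff)
  have "artanh x \<le> artanh y \<longleftrightarrow> (1 + x) / (1 - x) \<le> (1 + y) / (1 - y)"
    using p by (simp add: artanh_def)
  also have "\<dots> \<longleftrightarrow> (1 + x) * (1 - y) \<le> (1 + y) * (1 - x)"
    using p by (simp add: divide_le_eq le_divide_eq pos_divide_le_eq pos_le_divide_eq mult.commute)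
  also have "\<dots> \<longleftrightarrow> x \<le> y" by (simp add: algebra_simps)
  finally show ?thesis .
qed

lemma (in ising_tree) critical_iff: "\<beta> \<le> artanh (1 / sqrt (real d)) \<longleftrightarrow> d * \<theta>\<^sup>2 \<le> 1"
proof -
  have d: "real d \<ge> 2" using d2 by simp
  have "1 < sqrt (real d)" using d by simp
  then have s: "0 < 1 / sqrt (real d)" "1 / sqrt (real d) < 1" by simp_all
  have "\<beta> = artanh \<theta>" by (simp add: \<theta>_def artanh_tanh_real)
  then have "\<beta> \<le> artanh (1 / sqrt (real d)) \<longleftrightarrow> \<theta> \<le> 1 / sqrt (real d)"
    using artanh_le_iff[of \<theta> "1 / sqrt (real d)"] \<theta> s by simp
  also have "\<dots> \<longleftrightarrow> \<theta>\<^sup>2 \<le> (1 / sqrt (real d))\<^sup>2"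
    using \<theta> s abs_le_square_iff[of \<theta> "1 / sqrt (real d)"] by simp
  also have "\<dots> \<longleftrightarrow> d * \<theta>\<^sup>2 \<le> 1"
    using d by (simp add: power_divide field_simps)
  finally show ?thesis .
qed

theorem corollary1:
  fixes d :: nat and adj :: "'v \<Rightarrow> 'v \<Rightarrow> bool" and \<beta> :: real
    and \<mu> :: "('v \<Rightarrow> real) measure"
  assumes "2 \<le> d" and "cayley_tree d adj" and "0 \<le> \<beta>" and "free_state adj \<beta> \<mu>"
  shows "(\<beta> \<le> artanh (1 / sqrt (real d)) \<longrightarrow> extremal_gibbs adj \<beta> \<mu>) \<and>
    (artanh (1 / sqrt (real d)) < \<beta> \<longrightarrow>
      (\<forall>L. extremal_decomposition adj \<beta> \<mu> L \<longrightarrow>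
        (\<forall>\<nu>. extremal_gibbs adj \<beta> \<nu> \<longrightarrow> {\<nu>} \<in> null_sets L) \<and>
        (\<forall>S. (AE \<nu> in L. \<nu> \<in> S) \<longrightarrow> uncountable S)))"
proof -
  \<comment> \<open>The choice of root is arbitrary: the statement does not mention it.\<close>
  fix r :: 'v
  interpret free_ising_tree d adj r \<beta> \<mu>
    by unfold_locales (rule assms)+
  show ?thesis
  proof (intro conjI impI allI)
    assume "\<beta> \<le> artanh (1 / sqrt (real d))"
    then show "extremal_gibbs adj \<beta> \<mu>"
      unfolding critical_iff by (rule free_state_extremal)
  next
    fix L \<nu>
    assume "artanh (1 / sqrt (real d)) < \<beta>" "extremal_decomposition adj \<beta> \<mu> L" "extremal_gibbs adj \<beta> \<nu>"
    then show "{\<nu>} \<in> null_sets L"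
      using critical_iff by (intro extremal_decomposition_no_atoms) linarith+
  next
    fix L S
    assume "artanh (1 / sqrt (real d)) < \<beta>" "extremal_decomposition adj \<beta> \<mu> L" "AE \<nu> in L. \<nu> \<in> S"
    then show "uncountable S"
      using critical_iff by (intro extremal_decomposition_support_uncountable) linarith+
  qed
qed

end
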